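(* Let $n\ge1$. Suppose the symbol $\sigma:\mathbb{R}^n\times\mathbb{N}_0^n\to\mathbb{C}$ satisfies: for every multi-index $\nu\in\mathbb{N}_0^n$ with $|\nu|\le\lfloor n/2\rfloor+1$ there is a constant $C_\nu$ such that $$\sup_{\xi\in\mathbb{N}_0^n}\big\Vert\partial_x^\nu\sigma(\cdot,\xi)\big\Vert_{L^2(\mathbb{R}^n)}\le C_\nu .$$ Then the Hermite pseudo-multiplier $\sigma(\cdot,\mathcal{L})$ extends to a bounded operator on $L^2(\mathbb{R}^n)$.
   Context: $\mathbb{N}_0=\{0,1,2,\dots\}$; for $\nu\in\mathbb{N}_0^n$, $|\nu|=\nu_1+\dots+\nu_n$. The derivatives $\partial_x^\nu\sigma(\cdot,\xi)$ are understood in the weak (distributional) sense. Hermite functions: for $k\in\mathbb{N}_0$, $H_k(t)=(-1)^k e^{t^2}\partial_t^k(e^{-t^2})$ and $h_k(t)=(2^kk!\sqrt{\pi})^{-1/2}H_k(t)e^{-t^2/2}$, $t\in\mathbb{R}$; for $\xi\in\mathbb{N}_0^n$, $h_\xi(x)=\prod_{j=1}^n h_{\xi_j}(x_j)$, $x\in\mathbb{R}^n$. The family $\{h_\xi\}_{\xi\in\mathbb{N}_0^n}$ is an orthonormal basis of $L^2(\mathbb{R}^n)$ of eigenfunctions of $\mathcal{L}=-\Delta+|x|^2$. Hermite pseudo-multiplier with symbol $\sigma$: $\sigma(x,\mathcal{L})f(x)=\sum_{\xi\in\mathbb{N}_0^n}\sigma(x,\xi)\langle f,h_\xi\rangle h_\xi(x)$,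 where $\langle f,h_\xi\rangle=\int_{\mathbb{R}^n}f h_\xi\,dx$; it is initially defined on finite linear combinations of Hermite functions. *)

theory Defs
  imports "HOL-Analysis.Analysis"
begin

section \<open>Square-integrable functions\<close>

text \<open>
  Elements of \<open>L\<^sup>2(\<real>\<^sup>n)\<close> are handled through representatives: functions are compared
  almost everywhere, and \<open>L2norm\<close> is meaningful on \<open>L2\<close> only.
\<close>

definition L2 :: "(real ^ 'n \<Rightarrow> complex) set" where
  "L2 = {f. f \<in> borel_measurable lebesgue \<and> integrable lebesgue (\<lambda>x. (norm (f x))\<^sup>2)}"

definition L2norm :: "(real ^ 'n \<Rightarrow> complex) \<Rightarrow> real" where
  "L2norm f = sqrt (\<integral>x. (norm (f x))\<^sup>2 \<partial>lebesgue)"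

text \<open>
  Linearity and boundedness together make such a \<open>T\<close> respect almost everywhere equality,
  so it induces a bounded linear operator on the space of equivalence classes.
\<close>

definition bounded_operator_L2 ::
    "((real ^ 'n \<Rightarrow> complex) \<Rightarrow> (real ^ 'n \<Rightarrow> complex)) \<Rightarrow> bool" where
  "bounded_operator_L2 T \<longleftrightarrow>
     (\<forall>f\<in>L2. T f \<in> L2) \<and>
     (\<forall>f\<in>L2. \<forall>g\<in>L2. AE x in lebesgue. T (\<lambda>y. f y + g y) x = T f x + T g x) \<and>
     (\<forall>c. \<forall>f\<in>L2. AE x in lebesgue. T (\<lambda>y. c * f y) x = c * T f x) \<and>
     (\<exists>B. \<forall>f\<in>L2. L2norm (T f) \<le> B * L2norm f)"


section \<open>Weak derivatives\<close>

type_synonym 'n multi_index = "'n \<Rightarrow> nat"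

definition mi_length :: "'n::finite multi_index \<Rightarrow> nat" where
  "mi_length \<nu> = (\<Sum>j\<in>UNIV. \<nu> j)"

definition partial :: "'n::finite \<Rightarrow> (real ^ 'n \<Rightarrow> complex) \<Rightarrow> real ^ 'n \<Rightarrow> complex" where
  "partial j f x = frechet_derivative f (at x) (axis j 1)"

text \<open>
  The index type carries no order, so an arbitrary enumeration of the coordinates is chosen; by
  the symmetry of mixed partial derivatives the choice is immaterial on smooth functions, the
  only ones to which \<open>multi_partial\<close> is applied.
\<close>

definition multi_partial ::
    "'n::finite multi_index \<Rightarrow> (real ^ 'n \<Rightarrow> complex) \<Rightarrow> real ^ 'n \<Rightarrow> complex" where
  "multi_partial \<nu> f =
     foldr (\<lambda>j. partial j ^^ \<nu> j) (SOME js. distinct js \<and> set js = UNIV) f"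

text \<open>
  Differentiability of every iterated partial derivative implies that all of them are continuous,
  so this is \<open>C\<^sup>\<infinity>\<close>.
\<close>

definition smooth :: "(real ^ 'n::finite \<Rightarrow> complex) \<Rightarrow> bool" where
  "smooth f \<longleftrightarrow> (\<forall>js. foldr partial js f differentiable_on UNIV)"

definition test_function :: "(real ^ 'n::finite \<Rightarrow> complex) \<Rightarrow> bool" where
  "test_function \<phi> \<longleftrightarrow> smooth \<phi> \<and> compact (closure {x. \<phi> x \<noteq> 0})"

definition locally_integrable :: "(real ^ 'n \<Rightarrow> complex) \<Rightarrow> bool" where
  "locally_integrable f \<longleftrightarrow> (\<forall>K. compact K \<longrightarrow> set_integrable lebesgue K f)"

definition has_weak_derivative ::
    "'n::finite multi_index \<Rightarrow> (real ^ 'n \<Rightarrow> complex) \<Rightarrow> (real ^ 'n \<Rightarrow> complex) \<Rightarrow> bool" where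
  "has_weak_derivative \<nu> u g \<longleftrightarrow>
     locally_integrable u \<and> locally_integrable g \<and>
     (\<forall>\<phi>. test_function \<phi> \<longrightarrow>
        (\<integral>x. u x * multi_partial \<nu> \<phi> x \<partial>lebesgue) =
        (-1) ^ mi_length \<nu> * (\<integral>x. g x * \<phi> x \<partial>lebesgue))"


section \<open>Hermite functions and pseudo-multipliers\<close>

definition hermite_poly :: "nat \<Rightarrow> real \<Rightarrow> real" where
  "hermite_poly k t = (-1) ^ k * exp (t\<^sup>2) * (deriv ^^ k) (\<lambda>s. exp (- (s\<^sup>2))) t"

definition hermite1 :: "nat \<Rightarrow> real \<Rightarrow> real" where
  "hermite1 k t =
     (2 ^ k * fact k * sqrt pi) powr (-1/2) * hermite_poly k t * exp (- (t\<^sup>2) / 2)"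

definition hermite :: "'n::finite multi_index \<Rightarrow> real ^ 'n \<Rightarrow> real" where
  "hermite \<xi> x = (\<Prod>j\<in>UNIV. hermite1 (\<xi> j) (x $ j))"

definition hermite_coeff :: "(real ^ 'n \<Rightarrow> complex) \<Rightarrow> 'n::finite multi_index \<Rightarrow> complex" where
  "hermite_coeff f \<xi> = (\<integral>x. f x * of_real (hermite \<xi> x) \<partial>lebesgue)"

definition hermite_span :: "(real ^ 'n::finite \<Rightarrow> complex) set" where
  "hermite_span = {f. \<exists>S c. finite S \<and> f = (\<lambda>x. \<Sum>\<xi>\<in>S. c \<xi> * of_real (hermite \<xi> x))}"

text \<open>
  Used on \<open>hermite_span\<close> only, where all but finitely many summands vanish.
\<close>

definition pseudo_multiplier ::
    "(real ^ 'n \<Rightarrow> 'n::finite multi_index \<Rightarrow> complex) \<Rightarrow>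
     (real ^ 'n \<Rightarrow> complex) \<Rightarrow> real ^ 'n \<Rightarrow> complex" where
  "pseudo_multiplier \<sigma> f x =
     (\<Sum>\<^sub>\<infinity>\<xi>. \<sigma> x \<xi> * hermite_coeff f \<xi> * of_real (hermite \<xi> x))"

end

theory Submission
  imports Defs "HOL-Probability.Distributions"
begin

text \<open>
  Fix a finite set \<open>A\<close> of multi-indices and coefficients \<open>c \<xi>\<close>, and write \<open>h \<xi>\<close> for the Hermite
  functions. The value at \<open>y\<close> of the operator applied to \<open>\<Sum>\<xi>\<in>A. c \<xi> h \<xi>\<close> is the value on the
  diagonal \<open>x = y\<close> of
  \<open>U y x = (\<Sum>\<xi>\<in>A. c \<xi> h \<xi> y \<sigma> x \<xi>)\<close>. For fixed \<open>y\<close> the function \<open>U y\<close> is a finite combination of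
  the symbols \<open>\<sigma> \<cdot> \<xi>\<close>, so the Sobolev embedding (more than \<open>n/2\<close> derivatives in \<open>L\<^sup>2\<close> bound the
  supremum) gives
  \<open>\<bar>U y y\<bar>\<^sup>2 \<le> C (\<parallel>U y\<parallel>\<^sup>2 + (\<Sum>j. \<parallel>\<partial>\<^sub>j\<^sup>s U y\<parallel>\<^sup>2))\<close> with \<open>s = n div 2 + 1\<close>. The right-hand side is a
  quadratic form in the numbers \<open>c \<xi> h \<xi> y\<close>; when it is integrated over \<open>y\<close>, orthonormality of the
  Hermite functions removes all cross terms and leaves
  \<open>C (\<Sum>\<xi>\<in>A. \<bar>c \<xi>\<bar>\<^sup>2 (\<parallel>\<sigma> \<cdot> \<xi>\<parallel>\<^sup>2 + (\<Sum>j. \<parallel>\<partial>\<^sub>j\<^sup>s \<sigma> \<cdot> \<xi>\<parallel>\<^sup>2)))\<close>, hence at most a constant times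
  \<open>\<Sum>\<xi>\<in>A. \<bar>c \<xi>\<bar>\<^sup>2\<close>. This is \<open>pseudo_multiplier_bound\<close>.

  The Sobolev bound is proved for mollifications, uniformly in the scale (\<open>mollify_bound\<close>). Let
  \<open>b\<close> be a bump function with integral one and let the mollifier at scale \<open>2 ^ (- k)\<close> be the tensor
  product of dilates of \<open>b\<close>. Passing from scale \<open>k\<close> to scale \<open>k + 1\<close> one coordinate at a
  time replaces one factor \<open>b\<close> by \<open>2 b(2 \<cdot>)\<close>. If \<open>b\<close> has vanishing moments of orders
  \<open>1, \<dots>, s - 1\<close>, then \<open>2 b(2 \<cdot>) - b\<close> is an \<open>s\<close>-th derivative of a bump function
  (\<open>ex_bump_vanishing_moments\<close>). Moving these \<open>s\<close> derivatives to the symbol gains \<open>2 ^ (- k s)\<close>,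
  whereas the \<open>L\<^sup>2\<close> norm of the mollifier costs only \<open>2 ^ (k n / 2)\<close>; as \<open>n < 2 s\<close> the telescoping
  series converges geometrically. Mollifications converge back to the function weakly, when tested against
  continuous functions of compact support (\<open>mollify_weak_convergence\<close>), and such functions
  detect membership in \<open>L\<^sup>2\<close> together with the norm (\<open>L2_by_duality\<close>). The same two facts give the
  fundamental lemma of the calculus of variations, which identifies \<open>\<sigma> \<cdot> \<xi>\<close> almost everywhere with
  its weak derivative of order zero.

  Finally, by Bessel's inequality the Hermite coefficients of any square-integrable function are
  square-summable, so by the bound just described the partial sums of the operator along an
  enumeration of the multi-indices form a Cauchy sequence. Completeness of \<open>L\<^sup>2\<close>
  (\<open>L2_complete\<close>) provides the limit, and this limit defines the extension
  (\<open>extension_by_hermite_expansion\<close>).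
\<close>

section \<open>Smooth functions of one variable\<close>

text \<open>
  Since \<open>deriv\<close> is total, differentiability has to be demanded of every iterate.
\<close>

definition smooth1 :: "(real \<Rightarrow> real) \<Rightarrow> bool" where
  "smooth1 f \<longleftrightarrow> (\<forall>m t. ((deriv ^^ m) f has_real_derivative (deriv ^^ Suc m) f t) (at t))"

definition bump :: "(real \<Rightarrow> real) \<Rightarrow> bool" where
  "bump f \<longleftrightarrow> smooth1 f \<and> (\<exists>R. \<forall>t. \<bar>t\<bar> > R \<longrightarrow> f t = 0)"

text \<open>
  A chain of successive derivatives determines the iterates of \<open>deriv\<close>; closure properties of
  \<open>smooth1\<close> are obtained by writing down such a chain.
\<close>

lemma smooth1_family:
  assumes "F 0 = f" and "\<And>m t. (F m has_real_derivative F (Suc m) t) (at t)"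
  shows "smooth1 f" and "(deriv ^^ m) f = F m"
proof -
  have eq: "(deriv ^^ m) f = F m" for m
  proof (induction m)
    case (Suc m)
    have "deriv (F m) = F (Suc m)"
      using assms(2) by (auto intro: DERIV_imp_deriv)
    then show ?case using Suc by simp
  qed (use assms(1) in simp)
  show "(deriv ^^ m) f = F m" by (rule eq)
  show "smooth1 f" unfolding smooth1_def using eq assms(2) by metis
qed

lemma smooth1_DERIV:
  "smooth1 f \<Longrightarrow> ((deriv ^^ m) f has_real_derivative (deriv ^^ Suc m) f t) (at t)"
  by (auto simp: smooth1_def)

lemma smooth1_DERIV_0: "smooth1 f \<Longrightarrow> (f has_real_derivative deriv f t) (at t)"
  using smooth1_DERIV[of f 0 t] by simp

lemma smooth1_continuous: "smooth1 f \<Longrightarrow> continuous_on A ((deriv ^^ m) f)"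
  by (meson DERIV_continuous_on has_field_derivative_at_within smooth1_DERIV)

lemma smooth1_affine:
  assumes "smooth1 f"
  shows "smooth1 (\<lambda>t. c * f (a * t + b))"
    and "(deriv ^^ m) (\<lambda>t. c * f (a * t + b)) = (\<lambda>t. c * a ^ m * (deriv ^^ m) f (a * t + b))"
proof -
  define F where "F = (\<lambda>m t. c * a ^ m * (deriv ^^ m) f (a * t + b))"
  have "(F m has_real_derivative F (Suc m) t) (at t)" for m t
  proof -
    have "((\<lambda>t. a * t + b) has_real_derivative a) (at t)" by (auto intro!: derivative_eq_intros)
    from DERIV_cmult[OF DERIV_chain2[OF smooth1_DERIV[OF assms] this], of "c * a ^ m" m]
    show ?thesis by (simp add: F_def mult_ac)
  qed
  then show "smooth1 (\<lambda>t. c * f (a * t + b))"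
      and "(deriv ^^ m) (\<lambda>t. c * f (a * t + b)) = (\<lambda>t. c * a ^ m * (deriv ^^ m) f (a * t + b))"
    using smooth1_family[of F "\<lambda>t. c * f (a * t + b)"] by (auto simp: F_def)
qed

lemma smooth1_lincomb:
  assumes "smooth1 f" "smooth1 g"
  shows "smooth1 (\<lambda>t. c * f t + d * g t)"
    and "(deriv ^^ m) (\<lambda>t. c * f t + d * g t) = (\<lambda>t. c * (deriv ^^ m) f t + d * (deriv ^^ m) g t)"
proof -
  define F where "F = (\<lambda>m t. c * (deriv ^^ m) f t + d * (deriv ^^ m) g t)"
  have "(F m has_real_derivative F (Suc m) t) (at t)" for m t
    unfolding F_def
    by (intro DERIV_add DERIV_cmult smooth1_DERIV assms)
  then show "smooth1 (\<lambda>t. c * f t + d * g t)"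
      and "(deriv ^^ m) (\<lambda>t. c * f t + d * g t) = (\<lambda>t. c * (deriv ^^ m) f t + d * (deriv ^^ m) g t)"
    using smooth1_family[of F "\<lambda>t. c * f t + d * g t"] by (auto simp: F_def)
qed

lemma smooth1_antiderivative:
  assumes "smooth1 f" and "\<And>t. (X has_real_derivative f t) (at t)"
  shows "smooth1 X"
proof -
  define F where "F = (\<lambda>m. case m of 0 \<Rightarrow> X | Suc k \<Rightarrow> (deriv ^^ k) f)"
  have "(F m has_real_derivative F (Suc m) t) (at t)" for m t
    unfolding F_def using smooth1_DERIV[OF assms(1)] assms(2) by (cases m) auto
  then show ?thesis using smooth1_family[of F X] by (auto simp: F_def)
qed

lemma bump_smooth1: "bump f \<Longrightarrow> smooth1 f"
  by (simp add: bump_def)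

lemma bump_bound:
  assumes "bump f"
  obtains R where "R > 0" "\<And>t. \<bar>t\<bar> > R \<Longrightarrow> f t = 0"
proof -
  obtain R where R: "\<forall>t. \<bar>t\<bar> > R \<longrightarrow> f t = 0" using assms by (auto simp: bump_def)
  show ?thesis by (rule that[of "max R 1"]) (use R in auto)
qed

lemma bump_affine:
  assumes "bump f" "a \<noteq> 0"
  shows "bump (\<lambda>t. c * f (a * t + b))"
proof -
  obtain R where R: "R > 0" "\<And>t. \<bar>t\<bar> > R \<Longrightarrow> f t = 0" using bump_bound[OF assms(1)] by blast
  have "c * f (a * t + b) = 0" if "\<bar>t\<bar> > (R + \<bar>b\<bar>) / \<bar>a\<bar>" for t
  proof -
    have "\<bar>a * t\<bar> > R + \<bar>b\<bar>" using that assms(2) by (simp add: field_simps abs_mult)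
    then have "\<bar>a * t + b\<bar> > R" by linarith
    then show ?thesis using R by simp
  qed
  then show ?thesis using smooth1_affine[OF bump_smooth1[OF assms(1)]] by (auto simp: bump_def)
qed

lemma bump_lincomb:
  assumes "bump f" "bump g"
  shows "bump (\<lambda>t. c * f t + d * g t)"
proof -
  obtain R where R: "\<And>t. \<bar>t\<bar> > R \<Longrightarrow> f t = 0" using bump_bound[OF assms(1)] by blast
  obtain R' where R': "\<And>t. \<bar>t\<bar> > R' \<Longrightarrow> g t = 0" using bump_bound[OF assms(2)] by blast
  have "\<forall>t. \<bar>t\<bar> > max R R' \<longrightarrow> c * f t + d * g t = 0" using R R' by simp
  then show ?thesis
    using smooth1_lincomb(1)[OF assms[THEN bump_smooth1], of c d] unfolding bump_def by blast
qed

lemma bump_continuous: "bump f \<Longrightarrow> continuous_on A f"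
  using smooth1_continuous[of f A 0] by (simp add: bump_smooth1)

lemma bump_borel: "bump f \<Longrightarrow> f \<in> borel_measurable borel"
  using bump_continuous borel_measurable_continuous_onI by blast

lemma integrable_compact_support:
  fixes f :: "'a::euclidean_space \<Rightarrow> 'b::euclidean_space"
  assumes "continuous_on UNIV f" "compact K" "\<And>x. x \<notin> K \<Longrightarrow> f x = 0"
  shows "integrable lborel f"
proof -
  have "set_integrable lborel K f"
    by (rule borel_integrable_compact[unfolded set_integrable_def[symmetric]])
      (use assms continuous_on_subset[OF assms(1)] in auto)
  moreover have "(\<lambda>x. indicator K x *\<^sub>R f x) = f" using assms(3) by (auto simp: indicator_def)
  ultimately show ?thesis by (simp add: set_integrable_def)
qed

lemma bump_integrable:
  assumes "bump f" shows "integrable lborel f"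
proof -
  obtain R where R: "\<And>t. \<bar>t\<bar> > R \<Longrightarrow> f t = 0" using bump_bound[OF assms] by blast
  show ?thesis
    by (rule integrable_compact_support[where K = "{-R..R}"]) (use R bump_continuous[OF assms] in \<open>auto simp: not_le\<close>)
qed

lemma bump_square_integrable:
  assumes "bump f" shows "integrable lborel (\<lambda>t. (f t)\<^sup>2)"
proof -
  obtain R where R: "\<And>t. \<bar>t\<bar> > R \<Longrightarrow> f t = 0" using bump_bound[OF assms] by blast
  show ?thesis
    by (rule integrable_compact_support[where K = "{-R..R}"])
      (use R bump_continuous[OF assms] in \<open>auto simp: not_le intro!: continuous_intros\<close>)
qed

text \<open>
  An antiderivative \<open>X\<close> of a bump function is constant to the left and to the right of the support,
  so \<open>X (2 * t) - X t\<close> has compact support even though \<open>X\<close> need not. Its derivative is the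
  dilation difference of \<open>f\<close>; the two functions have the same integral, which is why this difference
  has a compactly supported antiderivative.
\<close>

lemma bump_dilation_antiderivative:
  assumes "bump f"
  obtains g where "bump g" "deriv g = (\<lambda>t. 2 * f (2 * t) - f t)"
proof -
  obtain R where R: "R > 0" "\<And>t. \<bar>t\<bar> > R \<Longrightarrow> f t = 0" using bump_bound[OF assms] by blast
  have "\<exists>X. \<forall>x::real. -\<infinity> < ereal x \<longrightarrow> ereal x < \<infinity> \<longrightarrow> (X has_vector_derivative f x) (at x)"
    by (rule einterval_antiderivative)
      (use bump_continuous[OF assms, of UNIV] in \<open>auto simp: continuous_on_eq_continuous_at\<close>)
  then obtain X where X: "\<And>x. (X has_real_derivative f x) (at x)"
    by (auto simp: has_real_derivative_iff_has_vector_derivative)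
  have smX: "smooth1 X" by (rule smooth1_antiderivative[OF bump_smooth1[OF assms] X])
  define g where "g = (\<lambda>t. 1 * X (2 * t) + (-1) * X t)"
  have sm2: "smooth1 (\<lambda>t. X (2 * t))" using smooth1_affine(1)[OF smX, of 1 2 0] by simp
  have smg: "smooth1 g" unfolding g_def by (rule smooth1_lincomb(1)[OF sm2 smX])
  \<comment> \<open>\<open>X\<close> is constant on each of the half-lines outside the support of \<open>f\<close>.\<close>
  have right: "X (2 * t) = X t" if "t > R" for t
  proof (rule DERIV_isconst2[of t "2 * t" X])
    show "t < 2 * t" using that R by simp
    show "continuous_on {t..2 * t} X" using X DERIV_continuous_on has_field_derivative_at_within by blast
    show "DERIV X x :> 0" if "t < x" for x
      using X[of x] R(2)[of x] that \<open>t > R\<close> R(1) by simp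
  qed (use that R in auto)
  have left: "X (2 * t) = X t" if "t < - R" for t
  proof (rule sym, rule DERIV_isconst2[of "2 * t" t X])
    show "2 * t < t" using that R by simp
    show "continuous_on {2*t..t} X" using X DERIV_continuous_on has_field_derivative_at_within by blast
    show "DERIV X x :> 0" if "x < t" for x
      using X[of x] R(2)[of x] that \<open>t < - R\<close> R(1) by simp
  qed (use that R in auto)
  have "g t = 0" if "\<bar>t\<bar> > R" for t
    using that left[of t] right[of t] unfolding g_def by (cases "t > 0") auto
  then have "bump g" using smg by (auto simp: bump_def)
  moreover have "deriv g = (\<lambda>t. 2 * f (2 * t) - f t)"
  proof
    fix t
    have "(g has_real_derivative 1 * (f (2 * t) * 2) + (-1) * f t) (at t)"
      unfolding g_def
      by (intro DERIV_add DERIV_cmult X DERIV_chain2[OF X]) (auto intro!: derivative_eq_intros)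
    then show "deriv g t = 2 * f (2 * t) - f t" by (simp add: DERIV_imp_deriv)
  qed
  ultimately show ?thesis by (rule that)
qed

lemma integral_dilation:
  fixes f :: "real \<Rightarrow> real"
  assumes "c > 0"
  shows "(\<integral>t. c * f (c * t + b) \<partial>lborel) = (\<integral>t. f t \<partial>lborel)"
proof -
  have "(\<integral>t. f t \<partial>lborel) = \<bar>c\<bar> *\<^sub>R (\<integral>t. f (b + c * t) \<partial>lborel)"
    by (rule lborel_integral_real_affine) (use assms in simp)
  then show ?thesis using assms by (simp add: add.commute)
qed

text \<open>
  Let \<open>D b = 2 * b (2 * \<cdot>)\<close> be the dilation operator, which preserves integrals. It satisfies
  \<open>2 ^ s * D (deriv ^^ s) \<kappa> = (deriv ^^ s) (D \<kappa>)\<close>. Hence if \<open>D b - b\<close> is the \<open>s\<close>-th derivative of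
  \<open>\<kappa>\<close>, applying \<open>2 ^ s * D - 1\<close> to it gives the \<open>s\<close>-th derivative of \<open>D \<kappa> - \<kappa>\<close>, which has a
  compactly supported antiderivative. Division by \<open>2 ^ s - 1\<close> restores the integral one; this
  is where \<open>s \<ge> 1\<close> is needed.
\<close>

lemma bump_moment_step:
  assumes b: "bump b" "(\<integral>t. b t \<partial>lborel) = 1"
    and chi: "bump \<kappa>" "\<And>t. 2 * b (2 * t) - b t = (deriv ^^ s) \<kappa> t" and s: "s \<ge> 1"
  obtains b' \<kappa>' where "bump b'" "(\<integral>t. b' t \<partial>lborel) = 1" "bump \<kappa>'"
    "\<And>t. 2 * b' (2 * t) - b' t = (deriv ^^ Suc s) \<kappa>' t"
proof -
  define q :: real where "q = 2 ^ s - 1"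
  have q: "q > 0" using s one_less_power[of "2::real" s] by (simp add: q_def)
  have Sb: "bump (\<lambda>t. 2 * b (2 * t))" using bump_affine[OF b(1), of 2 2 0] by simp
  \<comment> \<open>The operator \<open>(2 ^ s * D - 1) / (2 ^ s - 1)\<close> applied to \<open>b\<close>.\<close>
  define b' where "b' = (\<lambda>t. (2 ^ s / q) * (2 * b (2 * t)) + (- 1 / q) * b t)"
  obtain g where g: "bump g" "deriv g = (\<lambda>t. 2 * \<kappa> (2 * t) - \<kappa> t)"
    using bump_dilation_antiderivative[OF chi(1)] .
  define \<kappa>' where "\<kappa>' = (\<lambda>t. (1 / q) * g (1 * t + 0))"
  have 1: "bump b'" unfolding b'_def by (rule bump_lincomb[OF Sb b(1)])
  have 3: "bump \<kappa>'" unfolding \<kappa>'_def by (rule bump_affine[OF g(1)]) simp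
  have "(\<integral>t. b' t \<partial>lborel) = (\<integral>t. (2 ^ s / q) * (2 * b (2 * t)) \<partial>lborel) + (\<integral>t. (- 1 / q) * b t \<partial>lborel)"
    unfolding b'_def
    by (intro Bochner_Integration.integral_add integrable_mult_right bump_integrable Sb b(1))
  also have "(\<integral>t. (2 ^ s / q) * (2 * b (2 * t)) \<partial>lborel) = (2 ^ s / q) * (\<integral>t. 2 * b (2 * t) \<partial>lborel)"
    by (rule Bochner_Integration.integral_mult_right_zero)
  also have "(\<integral>t. 2 * b (2 * t) \<partial>lborel) = 1" using integral_dilation[of 2 b 0] b(2) by simp
  also have "(\<integral>t. (- 1 / q) * b t \<partial>lborel) = (- 1 / q) * 1"
    by (subst Bochner_Integration.integral_mult_right_zero) (simp only: b(2))
  also have "2 ^ s / q * 1 + (- 1 / q) * 1 = 1" using q by (simp add: field_simps) (simp add: q_def)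
  finally have 2: "(\<integral>t. b' t \<partial>lborel) = 1" .
  have smchi: "smooth1 \<kappa>" by (rule bump_smooth1[OF chi(1)])
  have sm2: "smooth1 (\<lambda>t. 2 * \<kappa> (2 * t + 0))" by (rule smooth1_affine(1)[OF smchi])
  have "(deriv ^^ Suc s) \<kappa>' t = 2 * b' (2 * t) - b' t" for t
  proof -
    have "(deriv ^^ Suc s) \<kappa>' t = (1 / q) * (deriv ^^ Suc s) g t"
      unfolding \<kappa>'_def by (subst smooth1_affine(2)[OF bump_smooth1[OF g(1)]]) simp
    also have "(deriv ^^ Suc s) g = (deriv ^^ s) (\<lambda>t. 1 * (2 * \<kappa> (2 * t + 0)) + (-1) * \<kappa> t)"
      unfolding funpow_Suc_right by (simp add: g(2))
    also have "\<dots> t = 2 * 2 ^ s * (deriv ^^ s) \<kappa> (2 * t) - (deriv ^^ s) \<kappa> t"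
      unfolding smooth1_lincomb(2)[OF sm2 smchi] smooth1_affine(2)[OF smchi] by simp
    also have "\<dots> = 2 * 2 ^ s * (2 * b (2 * (2 * t)) - b (2 * t)) - (2 * b (2 * t) - b t)"
      by (simp only: chi(2))
    also have "(1 / q) * \<dots> = 2 * b' (2 * t) - b' t"
      using q by (simp add: b'_def field_simps)
    finally show ?thesis .
  qed
  then show ?thesis using that[OF 1 2 3] by simp
qed

text \<open>
  The classical flat function \<open>exp (- 1 / t)\<close>, with a polynomial in \<open>1 / t\<close> as a factor: in this
  form the family is closed under differentiation, also at the origin.
\<close>

definition flat_exp :: "real poly \<Rightarrow> real \<Rightarrow> real" where
  "flat_exp p t = (if t > 0 then poly p (1 / t) * exp (- (1 / t)) else 0)"

lemma poly_exp_tendsto_0: "((\<lambda>x. poly p x * exp (- x)) \<longlongrightarrow> (0::real)) at_top"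
proof -
  have "((\<lambda>x. \<Sum>i\<le>degree p. coeff p i * (x ^ i / exp x)) \<longlongrightarrow> (\<Sum>i\<le>degree p. coeff p i * 0)) at_top"
    by (intro tendsto_intros tendsto_power_div_exp_0)
  then show ?thesis
    by (simp add: poly_altdef exp_minus sum_distrib_right divide_inverse mult.assoc)
qed

lemma DERIV_flat_exp:
  "(flat_exp p has_real_derivative flat_exp ([:0, 0, 1:] * (p - pderiv p)) t) (at t)"
proof -
  consider "t > 0" | "t < 0" | "t = 0" by linarith
  then show ?thesis
  proof cases
    case 1
    have "((\<lambda>t. poly p (1 / t) * exp (- (1 / t))) has_real_derivative
        (poly ([:0, 0, 1:] * (p - pderiv p)) (1 / t) * exp (- (1 / t)))) (at t)"
      using 1 by (auto intro!: derivative_eq_intros simp: field_simps power2_eq_square)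
    moreover have "eventually (\<lambda>x. (x::real) > 0) (nhds t)" using eventually_nhds_in_open[of "{0<..}" t] 1 by simp
    ultimately show ?thesis
      using 1 by (subst DERIV_cong_ev[OF refl _ refl, where g = "\<lambda>t. poly p (1 / t) * exp (- (1 / t))"])
        (auto simp: flat_exp_def elim!: eventually_mono)
  next
    case 2
    have "eventually (\<lambda>x. (x::real) < 0) (nhds t)" using eventually_nhds_in_open[of "{..<0}" t] 2 by simp
    then show ?thesis
      using 2 by (subst DERIV_cong_ev[OF refl _ refl, where g = "\<lambda>t. 0"])
        (auto simp: flat_exp_def elim!: eventually_mono)
  next
    case 3
    \<comment> \<open>At the origin the difference quotient is \<open>y * poly p y * exp (- y)\<close> with \<open>y = 1 / h\<close>, on the right.\<close>
    have "((\<lambda>h. (flat_exp p (0 + h) - flat_exp p 0) / h) \<longlongrightarrow> 0) (at 0)"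
    proof (rule filterlim_split_at)
      have "((\<lambda>h. 0) \<longlongrightarrow> (0::real)) (at_left 0)" by simp
      then show "((\<lambda>h. (flat_exp p (0 + h) - flat_exp p 0) / h) \<longlongrightarrow> 0) (at_left 0)"
        by (rule Lim_transform_eventually)
          (auto simp: flat_exp_def eventually_at_filter)
      have "((\<lambda>h. poly ([:0, 1:] * p) (inverse h) * exp (- inverse h)) \<longlongrightarrow> (0::real)) (at_right 0)"
        by (rule filterlim_compose[OF poly_exp_tendsto_0 filterlim_inverse_at_top_right])
      then show "((\<lambda>h. (flat_exp p (0 + h) - flat_exp p 0) / h) \<longlongrightarrow> 0) (at_right 0)"
        by (rule Lim_transform_eventually)
          (auto simp: flat_exp_def eventually_at_filter field_simps)
    qed
    then show ?thesis using 3 by (simp add: DERIV_def flat_exp_def)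
  qed
qed

text \<open>
  A class of functions supported in \<open>{-1..1}\<close> that is closed under differentiation by the product
  rule; this yields smoothness of all its members at once.
\<close>

inductive_set flat_products :: "(real \<Rightarrow> real) set" where
  base: "(\<lambda>t. c * flat_exp p (1 + t) * flat_exp q (1 - t)) \<in> flat_products"
| add: "f \<in> flat_products \<Longrightarrow> g \<in> flat_products \<Longrightarrow> (\<lambda>t. f t + g t) \<in> flat_products"

lemma DERIV_flat_products:
  assumes "f \<in> flat_products"
  shows "\<exists>f'\<in>flat_products. \<forall>t. (f has_real_derivative f' t) (at t)"
  using assms
proof induction
  case (base c p q)
  let ?D = "\<lambda>p. [:0, 0, 1:] * (p - pderiv p)"
  let ?f = "\<lambda>t. c * flat_exp (?D p) (1 + t) * flat_exp q (1 - t)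
              + (- c) * flat_exp p (1 + t) * flat_exp (?D q) (1 - t)"
  have 1: "((\<lambda>t. flat_exp p (1 + t)) has_real_derivative flat_exp (?D p) (1 + t) * 1) (at t)" for p t
    by (rule DERIV_chain2[OF DERIV_flat_exp]) (auto intro!: derivative_eq_intros)
  have 2: "((\<lambda>t. flat_exp p (1 - t)) has_real_derivative flat_exp (?D p) (1 - t) * (-1)) (at t)" for p t
    by (rule DERIV_chain2[OF DERIV_flat_exp]) (auto intro!: derivative_eq_intros)
  have "((\<lambda>t. c * flat_exp p (1 + t) * flat_exp q (1 - t)) has_real_derivative ?f t) (at t)" for t
    by (rule DERIV_cong[OF DERIV_mult[OF DERIV_cmult[OF 1] 2]]) (simp add: algebra_simps)
  then have "\<forall>t. ((\<lambda>t. c * flat_exp p (1 + t) * flat_exp q (1 - t)) has_real_derivative ?f t) (at t)"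
    by blast
  moreover have "?f \<in> flat_products"
    by (rule flat_products.add) (rule flat_products.base)+
  ultimately show ?case by (rule rev_bexI[rotated])
next
  case (add f g)
  then obtain f' g' where "f' \<in> flat_products" "g' \<in> flat_products"
    "\<And>t. (f has_real_derivative f' t) (at t)" "\<And>t. (g has_real_derivative g' t) (at t)" by metis
  then have "(\<lambda>t. f' t + g' t) \<in> flat_products"
      "\<And>t. ((\<lambda>t. f t + g t) has_real_derivative f' t + g' t) (at t)"
    by (simp_all add: DERIV_add flat_products.add)
  then show ?case by (intro bexI[of _ "\<lambda>t. f' t + g' t"]) simp_all
qed

lemma ex_unit_bump: "\<exists>b. bump b \<and> (\<integral>t. b t \<partial>lborel) = 1"
proof -
  define f where "f = (\<lambda>t. 1 * flat_exp 1 (1 + t) * flat_exp 1 (1 - t))"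
  have f: "f \<in> flat_products" unfolding f_def by (rule flat_products.base)
  have iter: "(deriv ^^ m) f \<in> flat_products" for m
  proof (induction m)
    case (Suc m)
    obtain f' where f': "f' \<in> flat_products" "\<And>t. ((deriv ^^ m) f has_real_derivative f' t) (at t)"
      using DERIV_flat_products[OF Suc] by blast
    then have "deriv ((deriv ^^ m) f) = f'" by (auto intro: DERIV_imp_deriv)
    then show ?case using f' by simp
  qed (use f in simp)
  have "smooth1 f"
    unfolding smooth1_def
  proof (intro allI)
    fix m t
    obtain f' where f': "\<And>t. ((deriv ^^ m) f has_real_derivative f' t) (at t)"
      using DERIV_flat_products[OF iter] by blast
    then show "((deriv ^^ m) f has_real_derivative (deriv ^^ Suc m) f t) (at t)"
      using DERIV_imp_deriv[OF f'] by simp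
  qed
  moreover have supp: "f t = 0" if "\<bar>t\<bar> > 1" for t
    using that by (auto simp: f_def flat_exp_def abs_if split: if_splits)
  ultimately have f: "bump f" unfolding bump_def by blast
  have pos: "f t > 0" if "\<bar>t\<bar> < 1" for t
    using that by (auto simp: f_def flat_exp_def)
  have nonneg: "f t \<ge> 0" for t by (auto simp: f_def flat_exp_def)
  have "(\<integral>t. f t \<partial>lborel) \<noteq> 0"
  proof
    assume "(\<integral>t. f t \<partial>lborel) = 0"
    then have "AE t in lborel. f t = 0"
      using integral_nonneg_eq_0_iff_AE[OF bump_integrable[OF f]] nonneg by auto
    then have "AE t::real in lborel. t \<notin> {-1<..<1}"
      by (rule eventually_mono) (use pos in \<open>force simp: abs_less_iff\<close>)
    then have "emeasure lborel {-1<..<(1::real)} = 0"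
      using AE_iff_measurable[of "{-1<..<(1::real)}" lborel "\<lambda>t. t \<notin> {-1<..<1}"]
      by (auto simp: set_eq_iff)
    then show False by simp
  qed
  then show ?thesis
    using bump_affine[OF f, of 1 "1 / (\<integral>t. f t \<partial>lborel)" 0]
    by (intro exI[of _ "\<lambda>t. (1 / (\<integral>t. f t \<partial>lborel)) * f t"]) auto
qed

text \<open>
  The condition says that \<open>b\<close> has vanishing moments of orders \<open>1, \<dots>, s - 1\<close>, in the form in which it is
  used: the difference of two consecutive dyadic mollifiers is an \<open>s\<close>-th derivative.
\<close>

lemma ex_bump_vanishing_moments:
  assumes "s \<ge> 1"
  obtains b \<kappa> where "bump b" "(\<integral>t. b t \<partial>lborel) = 1" "bump \<kappa>"
    "\<And>t. 2 * b (2 * t) - b t = (deriv ^^ s) \<kappa> t"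
  using assms
proof (induction s arbitrary: thesis rule: nat_induct_at_least)
  case base
  obtain b where b: "bump b" "(\<integral>t. b t \<partial>lborel) = 1" using ex_unit_bump by blast
  obtain g where "bump g" "deriv g = (\<lambda>t. 2 * b (2 * t) - b t)"
    using bump_dilation_antiderivative[OF b(1)] .
  then show ?case using base[OF b, of g] by simp
next
  case (Suc n)
  obtain b \<kappa> where "bump b" "(\<integral>t. b t \<partial>lborel) = 1" "bump \<kappa>"
    "\<And>t. 2 * b (2 * t) - b t = (deriv ^^ n) \<kappa> t" using Suc.IH by blast
  from bump_moment_step[OF this Suc.hyps] show ?case using Suc.prems by blast
qed

section \<open>Orthonormality of the Hermite functions\<close>

text \<open>
  The physicists' Hermite polynomials, generated by the recurrence that differentiation of
  \<open>exp (- t\<^sup>2)\<close> produces.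
\<close>

fun herm :: "nat \<Rightarrow> real poly" where
  "herm 0 = 1"
| "herm (Suc k) = [:0, 2:] * herm k - pderiv (herm k)"

lemma pderiv_herm: "pderiv (herm (Suc k)) = smult (2 * real (Suc k)) (herm k)"
proof (induction k)
  case (Suc k)
  have "pderiv (herm (Suc (Suc k))) = smult 2 (herm (Suc k)) + [:0, 2:] * pderiv (herm (Suc k))
          - pderiv (pderiv (herm (Suc k)))"
    by (subst herm.simps(2)) (simp add: pderiv_diff pderiv_mult pderiv_pCons pderiv_smult del: herm.simps)
  also have "\<dots> = smult 2 (herm (Suc k)) + smult (2 * real (Suc k)) ([:0, 2:] * herm k - pderiv (herm k))"
    by (simp add: Suc pderiv_smult smult_diff_right del: herm.simps mult_pCons_left)
  also have "[:0, 2:] * herm k - pderiv (herm k) = herm (Suc k)" by simp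
  also have "smult 2 (herm (Suc k)) + smult (2 * real (Suc k)) (herm (Suc k)) = smult (2 * real (Suc (Suc k))) (herm (Suc k))"
    by (simp add: smult_add_left[symmetric] del: herm.simps)
  finally show ?case .
qed (simp add: pderiv_pCons)

lemma higher_deriv_gaussian:
  "(deriv ^^ k) (\<lambda>s::real. exp (- (s\<^sup>2))) = (\<lambda>t. (-1) ^ k * poly (herm k) t * exp (- (t\<^sup>2)))"
proof (induction k)
  case (Suc k)
  have "((\<lambda>t. (-1) ^ k * poly (herm k) t * exp (- (t\<^sup>2))) has_real_derivative
      (-1) ^ Suc k * poly (herm (Suc k)) t * exp (- (t\<^sup>2))) (at t)" for t :: real
    by (auto intro!: derivative_eq_intros simp: algebra_simps)
  then show ?case using Suc by (auto intro: DERIV_imp_deriv)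
qed simp

lemma hermite_poly_eq: "hermite_poly k t = poly (herm k) t"
proof -
  have "hermite_poly k t = ((-1) ^ k * (-1) ^ k) * (exp (t\<^sup>2) * exp (- (t\<^sup>2))) * poly (herm k) t"
    unfolding hermite_poly_def higher_deriv_gaussian by simp
  also have "\<dots> = poly (herm k) t" by (simp add: power_mult_distrib[symmetric] exp_minus)
  finally show ?thesis .
qed

lemma integrable_monomial_gaussian: "integrable lborel (\<lambda>x::real. x ^ k * exp (- (x\<^sup>2)))"
proof (cases "even k")
  case True
  then obtain m where k: "k = 2 * m" by (elim evenE)
  have "has_bochner_integral lborel (\<lambda>x::real. exp (-x\<^sup>2) * x ^ (2 * m))
     (2 *\<^sub>R ((sqrt pi / 2) * (fact (2 * m) / (2 ^ (2 * m) * fact m))))"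
    by (rule has_bochner_integral_even_function[OF gaussian_moment_even_pos]) simp
  then show ?thesis by (auto simp: k mult.commute has_bochner_integral_iff)
next
  case False
  then obtain m where k: "k = 2 * m + 1" by (elim oddE)
  have "has_bochner_integral lborel (\<lambda>x::real. exp (-x\<^sup>2) * x ^ (2 * m + 1)) 0"
    by (rule has_bochner_integral_odd_function[OF gaussian_moment_odd_pos]) simp
  then show ?thesis by (auto simp: k mult.commute has_bochner_integral_iff)
qed

lemma integrable_poly_gaussian: "integrable lborel (\<lambda>x::real. poly p x * exp (- (x\<^sup>2)))"
proof -
  have "integrable lborel (\<lambda>x::real. \<Sum>i\<le>degree p. coeff p i * (x ^ i * exp (- (x\<^sup>2))))"
    by (intro Bochner_Integration.integrable_sum integrable_mult_right integrable_monomial_gaussian)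
  then show ?thesis by (simp add: poly_altdef sum_distrib_right mult.assoc)
qed

lemma poly_gaussian_at_top: "((\<lambda>x::real. poly p x * exp (- (x\<^sup>2))) \<longlongrightarrow> 0) at_top"
proof (rule Lim_null_comparison)
  show "((\<lambda>x. norm (poly p x * exp (- x))) \<longlongrightarrow> 0) at_top"
    using poly_exp_tendsto_0[of p] by (rule tendsto_norm_zero)
  show "eventually (\<lambda>x. norm (poly p x * exp (- (x\<^sup>2))) \<le> norm (poly p x * exp (- x))) at_top"
    using eventually_ge_at_top[of 1]
  proof eventually_elim
    case (elim x)
    then have "x \<le> x\<^sup>2" by (simp add: power2_eq_square)
    then show ?case by (auto simp: abs_mult intro!: mult_left_mono)
  qed
qed

lemma poly_gaussian_at_bot: "((\<lambda>x::real. poly p x * exp (- (x\<^sup>2))) \<longlongrightarrow> 0) at_bot"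
  using poly_gaussian_at_top[of "pcompose p [:0, -1:]"]
  by (simp add: filterlim_at_bot_mirror poly_pcompose)

lemma integral_pderiv_gaussian:
  fixes q :: "real poly"
  shows "(\<integral>x. poly (pderiv q - [:0, 2:] * q) x * exp (- (x\<^sup>2)) \<partial>lborel) = 0"
proof -
  define f where "f = (\<lambda>x::real. poly (pderiv q - [:0, 2:] * q) x * exp (- (x\<^sup>2)))"
  define F where "F = (\<lambda>x::real. poly q x * exp (- (x\<^sup>2)))"
  have F: "(F has_real_derivative f x) (at x)" for x
    unfolding F_def f_def by (auto intro!: derivative_eq_intros simp: algebra_simps)
  have "(LBINT x=-\<infinity>..\<infinity>. f x) = 0 - 0"
  proof (rule interval_integral_FTC_integrable)
    show "(F has_vector_derivative f x) (at x)" for x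
      using F by (simp add: has_real_derivative_iff_has_vector_derivative)
    show "isCont f x" for x unfolding f_def by (intro continuous_intros)
    show "set_integrable lborel (einterval (-\<infinity>) \<infinity>) f"
      using integrable_poly_gaussian[of "pderiv q - [:0, 2:] * q"]
      by (simp add: set_integrable_def f_def)
    show "((F \<circ> real_of_ereal) \<longlongrightarrow> 0) (at_right (-\<infinity>))" "((F \<circ> real_of_ereal) \<longlongrightarrow> 0) (at_left \<infinity>)"
      using poly_gaussian_at_top poly_gaussian_at_bot by (simp_all add: ereal_tendsto_simps F_def)
  qed simp
  then show ?thesis by (simp add: interval_lebesgue_integral_def set_lebesgue_integral_def f_def)
qed

text \<open>
  Integration by parts: \<open>herm (Suc k)\<close> is the adjoint of differentiation, with respect to the
  Gaussian weight, applied to \<open>herm k\<close>.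
\<close>

lemma integral_herm_Suc:
  "(\<integral>x. poly (q * herm (Suc k)) x * exp (- (x\<^sup>2)) \<partial>lborel) = (\<integral>x. poly (pderiv q * herm k) x * exp (- (x\<^sup>2)) \<partial>lborel)"
proof -
  have "pderiv q * herm k - q * herm (Suc k) = pderiv (q * herm k) - [:0, 2:] * (q * herm k)"
    by (simp add: pderiv_mult algebra_simps)
  then have "(\<integral>x. poly (pderiv q * herm k - q * herm (Suc k)) x * exp (- (x\<^sup>2)) \<partial>lborel) = 0"
    by (simp only: integral_pderiv_gaussian)
  moreover have "poly (pderiv q * herm k - q * herm (Suc k)) x * exp (- (x\<^sup>2))
     = poly (pderiv q * herm k) x * exp (- (x\<^sup>2)) - poly (q * herm (Suc k)) x * exp (- (x\<^sup>2))" for x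
    by (simp only: poly_diff left_diff_distrib)
  ultimately show ?thesis
    using Bochner_Integration.integral_diff[OF integrable_poly_gaussian integrable_poly_gaussian]
    by (simp only: right_minus_eq)
qed

text \<open>
  Both indices drop by one under integration by parts because \<open>pderiv (herm (Suc j))\<close> is a multiple
  of \<open>herm j\<close>; when one index reaches zero first, the derivative of a constant appears.
\<close>

lemma integral_herm_herm:
  "(\<integral>x. poly (herm j * herm k) x * exp (- (x\<^sup>2)) \<partial>lborel) = (if j = k then 2 ^ k * fact k * sqrt pi else 0)"
proof (induction k arbitrary: j)
  case 0
  show ?case
  proof (cases j)
    case 0
    have "has_bochner_integral lborel (\<lambda>x::real. exp (-x\<^sup>2)) (2 *\<^sub>R (sqrt pi / 2))"
      by (rule has_bochner_integral_even_function[OF gaussian_moment_0]) simp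
    then show ?thesis using 0 by (simp add: has_bochner_integral_iff)
  next
    case (Suc i)
    then show ?thesis using integral_herm_Suc[of 1 i] by simp
  qed
next
  case (Suc k)
  show ?case
  proof (cases j)
    case 0
    then show ?thesis using integral_herm_Suc[of 1 k] by simp
  next
    case (Suc i)
    have "(\<integral>x. poly (herm j * herm (Suc k)) x * exp (- (x\<^sup>2)) \<partial>lborel)
        = (\<integral>x. 2 * real (Suc i) * (poly (herm i * herm k) x * exp (- (x\<^sup>2))) \<partial>lborel)"
      unfolding Suc integral_herm_Suc pderiv_herm by (simp only: mult_smult_left poly_smult mult.assoc)
    also have "\<dots> = 2 * real (Suc i) * (if i = k then 2 ^ k * fact k * sqrt pi else 0)"
      by (subst Bochner_Integration.integral_mult_right_zero) (simp only: Suc.IH)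
    finally show ?thesis by (simp add: Suc algebra_simps)
  qed
qed

lemma hermite1_mult:
  "hermite1 j t * hermite1 k t = (2 ^ j * fact j * sqrt pi) powr (-1/2) * (2 ^ k * fact k * sqrt pi) powr (-1/2) *
     (poly (herm j * herm k) t * exp (- (t\<^sup>2)))"
proof -
  have "exp (- (t\<^sup>2)) = exp (- (t\<^sup>2) / 2) * exp (- (t\<^sup>2) / 2)"
    by (simp add: exp_add[symmetric])
  then show ?thesis by (simp add: hermite1_def hermite_poly_eq mult_ac)
qed

lemma hermite1_mult_integrable: "integrable lborel (\<lambda>t. hermite1 j t * hermite1 k t)"
  unfolding hermite1_mult by (intro integrable_mult_right integrable_poly_gaussian)

lemma hermite1_orthonormal:
  "(\<integral>t. hermite1 j t * hermite1 k t \<partial>lborel) = (if j = k then 1 else 0)"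
proof -
  have "(\<integral>t. hermite1 j t * hermite1 k t \<partial>lborel) =
      (2 ^ j * fact j * sqrt pi) powr (-1/2) * (2 ^ k * fact k * sqrt pi) powr (-1/2) *
       (if j = k then 2 ^ k * fact k * sqrt pi else 0)"
    unfolding hermite1_mult by (subst Bochner_Integration.integral_mult_right_zero) (simp only: integral_herm_herm)
  moreover have "(c::real) powr (-1/2) * c powr (-1/2) * c = 1" if "c > 0" for c
  proof -
    have "c powr (-1/2) * c powr (-1/2) = c powr (-1)" by (subst powr_add[symmetric]) simp
    then show ?thesis using that by (simp add: powr_minus_divide)
  qed
  ultimately show ?thesis by simp
qed

lemma hermite1_continuous: "continuous_on A (hermite1 k)"
  unfolding hermite1_def hermite_poly_eq by (intro continuous_intros) auto

text \<open>
  Lebesgue measure on \<open>real ^ 'n\<close> is the image of a product measure indexed by \<open>Basis\<close>, so integrals of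
  products over the coordinates factorise.
\<close>

lemma lborel_vec_prod:
  fixes f :: "'n::finite \<Rightarrow> real \<Rightarrow> real"
  assumes "\<And>j. integrable lborel (f j)"
  shows "integrable lborel (\<lambda>x::real^'n. \<Prod>j\<in>UNIV. f j (x $ j))"
    and "integral\<^sup>L lborel (\<lambda>x::real^'n. \<Prod>j\<in>UNIV. f j (x $ j)) = (\<Prod>j\<in>UNIV. \<integral>t. f j t \<partial>lborel)"
proof -
  define e :: "'n \<Rightarrow> real^'n" where "e = (\<lambda>j. axis j 1)"
  have e: "inj e" "range e = Basis"
    by (auto simp: e_def inj_on_def axis_eq_axis Basis_vec_def)
  interpret product_sigma_finite "\<lambda>_::real^'n. lborel :: real measure" by standard
  define g where "g = (\<lambda>b. f (inv e b))"
  have g: "integrable lborel (g b)" for b unfolding g_def by (rule assms)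
  have [measurable]: "f j \<in> borel_measurable borel" for j
    using borel_measurable_integrable[OF assms[of j]] by simp
  let ?T = "\<lambda>y. \<Sum>b\<in>Basis. y b *\<^sub>R (b :: real^'n)"
  have comp: "?T y $ j = y (e j)" for y j
  proof -
    have "?T y $ j = ?T y \<bullet> e j" by (simp add: e_def inner_axis)
    also have "\<dots> = y (e j)" using e by (subst inner_sum_left_Basis) auto
    finally show ?thesis .
  qed
  have prod_eq: "(\<Prod>j\<in>UNIV. f j (?T y $ j)) = (\<Prod>b\<in>Basis. g b (y b))" for y
  proof -
    have "(\<Prod>j\<in>UNIV. f j (?T y $ j)) = (\<Prod>j\<in>UNIV. f j (y (e j)))" by (simp only: comp)
    also have "\<dots> = (\<Prod>b\<in>range e. g b (y b))"
      by (subst prod.reindex) (use e(1) in \<open>auto simp: g_def\<close>)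
    finally show ?thesis by (simp only: e(2))
  qed
  have meas: "(\<lambda>x::real^'n. \<Prod>j\<in>UNIV. f j (x $ j)) \<in> borel_measurable borel"
    by measurable
  have T: "?T \<in> measurable (\<Pi>\<^sub>M b\<in>Basis. lborel) borel" by measurable
  show "integrable lborel (\<lambda>x::real^'n. \<Prod>j\<in>UNIV. f j (x $ j))"
    by (subst lborel_eq, subst integrable_distr_eq[OF T meas], subst prod_eq)
      (rule product_integrable_prod[OF _ g], simp)
  show "integral\<^sup>L lborel (\<lambda>x::real^'n. \<Prod>j\<in>UNIV. f j (x $ j)) = (\<Prod>j\<in>UNIV. \<integral>t. f j t \<partial>lborel)"
    apply (subst lborel_eq, subst integral_distr[OF T meas], subst prod_eq)
    apply (subst product_integral_prod[OF _ g], simp)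
    unfolding e(2)[symmetric] by (subst prod.reindex) (use e(1) in \<open>auto simp: g_def\<close>)
qed

lemma hermite_continuous: "continuous_on A (hermite \<xi>)"
proof -
  have "continuous_on A (\<lambda>x. hermite1 (\<xi> j) (x $ j))" for j
    by (rule continuous_on_compose2[OF hermite1_continuous[of UNIV]]) (auto intro!: continuous_intros)
  then show ?thesis unfolding hermite_def by (intro continuous_on_prod)
qed

lemma hermite_orthonormal:
  fixes \<xi> \<eta> :: "'n::finite multi_index"
  shows "integrable lborel (\<lambda>x::real^'n. hermite \<xi> x * hermite \<eta> x)"
    and "integral\<^sup>L lborel (\<lambda>x::real^'n. hermite \<xi> x * hermite \<eta> x) = (if \<xi> = \<eta> then 1 else 0)"
proof -
  have eq: "hermite \<xi> x * hermite \<eta> x = (\<Prod>j\<in>UNIV. hermite1 (\<xi> j) (x $ j) * hermite1 (\<eta> j) (x $ j))" for x :: "real^'n"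
    by (simp add: hermite_def prod.distrib)
  show "integrable lborel (\<lambda>x::real^'n. hermite \<xi> x * hermite \<eta> x)"
    unfolding eq by (rule lborel_vec_prod(1)) (rule hermite1_mult_integrable)
  have "integral\<^sup>L lborel (\<lambda>x::real^'n. hermite \<xi> x * hermite \<eta> x) = (\<Prod>j\<in>UNIV. if \<xi> j = \<eta> j then 1 else 0)"
    unfolding eq by (subst lborel_vec_prod(2)) (auto intro: hermite1_mult_integrable simp: hermite1_orthonormal)
  also have "\<dots> = (if \<xi> = \<eta> then 1 else 0)"
    by (auto simp: fun_eq_iff)
  finally show "integral\<^sup>L lborel (\<lambda>x::real^'n. hermite \<xi> x * hermite \<eta> x) = (if \<xi> = \<eta> then 1 else 0)" .
qed

section \<open>Tensor products of bump functions as test functions\<close>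

definition tensor :: "('n::finite \<Rightarrow> real \<Rightarrow> real) \<Rightarrow> real ^ 'n \<Rightarrow> complex" where
  "tensor f x = of_real (\<Prod>j\<in>UNIV. f j (x $ j))"

lemma tensor_has_derivative:
  fixes f :: "'n::finite \<Rightarrow> real \<Rightarrow> real"
  assumes "\<And>i. smooth1 (f i)"
  shows "(tensor f has_derivative
     (\<lambda>h. of_real (\<Sum>i\<in>UNIV. deriv (f i) (x $ i) * h $ i * (\<Prod>l\<in>UNIV - {i}. f l (x $ l))))) (at x)"
proof -
  have 1: "((\<lambda>x. f i (x $ i)) has_derivative (\<lambda>h. deriv (f i) (x $ i) * h $ i)) (at x)" for i
  proof -
    have "(f i has_derivative (*) (deriv (f i) (x $ i))) (at (x $ i))"
      using smooth1_DERIV_0[OF assms[of i]] by (simp add: has_field_derivative_def)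
    moreover have "((\<lambda>x. x $ i) has_derivative (\<lambda>h. h $ i)) (at x)"
      by (rule bounded_linear_imp_has_derivative[OF bounded_linear_vec_nth])
    ultimately show ?thesis by (rule has_derivative_compose[rotated])
  qed
  have "((\<lambda>x. \<Prod>i\<in>UNIV. f i (x $ i)) has_derivative
      (\<lambda>h. \<Sum>i\<in>UNIV. deriv (f i) (x $ i) * h $ i * (\<Prod>l\<in>UNIV - {i}. f l (x $ l)))) (at x)"
    by (rule has_derivative_prod) (rule 1)
  then show ?thesis unfolding tensor_def[abs_def] by (rule has_derivative_of_real)
qed

lemma partial_tensor:
  fixes f :: "'n::finite \<Rightarrow> real \<Rightarrow> real"
  assumes "\<And>i. smooth1 (f i)"
  shows "partial j (tensor f) = tensor (f(j := deriv (f j)))"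
proof
  fix x :: "real^'n"
  have "partial j (tensor f) x =
     of_real (\<Sum>i\<in>UNIV. deriv (f i) (x $ i) * axis j 1 $ i * (\<Prod>l\<in>UNIV - {i}. f l (x $ l)))"
    unfolding partial_def frechet_derivative_at[OF tensor_has_derivative[OF assms], symmetric] ..
  also have "(\<Sum>i\<in>UNIV. deriv (f i) (x $ i) * axis j 1 $ i * (\<Prod>l\<in>UNIV - {i}. f l (x $ l)))
     = (\<Sum>i\<in>UNIV. if i = j then deriv (f j) (x $ j) * (\<Prod>l\<in>UNIV - {j}. f l (x $ l)) else 0)"
    by (intro sum.cong) (auto simp: axis_def)
  also have "\<dots> = (\<Prod>i\<in>UNIV. (f(j := deriv (f j))) i (x $ i))"
    by (subst prod.remove[of UNIV j]) auto
  finally show "partial j (tensor f) x = tensor (f(j := deriv (f j))) x"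
    unfolding tensor_def[of "f(j := deriv (f j))"] .
qed

lemma smooth1_deriv: "smooth1 f \<Longrightarrow> smooth1 ((deriv ^^ k) f)"
  unfolding smooth1_def
proof (intro allI)
  fix m t assume "\<forall>m t. ((deriv ^^ m) f has_real_derivative (deriv ^^ Suc m) f t) (at t)"
  then have "((deriv ^^ (m + k)) f has_real_derivative (deriv ^^ Suc (m + k)) f t) (at t)" by blast
  then show "((deriv ^^ m) ((deriv ^^ k) f) has_real_derivative (deriv ^^ Suc m) ((deriv ^^ k) f) t) (at t)"
    by (simp add: funpow_add)
qed

lemma foldr_partial_tensor:
  assumes "\<And>i. smooth1 (f i)"
  shows "\<exists>g. (\<forall>i. smooth1 (g i)) \<and> foldr partial js (tensor f) = tensor g"
proof (induction js)
  case (Cons j js)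
  then obtain g where g: "\<And>i. smooth1 (g i)" "foldr partial js (tensor f) = tensor g" by blast
  have "\<forall>i. smooth1 ((g(j := deriv (g j))) i)" using g(1) smooth1_deriv[of "g j" 1] by simp
  moreover have "foldr partial (j # js) (tensor f) = tensor (g(j := deriv (g j)))"
    using g by (simp add: partial_tensor)
  ultimately show ?case by blast
qed (use assms in auto)

lemma test_function_tensor:
  fixes f :: "'n::finite \<Rightarrow> real \<Rightarrow> real"
  assumes "\<And>i. bump (f i)"
  shows "test_function (tensor f)"
proof -
  have "smooth (tensor f)"
    unfolding smooth_def
  proof
    fix js
    obtain g where g: "\<And>i. smooth1 (g i)" "foldr partial js (tensor f) = tensor g"
      using foldr_partial_tensor[of f js] bump_smooth1[OF assms] by blast
    have "tensor g differentiable at x" for x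
      using tensor_has_derivative[of g, OF g(1)] unfolding differentiable_def by blast
    then show "foldr partial js (tensor f) differentiable_on UNIV"
      by (simp add: g(2) differentiable_on_def)
  qed
  moreover have "bounded {x. tensor f x \<noteq> 0}"
  proof -
    have "\<forall>i. \<exists>R. \<forall>t. \<bar>t\<bar> > R \<longrightarrow> f i t = 0" using assms by (auto simp: bump_def)
    then obtain R where R: "\<And>i t. \<bar>t\<bar> > R i \<Longrightarrow> f i t = 0" by metis
    have "norm x \<le> (\<Sum>i\<in>UNIV. R i)" if "tensor f x \<noteq> 0" for x :: "real^'n"
    proof -
      have "f i (x $ i) \<noteq> 0" for i using that by (auto simp: tensor_def)
      then have "\<bar>x $ i\<bar> \<le> R i" for i using R[of i "x $ i"] by force
      then have "(\<Sum>i\<in>UNIV. \<bar>x $ i\<bar>) \<le> (\<Sum>i\<in>UNIV. R i)" by (intro sum_mono)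
      then show ?thesis using norm_le_l1_cart[of x] by linarith
    qed
    then show ?thesis by (auto simp: bounded_iff)
  qed
  ultimately show ?thesis by (simp add: test_function_def compact_closure)
qed

lemma partial_pow_tensor:
  assumes "\<And>i. smooth1 (f i)"
  shows "(partial j ^^ m) (tensor f) = tensor (f(j := (deriv ^^ m) (f j)))"
proof (induction m)
  case (Suc m)
  have "smooth1 ((f(j := (deriv ^^ m) (f j))) i)" for i using assms smooth1_deriv by simp
  note sm = this
  have "(partial j ^^ Suc m) (tensor f) = partial j (tensor (f(j := (deriv ^^ m) (f j))))"
    by (simp only: funpow.simps o_apply Suc)
  also have "\<dots> = tensor (f(j := (deriv ^^ Suc m) (f j)))"
    unfolding partial_tensor[of "f(j := (deriv ^^ m) (f j))", OF sm, of j]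
    by (simp only: fun_upd_upd fun_upd_same funpow.simps o_apply)
  finally show ?case .
qed simp

lemma foldr_partial_pow_tensor:
  assumes "\<And>i. smooth1 (f i)" "distinct js"
  shows "foldr (\<lambda>j. partial j ^^ \<nu> j) js (tensor f) = tensor (\<lambda>i. if i \<in> set js then (deriv ^^ \<nu> i) (f i) else f i)"
  using assms(2)
proof (induction js)
  case (Cons j js)
  let ?g = "\<lambda>i. if i \<in> set js then (deriv ^^ \<nu> i) (f i) else f i"
  have "smooth1 (?g i)" for i using assms(1) smooth1_deriv by simp
  then have "(partial j ^^ \<nu> j) (tensor ?g) = tensor (?g(j := (deriv ^^ \<nu> j) (?g j)))"
    by (rule partial_pow_tensor)
  also have "?g(j := (deriv ^^ \<nu> j) (?g j)) = (\<lambda>i. if i \<in> set (j # js) then (deriv ^^ \<nu> i) (f i) else f i)"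
    using Cons.prems by (auto simp: fun_eq_iff)
  finally show ?case using Cons by simp
qed simp

text \<open>
  Partial derivatives act on a tensor product factor by factor, so iterating them along any list of
  distinct coordinates that exhausts the index type differentiates each factor the prescribed number of times.
\<close>

lemma multi_partial_tensor:
  fixes f :: "'n::finite \<Rightarrow> real \<Rightarrow> real"
  assumes "\<And>i. smooth1 (f i)"
  shows "multi_partial \<nu> (tensor f) = tensor (\<lambda>i. (deriv ^^ \<nu> i) (f i))"
proof -
  let ?P = "\<lambda>js::'n list. distinct js \<and> set js = UNIV"
  obtain xs :: "'n list" where "set xs = UNIV" "distinct xs" using finite_distinct_list[of "UNIV :: 'n set"] by auto
  then have "?P (SOME js. ?P js)" by (intro someI[of ?P xs]) simp
  then show ?thesis unfolding multi_partial_def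
    by (subst foldr_partial_pow_tensor) (use assms in auto)
qed

lemma tensor_continuous:
  assumes "\<And>i. continuous_on UNIV (f i)"
  shows "continuous_on A (tensor f)"
proof -
  have "continuous_on A (\<lambda>x. f j (x $ j))" for j
    by (rule continuous_on_compose2[OF assms]) (auto intro!: continuous_intros)
  then show ?thesis unfolding tensor_def[abs_def] by (intro continuous_intros)
qed

lemma tensor_integral_sq:
  fixes f :: "'n::finite \<Rightarrow> real \<Rightarrow> real"
  assumes "\<And>i. bump (f i)"
  shows "integrable lborel (\<lambda>x. (norm (tensor f x))\<^sup>2)"
    and "(\<integral>x. (norm (tensor f x))\<^sup>2 \<partial>lborel) = (\<Prod>i\<in>UNIV. \<integral>t. (f i t)\<^sup>2 \<partial>lborel)"
proof -
  have eq: "(norm (tensor f x))\<^sup>2 = (\<Prod>i\<in>UNIV. (f i (x $ i))\<^sup>2)" for x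
    by (simp only: tensor_def norm_of_real power2_abs prod_power_distrib)
  show "integrable lborel (\<lambda>x. (norm (tensor f x))\<^sup>2)"
    unfolding eq by (rule lborel_vec_prod(1)) (rule bump_square_integrable[OF assms])
  show "(\<integral>x. (norm (tensor f x))\<^sup>2 \<partial>lborel) = (\<Prod>i\<in>UNIV. \<integral>t. (f i t)\<^sup>2 \<partial>lborel)"
    unfolding eq by (rule lborel_vec_prod(2)) (rule bump_square_integrable[OF assms])
qed

lemma tensor_integral:
  fixes f :: "'n::finite \<Rightarrow> real \<Rightarrow> real"
  assumes "\<And>i. bump (f i)"
  shows "integrable lborel (tensor f)"
    and "(\<integral>x. tensor f x \<partial>lborel) = of_real (\<Prod>i\<in>UNIV. \<integral>t. f i t \<partial>lborel)"
proof -
  note L = lborel_vec_prod[OF bump_integrable[OF assms]]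
  show "integrable lborel (tensor f)"
    unfolding tensor_def[abs_def] using L(1) by (rule integrable_of_real)
  show "(\<integral>x. tensor f x \<partial>lborel) = of_real (\<Prod>i\<in>UNIV. \<integral>t. f i t \<partial>lborel)"
    unfolding tensor_def[abs_def] by (simp only: integral_complex_of_real L(2))
qed

text \<open>
  The factor \<open>2 ^ k\<close> preserves the integral, so tensor products of such dilates concentrate at the point
  with coordinates \<open>x\<close> as \<open>k\<close> grows.
\<close>

definition dilate :: "nat \<Rightarrow> real \<Rightarrow> (real \<Rightarrow> real) \<Rightarrow> real \<Rightarrow> real" where
  "dilate k x f t = 2 ^ k * f (2 ^ k * (t - x))"

lemma dilate_affine: "dilate k x f = (\<lambda>t. 2 ^ k * f (2 ^ k * t + (- (2 ^ k * x))))"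
  by (simp add: dilate_def fun_eq_iff algebra_simps)

lemma bump_dilate: "bump f \<Longrightarrow> bump (dilate k x f)"
  unfolding dilate_affine by (rule bump_affine) simp_all

lemma dilate_deriv:
  assumes "smooth1 f" shows "(deriv ^^ m) (dilate k x f) = (\<lambda>t. (2 ^ k) ^ m * dilate k x ((deriv ^^ m) f) t)"
  unfolding dilate_affine smooth1_affine(2)[OF assms] by (simp add: mult_ac)

lemma integral_dilate: "(\<integral>t. dilate k x f t \<partial>lborel) = (\<integral>t. f t \<partial>lborel)"
  unfolding dilate_affine by (rule integral_dilation) simp

lemma integral_dilate_sq: "(\<integral>t. (dilate k x f t)\<^sup>2 \<partial>lborel) = 2 ^ k * (\<integral>t. (f t)\<^sup>2 \<partial>lborel)"
proof -
  have "(\<integral>t. (dilate k x f t)\<^sup>2 \<partial>lborel) = (\<integral>t. 2 ^ k * dilate k x (\<lambda>t. (f t)\<^sup>2) t \<partial>lborel)"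
    by (simp add: dilate_def power_mult_distrib power2_eq_square mult_ac)
  also have "\<dots> = 2 ^ k * (\<integral>t. (f t)\<^sup>2 \<partial>lborel)"
    by (subst Bochner_Integration.integral_mult_right_zero) (simp only: integral_dilate)
  finally show ?thesis .
qed

section \<open>Square-integrability by duality\<close>

definition Cc :: "(real ^ 'n \<Rightarrow> complex) \<Rightarrow> bool" where
  "Cc G \<longleftrightarrow> continuous_on UNIV G \<and> (\<exists>R. \<forall>x. norm x > R \<longrightarrow> G x = 0)"

lemma borel_lebesgue: "f \<in> borel_measurable borel \<Longrightarrow> f \<in> borel_measurable lebesgue"
  by (simp add: measurable_completion)

lemma integrable_mult_squares:
  fixes f g :: "'a \<Rightarrow> complex"
  assumes [measurable]: "f \<in> borel_measurable M" "g \<in> borel_measurable M"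
    and "integrable M (\<lambda>x. (norm (f x))\<^sup>2)" "integrable M (\<lambda>x. (norm (g x))\<^sup>2)"
  shows "integrable M (\<lambda>x. f x * g x)"
proof (rule Bochner_Integration.integrable_bound)
  show "integrable M (\<lambda>x. (norm (f x))\<^sup>2 + (norm (g x))\<^sup>2)" using assms by simp
  show "AE x in M. norm (f x * g x) \<le> norm ((norm (f x))\<^sup>2 + (norm (g x))\<^sup>2)"
  proof (rule AE_I2)
    fix x
    have "0 \<le> (norm (f x) - norm (g x))\<^sup>2 + norm (f x) * norm (f x) + norm (g x) * norm (g x)"
      by simp
    then have "norm (f x) * norm (g x) \<le> (norm (f x))\<^sup>2 + (norm (g x))\<^sup>2"
      by (simp add: power2_eq_square algebra_simps)
    then show "norm (f x * g x) \<le> norm ((norm (f x))\<^sup>2 + (norm (g x))\<^sup>2)"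
      by (simp add: norm_mult)
  qed
qed measurable

text \<open>
  The integral of \<open>(t * norm (f x) - norm (g x))\<^sup>2\<close> is a nonnegative quadratic polynomial in \<open>t\<close>.
\<close>

lemma Cauchy_Schwarz_integral:
  fixes f g :: "'a \<Rightarrow> complex"
  assumes [measurable]: "f \<in> borel_measurable M" "g \<in> borel_measurable M"
    and f: "integrable M (\<lambda>x. (norm (f x))\<^sup>2)" and g: "integrable M (\<lambda>x. (norm (g x))\<^sup>2)"
  shows "(norm (\<integral>x. f x * g x \<partial>M))\<^sup>2 \<le> (\<integral>x. (norm (f x))\<^sup>2 \<partial>M) * (\<integral>x. (norm (g x))\<^sup>2 \<partial>M)"
proof -
  define p where "p = (\<integral>x. norm (f x * g x) \<partial>M)"
  define a where "a = (\<integral>x. (norm (f x))\<^sup>2 \<partial>M)"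
  define b where "b = (\<integral>x. (norm (g x))\<^sup>2 \<partial>M)"
  have fg: "integrable M (\<lambda>x. norm (f x * g x))"
    by (rule integrable_norm[OF integrable_mult_squares[OF assms]])
  have a0: "a \<ge> 0" and b0: "b \<ge> 0" and p0: "p \<ge> 0" unfolding a_def b_def p_def by simp_all
  have quad: "0 \<le> t\<^sup>2 * a - 2 * t * p + b" for t
  proof -
    have "0 \<le> (\<integral>x. (t * norm (f x) - norm (g x))\<^sup>2 \<partial>M)" by simp
    also have "\<dots> = (\<integral>x. t\<^sup>2 * (norm (f x))\<^sup>2 - 2 * t * norm (f x * g x) + (norm (g x))\<^sup>2 \<partial>M)"
      by (intro Bochner_Integration.integral_cong) (auto simp: power2_eq_square norm_mult algebra_simps)
    also have "\<dots> = t\<^sup>2 * a - 2 * t * p + b"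
      using f g fg by (simp add: a_def b_def p_def)
    finally show ?thesis .
  qed
  have "p\<^sup>2 \<le> a * b"
  proof (cases "a = 0")
    case True
    have "p = 0"
    proof (rule ccontr)
      assume "p \<noteq> 0"
      then show False using quad[of "(b + 1) / (2 * p)"] True by (simp add: field_simps)
    qed
    then show ?thesis using True by simp
  next
    case False
    then have "a > 0" using a0 by simp
    then show ?thesis using quad[of "p / a"] by (simp add: field_simps power2_eq_square)
  qed
  moreover have "norm (\<integral>x. f x * g x \<partial>M) \<le> p" unfolding p_def by (rule integral_norm_bound)
  ultimately show ?thesis unfolding a_def b_def by (meson norm_ge_zero order_trans power_mono)
qed

lemma Cc_bound:
  fixes G :: "real ^ 'n::finite \<Rightarrow> complex"
  assumes "Cc G" obtains M R where "M > 0" "R > 0" "\<And>x. norm (G x) \<le> M" "\<And>x. norm x > R \<Longrightarrow> G x = 0"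
proof -
  obtain R where R: "\<And>x. norm x > R \<Longrightarrow> G x = 0" using assms by (auto simp: Cc_def)
  have "compact (G ` cball 0 R)"
    using assms by (intro compact_continuous_image) (auto simp: Cc_def intro: continuous_on_subset)
  then have "bounded (G ` cball 0 R)" by (rule compact_imp_bounded)
  then obtain M where "\<forall>x\<in>cball 0 R. norm (G x) \<le> M" by (auto simp: bounded_iff)
  then have M: "norm (G x) \<le> M" if "norm x \<le> R" for x using that by simp
  show ?thesis
  proof (rule that[of "max M 1" "max R 1"])
    show "norm (G x) \<le> max M 1" for x using M[of x] R[of x] by (cases "norm x \<le> R") auto
  qed (use R in auto)
qed

lemma Cc_measurable: "Cc G \<Longrightarrow> G \<in> borel_measurable borel"
  by (auto simp: Cc_def intro: borel_measurable_continuous_onI)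

lemma locally_integrable_measurable:
  fixes F :: "real ^ 'n::finite \<Rightarrow> complex"
  assumes "locally_integrable F" shows "F \<in> borel_measurable lebesgue"
proof (rule borel_measurable_LIMSEQ_metric)
  fix i :: nat
  have "set_integrable lebesgue (cball 0 (real i)) F" using assms by (auto simp: locally_integrable_def)
  then show "(\<lambda>x. indicator (cball 0 (real i)) x *\<^sub>R F x) \<in> borel_measurable lebesgue"
    by (auto simp: set_integrable_def)
next
  fix x :: "real ^ 'n"
  obtain N where N: "norm x \<le> real N" using real_arch_simple by blast
  show "(\<lambda>i. indicator (cball 0 (real i)) x *\<^sub>R F x) \<longlonglongrightarrow> F x"
    by (rule tendsto_eventually) (use N in \<open>auto simp: eventually_sequentially intro!: exI[of _ N]\<close>)
qed

lemma locally_integrable_mult_bounded: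
  fixes F G :: "real ^ 'n::finite \<Rightarrow> complex"
  assumes F: "locally_integrable F" and G: "G \<in> borel_measurable lebesgue"
    and M: "\<And>x. norm (G x) \<le> M" and R: "\<And>x. norm x > R \<Longrightarrow> G x = 0"
  shows "integrable lebesgue (\<lambda>x. F x * G x)"
proof (rule Bochner_Integration.integrable_bound)
  have "set_integrable lebesgue (cball 0 R) F" using F by (auto simp: locally_integrable_def)
  then show "integrable lebesgue (\<lambda>x. M * norm (indicator (cball 0 R) x *\<^sub>R F x))"
    unfolding set_integrable_def by (intro integrable_mult_right integrable_norm)
  show "AE x in lebesgue. norm (F x * G x) \<le> norm (M * norm (indicator (cball 0 R) x *\<^sub>R F x))"
  proof (rule AE_I2)
    fix x
    have "M \<ge> 0" using M[of x] norm_ge_zero[of "G x"] by linarith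
    then show "norm (F x * G x) \<le> norm (M * norm (indicator (cball 0 R) x *\<^sub>R F x))"
      using mult_right_mono[OF M[of x], of "norm (F x)"] R[of x]
      by (auto simp: indicator_def norm_mult mult.commute)
  qed
  show "(\<lambda>x. F x * G x) \<in> borel_measurable lebesgue"
    using locally_integrable_measurable[OF F] G by (rule borel_measurable_times)
qed

lemma Cc_mult_integrable:
  fixes F G :: "real ^ 'n::finite \<Rightarrow> complex"
  assumes "locally_integrable F" "Cc G" shows "integrable lebesgue (\<lambda>x. F x * G x)"
  using Cc_bound[OF assms(2)] locally_integrable_mult_bounded[OF assms(1) borel_lebesgue[OF Cc_measurable[OF assms(2)]]]
  by metis

lemma Cc_square_integrable:
  fixes G :: "real ^ 'n::finite \<Rightarrow> complex"
  assumes "Cc G" shows "integrable lborel (\<lambda>x. (norm (G x))\<^sup>2)"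
proof -
  obtain R where R: "\<And>x. norm x > R \<Longrightarrow> G x = 0" using assms by (auto simp: Cc_def)
  show ?thesis
    by (rule integrable_compact_support[where K = "cball 0 R"])
      (use assms R in \<open>auto simp: Cc_def not_le intro!: continuous_intros\<close>)
qed

text \<open>
  Radial truncation to the disc of radius \<open>m\<close>; unlike a truncation by cases it is continuous.
\<close>

definition clip :: "real \<Rightarrow> complex \<Rightarrow> complex" where
  "clip m z = of_real (m / max m (norm z)) * z"

lemma clip_continuous: "m > 0 \<Longrightarrow> continuous_on A (clip m)"
  unfolding clip_def by (intro continuous_intros) auto

lemma clip_bound: "m > 0 \<Longrightarrow> norm (clip m z) \<le> m"
  by (auto simp: clip_def norm_mult norm_divide max_def field_simps)

lemma clip_0 [simp]: "clip m 0 = 0"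
  by (simp add: clip_def)

lemma clip_id: "m > 0 \<Longrightarrow> norm z \<le> m \<Longrightarrow> clip m z = z"
  by (simp add: clip_def max_def)

definition cutoff :: "real \<Rightarrow> 'a::real_normed_vector \<Rightarrow> real" where
  "cutoff m x = max 0 (min 1 (m + 1 - norm x))"

text \<open>
  A measurable function is almost everywhere a limit of continuous functions. Clipping the values and
  cutting off at infinity preserves this and supplies the bounds needed for dominated convergence.
\<close>

lemma truncated_approximation:
  fixes H :: "real ^ 'n::finite \<Rightarrow> complex"
  assumes H: "H \<in> borel_measurable lebesgue" and m: "m > 0"
    and bd: "\<And>x. norm (H x) \<le> m" and supp: "\<And>x. norm x > m \<Longrightarrow> H x = 0"
  obtains G where "\<And>i::nat. Cc (G i)" "\<And>i x. norm (G i x) \<le> m" "\<And>i x. norm x > m + 1 \<Longrightarrow> G i x = 0"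
    "AE x in lebesgue. (\<lambda>i. G i x) \<longlonglongrightarrow> H x"
proof -
  have "H measurable_on UNIV" by (rule lebesgue_measurable_imp_measurable_on[OF H]) simp
  then obtain N g where N: "negligible N" and g: "\<And>i::nat. continuous_on UNIV (g i)"
      and lim: "\<And>x. x \<notin> N \<Longrightarrow> (\<lambda>i. g i x) \<longlonglongrightarrow> H x"
    unfolding measurable_on_def by auto
  define G where "G = (\<lambda>i x. of_real (cutoff m x) * clip m (g i x))"
  have b: "norm (G i x) \<le> m" for i x
  proof -
    have "norm (G i x) = \<bar>cutoff m x\<bar> * norm (clip m (g i x))" by (simp add: G_def norm_mult)
    also have "\<dots> \<le> 1 * m" using clip_bound[OF m] by (intro mult_mono) (auto simp: cutoff_def)
    finally show ?thesis by simp
  qed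
  have s: "G i x = 0" if "norm x > m + 1" for i x
    using that by (auto simp: G_def cutoff_def)
  have c: "continuous_on UNIV (G i)" for i
    unfolding G_def cutoff_def
    by (intro continuous_intros continuous_on_compose2[OF clip_continuous[OF m, of UNIV] g]) auto
  have l: "(\<lambda>i. G i x) \<longlonglongrightarrow> H x" if "x \<notin> N" for x
  proof -
    have "(\<lambda>i. clip m (g i x)) \<longlonglongrightarrow> clip m (H x)"
      using clip_continuous[OF m, of UNIV] lim[OF that]
      by (auto simp: continuous_on_eq_continuous_at intro: isCont_tendsto_compose)
    then have "(\<lambda>i. G i x) \<longlonglongrightarrow> of_real (cutoff m x) * clip m (H x)"
      unfolding G_def by (intro tendsto_intros)
    also have "of_real (cutoff m x) * clip m (H x) = H x"
      using supp[of x] by (cases "norm x > m") (auto simp: clip_id[OF m bd] cutoff_def)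
    finally show ?thesis .
  qed
  have "AE x in lebesgue. (\<lambda>i. G i x) \<longlonglongrightarrow> H x"
  proof (rule AE_I')
    show "N \<in> null_sets lebesgue" using N by (simp add: negligible_iff_null_sets)
  qed (use l in auto)
  moreover have "Cc (G i)" for i unfolding Cc_def using c s by blast
  ultimately show ?thesis using b s that[of G] by blast
qed

lemma integrable_bounded_support:
  fixes f :: "real ^ 'n::finite \<Rightarrow> 'b::{banach, second_countable_topology}"
  assumes "f \<in> borel_measurable lebesgue" "\<And>x. norm (f x) \<le> M" "\<And>x. norm x > R \<Longrightarrow> f x = 0"
  shows "integrable lebesgue f"
proof (rule Bochner_Integration.integrable_bound)
  show "integrable lebesgue (\<lambda>x::real^'n. M * indicat_real (cball 0 R) x)"
    by (intro integrable_mult_right integrable_real_indicator)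
      (use emeasure_bounded_finite[OF bounded_cball, of "0 :: real^'n" R] in auto)
  show "AE x in lebesgue. norm (f x) \<le> norm (M * indicat_real (cball 0 R) x)"
  proof (rule AE_I2)
    fix x show "norm (f x) \<le> norm (M * indicat_real (cball 0 R) x)"
      using assms(2)[of x] assms(3)[of x] by (auto simp: indicator_def not_le)
  qed
qed fact

text \<open>
  Test against approximations of \<open>cnj F\<close> restricted to the set where both \<open>F\<close> and the argument are
  bounded by \<open>m\<close>. In the limit the hypothesis reads \<open>I\<^sup>2 \<le> K * I\<close> for the integral \<open>I\<close> of
  \<open>(norm F)\<^sup>2\<close> over that set, so \<open>I \<le> K\<close>; then let \<open>m\<close> tend to infinity.
\<close>

lemma L2_by_duality:
  fixes F :: "real ^ 'n::finite \<Rightarrow> complex"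
  assumes F: "locally_integrable F" and K: "K \<ge> 0"
    and dual: "\<And>G. Cc G \<Longrightarrow> (norm (\<integral>x. F x * G x \<partial>lebesgue))\<^sup>2 \<le> K * (\<integral>x. (norm (G x))\<^sup>2 \<partial>lebesgue)"
  shows "F \<in> L2" and "(\<integral>x. (norm (F x))\<^sup>2 \<partial>lebesgue) \<le> K"
proof -
  have Fm[measurable]: "F \<in> borel_measurable lebesgue" by (rule locally_integrable_measurable[OF F])
  define A where "A = (\<lambda>i::nat. {x. norm (F x) \<le> real (Suc i) \<and> norm x \<le> real (Suc i)})"
  have Am[measurable]: "A i \<in> sets lebesgue" for i
  proof -
    have "{x \<in> space lebesgue. norm (F x) \<le> real (Suc i)} \<inter> cball 0 (real (Suc i)) \<in> sets lebesgue"
      by (intro sets.Int) (measurable, auto)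
    also have "{x \<in> space lebesgue. norm (F x) \<le> real (Suc i)} \<inter> cball 0 (real (Suc i)) = A i"
      by (auto simp: A_def)
    finally show ?thesis .
  qed
  define I where "I = (\<lambda>i. \<integral>x. (norm (F x))\<^sup>2 * indicat_real (A i) x \<partial>lebesgue)"
  have int: "integrable lebesgue (\<lambda>x. (norm (F x))\<^sup>2 * indicat_real (A i) x)" for i
    by (rule integrable_bounded_support[where M = "(real (Suc i))\<^sup>2" and R = "real (Suc i)"])
       (measurable, auto simp: A_def indicator_def intro: power_mono)
  have I: "I i \<le> K" for i
  proof -
    let ?m = "real (Suc i)"
    \<comment> \<open>The function that turns the pairing with \<open>F\<close> into the integral of \<open>(norm F)\<^sup>2\<close>.\<close>
    define H where "H = (\<lambda>x. cnj (F x) * of_real (indicat_real (A i) x))"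
    have Hm: "H \<in> borel_measurable lebesgue"
    proof -
      have "cnj \<in> borel_measurable borel" by (intro borel_measurable_continuous_onI continuous_intros)
      from measurable_compose[OF Fm this] have 1: "(\<lambda>x. cnj (F x)) \<in> borel_measurable lebesgue" .
      have "(\<lambda>x. complex_of_real (indicat_real (A i) x)) \<in> borel_measurable lebesgue"
        by (rule measurable_compose[OF _ borel_measurable_of_real]) measurable
      with 1 show ?thesis unfolding H_def by (rule borel_measurable_times)
    qed
    have Hb: "norm (H x) \<le> ?m" for x by (auto simp: H_def A_def indicator_def norm_mult)
    have Hs: "H x = 0" if "norm x > ?m" for x using that by (auto simp: H_def A_def indicator_def)
    obtain G where G: "\<And>i::nat. Cc (G i)" "\<And>i x. norm (G i x) \<le> ?m" "\<And>i x. norm x > ?m + 1 \<Longrightarrow> G i x = 0"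
      "AE x in lebesgue. (\<lambda>i. G i x) \<longlonglongrightarrow> H x"
      using truncated_approximation[OF Hm _ Hb Hs] by auto
    have Gm[measurable]: "G k \<in> borel_measurable lebesgue" for k
      by (rule borel_lebesgue[OF Cc_measurable[OF G(1)]])
    have "set_integrable lebesgue (cball 0 (?m + 1)) F" using F by (auto simp: locally_integrable_def)
    then have dom: "integrable lebesgue (\<lambda>x. ?m * norm (indicator (cball 0 (?m + 1)) x *\<^sub>R F x))"
      unfolding set_integrable_def by (intro integrable_mult_right integrable_norm)
    have lim1: "(\<lambda>k. \<integral>x. F x * G k x \<partial>lebesgue) \<longlonglongrightarrow> (\<integral>x. F x * H x \<partial>lebesgue)"
    proof (rule integral_dominated_convergence[OF _ _ dom])
      show "AE x in lebesgue. (\<lambda>k. F x * G k x) \<longlonglongrightarrow> F x * H x"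
        using G(4) by eventually_elim (intro tendsto_intros)
      show "AE x in lebesgue. norm (F x * G k x) \<le> ?m * norm (indicator (cball 0 (?m + 1)) x *\<^sub>R F x)" for k
      proof (rule AE_I2)
        fix x show "norm (F x * G k x) \<le> ?m * norm (indicator (cball 0 (?m + 1)) x *\<^sub>R F x)"
          using mult_right_mono[OF G(2)[of k x], of "norm (F x)"] G(3)[of x k]
          by (auto simp: indicator_def norm_mult mult.commute simp del: of_nat_Suc)
      qed
    qed (use Hm in measurable)
    have lim2: "(\<lambda>k. \<integral>x. (norm (G k x))\<^sup>2 \<partial>lebesgue) \<longlonglongrightarrow> (\<integral>x. (norm (H x))\<^sup>2 \<partial>lebesgue)"
    proof (rule integral_dominated_convergence)
      show "AE x in lebesgue. (\<lambda>k. (norm (G k x))\<^sup>2) \<longlonglongrightarrow> (norm (H x))\<^sup>2"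
        using G(4) by eventually_elim (intro tendsto_intros)
      show "integrable lebesgue (\<lambda>x::real^'n. ?m\<^sup>2 * indicat_real (cball 0 (?m + 1)) x)"
        by (intro integrable_mult_right integrable_real_indicator) (use emeasure_bounded_finite[OF bounded_cball, of "0 :: real^'n" "?m + 1"] in auto)
      show "AE x in lebesgue. norm ((norm (G k x))\<^sup>2) \<le> ?m\<^sup>2 * indicat_real (cball 0 (?m + 1)) x" for k
      proof (rule AE_I2)
        fix x show "norm ((norm (G k x))\<^sup>2) \<le> ?m\<^sup>2 * indicat_real (cball 0 (?m + 1)) x"
          using power_mono[OF G(2)[of k x] norm_ge_zero, of 2] G(3)[of x k]
          by (auto simp: indicator_def simp del: of_nat_Suc)
      qed
    qed (use Hm in measurable)
    have "F x * H x = of_real ((norm (F x))\<^sup>2 * indicat_real (A i) x)" for x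
      using complex_norm_square[of "F x"] by (simp add: H_def mult.assoc)
    then have 1: "(\<integral>x. F x * H x \<partial>lebesgue) = of_real (I i)"
      by (simp only: I_def integral_complex_of_real)
    have "(norm (H x))\<^sup>2 = (norm (F x))\<^sup>2 * indicat_real (A i) x" for x
      by (simp add: H_def norm_mult power_mult_distrib indicator_def)
    then have 2: "(\<integral>x. (norm (H x))\<^sup>2 \<partial>lebesgue) = I i" by (simp only: I_def)
    have "(norm (of_real (I i) :: complex))\<^sup>2 \<le> K * I i"
    proof (rule LIMSEQ_le)
      show "(\<lambda>k. (norm (\<integral>x. F x * G k x \<partial>lebesgue))\<^sup>2) \<longlonglongrightarrow> (norm (of_real (I i) :: complex))\<^sup>2"
        using lim1 unfolding 1 by (intro tendsto_intros)
      show "(\<lambda>k. K * (\<integral>x. (norm (G k x))\<^sup>2 \<partial>lebesgue)) \<longlonglongrightarrow> K * I i"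
        using lim2 unfolding 2 by (intro tendsto_intros)
    qed (use dual[OF G(1)] in blast)
    moreover have "I i \<ge> 0" unfolding I_def by simp
    ultimately show ?thesis using K
      by (cases "I i = 0") (auto simp: power2_eq_square)
  qed
  have sup: "(SUP i. ennreal ((norm (F x))\<^sup>2 * indicat_real (A i) x)) = ennreal ((norm (F x))\<^sup>2)" for x
  proof (rule antisym)
    show "(SUP i. ennreal ((norm (F x))\<^sup>2 * indicat_real (A i) x)) \<le> ennreal ((norm (F x))\<^sup>2)"
      by (rule SUP_least) (auto simp: indicator_def intro!: ennreal_leI)
    obtain j where "max (norm (F x)) (norm x) \<le> real j" using real_arch_simple by blast
    then have "x \<in> A j" by (auto simp: A_def)
    then show "ennreal ((norm (F x))\<^sup>2) \<le> (SUP i. ennreal ((norm (F x))\<^sup>2 * indicat_real (A i) x))"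
      by (intro SUP_upper2[of j]) auto
  qed
  have inc: "incseq (\<lambda>i x. ennreal ((norm (F x))\<^sup>2 * indicat_real (A i) x))"
    by (intro incseq_SucI le_funI ennreal_leI mult_left_mono) (auto simp: A_def indicator_def)
  have "(\<integral>\<^sup>+x. ennreal ((norm (F x))\<^sup>2) \<partial>lebesgue)
      = (SUP i. \<integral>\<^sup>+x. ennreal ((norm (F x))\<^sup>2 * indicat_real (A i) x) \<partial>lebesgue)"
    unfolding sup[symmetric] by (rule nn_integral_monotone_convergence_SUP[OF inc]) measurable
  also have "\<dots> = (SUP i. ennreal (I i))"
    unfolding I_def by (intro SUP_cong refl nn_integral_eq_integral int) auto
  also have "\<dots> \<le> ennreal K" by (intro SUP_least ennreal_leI I)
  finally have nn: "(\<integral>\<^sup>+x. ennreal ((norm (F x))\<^sup>2) \<partial>lebesgue) \<le> ennreal K" .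
  have fin: "integrable lebesgue (\<lambda>x. (norm (F x))\<^sup>2)"
    by (rule integrableI_bounded) (use nn in \<open>auto simp: le_less_trans\<close>)
  then show "F \<in> L2" by (simp add: L2_def)
  have "ennreal (\<integral>x. (norm (F x))\<^sup>2 \<partial>lebesgue) \<le> ennreal K"
    using nn nn_integral_eq_integral[OF fin] by simp
  then show "(\<integral>x. (norm (F x))\<^sup>2 \<partial>lebesgue) \<le> K" using K by (simp add: ennreal_le_iff)
qed

section \<open>A Sobolev bound for mollifications\<close>

lemma Cc_tensor:
  fixes f :: "'n::finite \<Rightarrow> real \<Rightarrow> real"
  assumes "\<And>i. bump (f i)"
  shows "Cc (tensor f)"
proof -
  have "compact (closure {x. tensor f x \<noteq> 0})"
    using test_function_tensor[of f, OF assms] by (simp add: test_function_def)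
  then have "bounded {x. tensor f x \<noteq> 0}" by (simp add: compact_closure)
  then obtain R where "\<forall>x\<in>{x. tensor f x \<noteq> 0}. norm x \<le> R" by (auto simp: bounded_iff)
  then have "tensor f x \<noteq> 0 \<Longrightarrow> norm x \<le> R" for x by blast
  then have "\<forall>x. norm x > R \<longrightarrow> tensor f x = 0" by (meson not_le)
  moreover have "continuous_on UNIV (tensor f)"
    by (rule tensor_continuous[of f, OF bump_continuous[OF assms]])
  ultimately show ?thesis unfolding Cc_def by blast
qed

lemma tensor_L2:
  fixes f :: "'n::finite \<Rightarrow> real \<Rightarrow> real"
  assumes "\<And>i. bump (f i)"
  shows "tensor f \<in> L2" and "(\<integral>x. (norm (tensor f x))\<^sup>2 \<partial>lebesgue) = (\<Prod>i\<in>UNIV. \<integral>t. (f i t)\<^sup>2 \<partial>lborel)"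
proof -
  have m: "tensor f \<in> borel_measurable borel"
    by (rule Cc_measurable[OF Cc_tensor[of f, OF assms]])
  then have m2: "(\<lambda>x. (norm (tensor f x))\<^sup>2) \<in> borel_measurable borel" by measurable
  show "tensor f \<in> L2"
    using tensor_integral_sq(1)[of f, OF assms] m m2
    by (simp add: L2_def borel_lebesgue integrable_completion)
  show "(\<integral>x. (norm (tensor f x))\<^sup>2 \<partial>lebesgue) = (\<Prod>i\<in>UNIV. \<integral>t. (f i t)\<^sup>2 \<partial>lborel)"
    using tensor_integral_sq(2)[of f, OF assms] m2 by (simp add: integral_completion)
qed

lemma L2_mult_integrable: "f \<in> L2 \<Longrightarrow> g \<in> L2 \<Longrightarrow> integrable lebesgue (\<lambda>x. f x * g x)"
  by (rule integrable_mult_squares) (auto simp: L2_def)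

lemma L2_Cauchy_Schwarz:
  "f \<in> L2 \<Longrightarrow> g \<in> L2 \<Longrightarrow> norm (\<integral>x. f x * g x \<partial>lebesgue) \<le> L2norm f * L2norm g"
proof -
  assume f: "f \<in> L2" and g: "g \<in> L2"
  have "(norm (\<integral>x. f x * g x \<partial>lebesgue))\<^sup>2 \<le> (L2norm f * L2norm g)\<^sup>2"
    using Cauchy_Schwarz_integral[of f lebesgue g] f g by (simp add: L2_def L2norm_def power_mult_distrib)
  then show ?thesis by (rule power2_le_imp_le) (simp add: L2norm_def)
qed

lemma L2norm_nonneg [simp]: "L2norm f \<ge> 0"
  by (simp add: L2norm_def)

text \<open>
  Weak derivatives of order \<open>s\<close> in direction \<open>j\<close>, tested on tensor products of bump functions only.
  In this form linear combinations are immediate, since such test functions are square-integrable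
  together with their derivatives.
\<close>

definition weak_pure_derivative ::
    "nat \<Rightarrow> 'n::finite \<Rightarrow> (real ^ 'n \<Rightarrow> complex) \<Rightarrow> (real ^ 'n \<Rightarrow> complex) \<Rightarrow> bool" where
  "weak_pure_derivative s j u g \<longleftrightarrow> (\<forall>f. (\<forall>i. bump (f i)) \<longrightarrow>
     (\<integral>x. u x * tensor (f(j := (deriv ^^ s) (f j))) x \<partial>lebesgue) = (-1) ^ s * (\<integral>x. g x * tensor f x \<partial>lebesgue))"

lemma weak_pure_derivativeI:
  assumes "has_weak_derivative (\<lambda>i. if i = j then s else 0) u g"
  shows "weak_pure_derivative s j u g"
  unfolding weak_pure_derivative_def
proof (intro allI impI)
  fix f :: "'a \<Rightarrow> real \<Rightarrow> real" assume f: "\<forall>i. bump (f i)"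
  let ?\<nu> = "\<lambda>i. if i = j then s else (0::nat)"
  have len: "mi_length ?\<nu> = s" by (simp add: mi_length_def)
  have "(\<lambda>i. (deriv ^^ ?\<nu> i) (f i)) = f(j := (deriv ^^ s) (f j))" by (auto simp: fun_eq_iff)
  then have mp: "multi_partial ?\<nu> (tensor f) = tensor (f(j := (deriv ^^ s) (f j)))"
    using multi_partial_tensor[of f ?\<nu>] f bump_smooth1 by simp
  have tf: "test_function (tensor f)" by (rule test_function_tensor) (use f in blast)
  have "test_function \<phi> \<Longrightarrow> (\<integral>x. u x * multi_partial ?\<nu> \<phi> x \<partial>lebesgue) =
      (-1) ^ mi_length ?\<nu> * (\<integral>x. g x * \<phi> x \<partial>lebesgue)" for \<phi>
    using assms unfolding has_weak_derivative_def by blast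
  from this[OF tf] show "(\<integral>x. u x * tensor (f(j := (deriv ^^ s) (f j))) x \<partial>lebesgue) = (-1) ^ s * (\<integral>x. g x * tensor f x \<partial>lebesgue)"
    by (simp only: mp len)
qed

lemma bump_deriv: assumes "bump f" shows "bump ((deriv ^^ k) f)"
proof -
  obtain R where R: "R > 0" "\<And>t. \<bar>t\<bar> > R \<Longrightarrow> f t = 0" using bump_bound[OF assms] by blast
  have "(deriv ^^ k) f t = 0" if "\<bar>t\<bar> > R" for t
    using that
  proof (induction k arbitrary: t)
    case (Suc k)
    have "open {t::real. \<bar>t\<bar> > R}" by (intro open_Collect_less continuous_intros)
    then have "eventually (\<lambda>t. t \<in> {t. \<bar>t\<bar> > R}) (nhds t)" using Suc.prems by (intro eventually_nhds_in_open) auto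
    then have "eventually (\<lambda>t. (deriv ^^ k) f t = 0) (nhds t)" by eventually_elim (use Suc.IH in auto)
    then have "((deriv ^^ k) f has_real_derivative 0) (at t)"
      by (subst DERIV_cong_ev[OF refl _ refl, where g = "\<lambda>_. 0"]) auto
    then show ?case by (simp add: DERIV_imp_deriv)
  qed (use R in auto)
  then show ?thesis using smooth1_deriv[OF bump_smooth1[OF assms]] unfolding bump_def by blast
qed

definition bump_kernel :: "nat \<Rightarrow> (real \<Rightarrow> real) \<Rightarrow> real ^ 'n \<Rightarrow> real ^ 'n::finite \<Rightarrow> complex" where
  "bump_kernel k b y = tensor (\<lambda>j. dilate k (y $ j) b)"

definition mollify :: "nat \<Rightarrow> (real \<Rightarrow> real) \<Rightarrow> (real ^ 'n::finite \<Rightarrow> complex) \<Rightarrow> real ^ 'n \<Rightarrow> complex" where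
  "mollify k b u y = (\<integral>w. u w * bump_kernel k b y w \<partial>lebesgue)"

lemma tensor_update_diff:
  "tensor (f(j := g)) x - tensor (f(j := h)) x = tensor (f(j := (\<lambda>t. g t - h t))) x"
proof -
  have "(\<Prod>i\<in>UNIV. (f(j := q)) i (x $ i)) = q (x $ j) * (\<Prod>i\<in>UNIV - {j}. f i (x $ i))" for q
    by (subst prod.remove[of UNIV j]) auto
  then show ?thesis unfolding tensor_def of_real_diff[symmetric] by (simp only: left_diff_distrib)
qed

lemma tensor_update_scale:
  "tensor (f(j := (\<lambda>t. c * g t))) x = of_real c * tensor (f(j := g)) x"
proof -
  have "(\<Prod>i\<in>UNIV. (f(j := q)) i (x $ i)) = q (x $ j) * (\<Prod>i\<in>UNIV - {j}. f i (x $ i))" for q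
    by (subst prod.remove[of UNIV j]) auto
  then show ?thesis unfolding tensor_def of_real_mult[symmetric] by (simp only: mult.assoc)
qed

context
  fixes b \<kappa> :: "real \<Rightarrow> real" and s :: nat and N :: real
  assumes b: "bump b" and \<kappa>: "bump \<kappa>" and dil: "\<And>t. 2 * b (2 * t) - b t = (deriv ^^ s) \<kappa> t"
    and N: "(\<integral>t. (b t)\<^sup>2 \<partial>lborel) \<le> N" "(\<integral>t. (\<kappa> t)\<^sup>2 \<partial>lborel) \<le> N"
begin

text \<open>
  The mollifier with scale \<open>k + 1\<close> in the coordinates from \<open>J\<close> and scale \<open>k\<close> in the others: it
  interpolates between two consecutive mollifiers one coordinate at a time.
\<close>

definition mixed_kernel :: "'n::finite set \<Rightarrow> nat \<Rightarrow> real ^ 'n \<Rightarrow> real ^ 'n \<Rightarrow> complex" where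
  "mixed_kernel J k y = tensor (\<lambda>i. dilate (if i \<in> J then Suc k else k) (y $ i) b)"

lemma N_nonneg: "N \<ge> 0"
  using N(1) by (rule order_trans[rotated]) simp

text \<open>
  The moment condition on \<open>b\<close>, rescaled to scale \<open>k\<close>; each derivative contributes a factor
  \<open>2 ^ (- k)\<close>.
\<close>

lemma dilate_step:
  "dilate (Suc k) x b t - dilate k x b t = inverse (2 ^ (k * s)) * (deriv ^^ s) (dilate k x \<kappa>) t"
proof -
  have "dilate (Suc k) x b t - dilate k x b t = 2 ^ k * (2 * b (2 * (2 ^ k * (t - x))) - b (2 ^ k * (t - x)))"
    by (simp add: dilate_def algebra_simps)
  also have "\<dots> = dilate k x ((deriv ^^ s) \<kappa>) t" by (simp only: dil dilate_def)
  also have "\<dots> = inverse (2 ^ (k * s)) * ((2 ^ k) ^ s * dilate k x ((deriv ^^ s) \<kappa>) t)"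
    by (simp add: power_mult)
  finally show ?thesis by (simp add: dilate_deriv[OF bump_smooth1[OF \<kappa>]])
qed

text \<open>
  Each one-dimensional factor has squared \<open>L\<^sup>2\<close> norm at most \<open>2 ^ k * (2 * N)\<close>, where the two allows
  for the finer scale.
\<close>

lemma mixed_kernel_norm_bound:
  fixes f :: "'n::finite \<Rightarrow> real \<Rightarrow> real"
  assumes "\<And>i. f i = dilate k (y i) b \<or> f i = dilate (Suc k) (y i) b \<or> f i = dilate k (y i) \<kappa>"
  shows "L2norm (tensor f) \<le> sqrt ((2 * N) ^ CARD('n)) * sqrt (2 ^ (k * CARD('n)))"
proof -
  have bump: "bump (f i)" for i using assms[of i] bump_dilate b \<kappa> by metis
  have "(\<integral>t. (f i t)\<^sup>2 \<partial>lborel) \<le> 2 ^ k * (2 * N)" for i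
  proof -
    have "(2 ^ k * (\<integral>t. (b t)\<^sup>2 \<partial>lborel)) \<le> 2 ^ k * (2 * N)" "2 ^ Suc k * (\<integral>t. (b t)\<^sup>2 \<partial>lborel) \<le> 2 ^ k * (2 * N)"
      "(2 ^ k * (\<integral>t. (\<kappa> t)\<^sup>2 \<partial>lborel)) \<le> 2 ^ k * (2 * N)"
      using N N_nonneg by simp_all
    then show ?thesis using assms[of i] by (auto simp: integral_dilate_sq)
  qed
  then have "(\<Prod>i\<in>UNIV. \<integral>t. (f i t)\<^sup>2 \<partial>lborel) \<le> (\<Prod>i\<in>(UNIV::'n set). 2 ^ k * (2 * N))"
    by (intro prod_mono) auto
  also have "\<dots> = (2 * N) ^ CARD('n) * 2 ^ (k * CARD('n))"
    by (simp add: power_mult_distrib power_mult)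
  finally show ?thesis
    unfolding L2norm_def tensor_L2(2)[of f, OF bump] real_sqrt_mult[symmetric]
    by (rule real_sqrt_le_mono)
qed

text \<open>
  Changing the scale in the coordinate \<open>j\<close> changes the mollifier by an \<open>s\<close>-th derivative in that
  direction, which is moved to \<open>u\<close>. The gain \<open>2 ^ (- k * s)\<close> beats the growth \<open>2 ^ (k * n / 2)\<close> of the
  norm of the kernel by a factor of at least \<open>2 ^ (k / 2)\<close>.
\<close>

lemma mixed_kernel_step:
  fixes u g :: "real ^ 'n::finite \<Rightarrow> complex"
  assumes u: "u \<in> L2" and g: "g \<in> L2" and wd: "weak_pure_derivative s j u g" and j: "j \<notin> J"
    and s: "CARD('n) < 2 * s"
  shows "norm ((\<integral>w. u w * mixed_kernel (insert j J) k y w \<partial>lebesgue) - (\<integral>w. u w * mixed_kernel J k y w \<partial>lebesgue))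
     \<le> sqrt ((2 * N) ^ CARD('n)) * L2norm g * sqrt (1/2) ^ k"
proof -
  define f where "f = (\<lambda>i. dilate (if i \<in> J then Suc k else k) (y $ i) b)"
  define h where "h = f(j := dilate k (y $ j) \<kappa>)"
  \<comment> \<open>\<open>f\<close> carries the factors common to both kernels; \<open>h\<close> is the test function left after the \<open>s\<close> derivatives are moved to \<open>u\<close>.\<close>
  have fb: "bump (f i)" for i by (simp add: f_def bump_dilate b)
  have hb: "bump (h i)" for i using fb by (simp add: h_def bump_dilate \<kappa>)
  have K0: "mixed_kernel J k y = tensor (f(j := dilate k (y $ j) b))"
    unfolding mixed_kernel_def f_def using j by (intro arg_cong[of _ _ tensor]) auto
  have K1: "mixed_kernel (insert j J) k y = tensor (f(j := dilate (Suc k) (y $ j) b))"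
    unfolding mixed_kernel_def f_def by (intro arg_cong[of _ _ tensor]) auto
  have b0: "bump ((f(j := dilate k (y $ j) b)) i)" and b1: "bump ((f(j := dilate (Suc k) (y $ j) b)) i)" for i
    using fb by (simp_all add: bump_dilate b)
  have i0: "integrable lebesgue (\<lambda>w. u w * mixed_kernel J k y w)"
    unfolding K0 by (rule L2_mult_integrable[OF u tensor_L2(1)[OF b0]])
  have i1: "integrable lebesgue (\<lambda>w. u w * mixed_kernel (insert j J) k y w)"
    unfolding K1 by (rule L2_mult_integrable[OF u tensor_L2(1)[OF b1]])
  have diff: "u w * mixed_kernel (insert j J) k y w - u w * mixed_kernel J k y w =
      of_real (inverse (2 ^ (k * s))) * (u w * tensor (h(j := (deriv ^^ s) (h j))) w)" for w
  proof -
    have "mixed_kernel (insert j J) k y w - mixed_kernel J k y w =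
        tensor (f(j := (\<lambda>t. inverse (2 ^ (k * s)) * (deriv ^^ s) (dilate k (y $ j) \<kappa>) t))) w"
      unfolding K0 K1 tensor_update_diff dilate_step ..
    also have "\<dots> = of_real (inverse (2 ^ (k * s))) * tensor (h(j := (deriv ^^ s) (h j))) w"
      unfolding tensor_update_scale h_def by (simp only: fun_upd_upd fun_upd_same)
    finally show ?thesis by (simp add: right_diff_distrib[symmetric])
  qed
  have "(\<integral>w. u w * mixed_kernel (insert j J) k y w \<partial>lebesgue) - (\<integral>w. u w * mixed_kernel J k y w \<partial>lebesgue)
      = (\<integral>w. u w * mixed_kernel (insert j J) k y w - u w * mixed_kernel J k y w \<partial>lebesgue)"
    by (rule Bochner_Integration.integral_diff[OF i1 i0, symmetric])
  also have "\<dots> = of_real (inverse (2 ^ (k * s))) * (\<integral>w. u w * tensor (h(j := (deriv ^^ s) (h j))) w \<partial>lebesgue)"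
    unfolding diff by (rule Bochner_Integration.integral_mult_right_zero)
  also have "\<dots> = of_real (inverse (2 ^ (k * s))) * ((-1) ^ s * (\<integral>w. g w * tensor h w \<partial>lebesgue))"
    using wd hb unfolding weak_pure_derivative_def by simp
  also have "norm \<dots> = inverse (2 ^ (k * s)) * norm (\<integral>w. g w * tensor h w \<partial>lebesgue)"
    by (simp add: norm_mult norm_power norm_inverse)
  also have "\<dots> \<le> inverse (2 ^ (k * s)) * (L2norm g * (sqrt ((2 * N) ^ CARD('n)) * sqrt (2 ^ (k * CARD('n)))))"
  proof (rule mult_left_mono)
    have "L2norm (tensor h) \<le> sqrt ((2 * N) ^ CARD('n)) * sqrt (2 ^ (k * CARD('n)))"
      by (rule mixed_kernel_norm_bound[where y = "\<lambda>i. y $ i"]) (auto simp: h_def f_def)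
    then show "norm (\<integral>w. g w * tensor h w \<partial>lebesgue) \<le> L2norm g * (sqrt ((2 * N) ^ CARD('n)) * sqrt (2 ^ (k * CARD('n))))"
      using L2_Cauchy_Schwarz[OF g tensor_L2(1)[of h, OF hb]] mult_left_mono[OF _ L2norm_nonneg[of g]]
      by (meson order_trans)
  qed simp
  also have "\<dots> = sqrt ((2 * N) ^ CARD('n)) * L2norm g * (inverse (2 ^ (k * s)) * sqrt (2 ^ (k * CARD('n))))"
    by (simp only: mult_ac)
  also have "\<dots> \<le> sqrt ((2 * N) ^ CARD('n)) * L2norm g * sqrt (1/2) ^ k"
  proof (rule mult_left_mono)
    have "inverse (2 ^ (k * s)) * sqrt (2 ^ (k * CARD('n))) = sqrt (inverse (2 ^ (k * (2 * s))) * 2 ^ (k * CARD('n)))"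
    proof -
      have "(2::real) ^ (k * (2 * s)) = (2 ^ (k * s))\<^sup>2" by (simp flip: power_mult add: mult_ac)
      then have "sqrt (inverse (2 ^ (k * (2 * s)))) = inverse (2 ^ (k * s))" by (simp add: real_sqrt_inverse)
      then show ?thesis by (simp only: real_sqrt_mult)
    qed
    also have "\<dots> \<le> sqrt ((1/2) ^ k)"
    proof (rule real_sqrt_le_mono)
      \<comment> \<open>By \<open>n < 2 * s\<close> a factor \<open>2 ^ k\<close> is left over under the square root.\<close>
      have "k * (CARD('n) + 1) \<le> k * (2 * s)" using s by (intro mult_le_mono2) simp
      then have "(2::real) ^ (k * (CARD('n) + 1)) \<le> 2 ^ (k * (2 * s))" by (rule power_increasing) simp
      then have le: "(2::real) ^ (k * CARD('n)) * 2 ^ k \<le> 2 ^ (k * (2 * s))"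
        by (simp only: distrib_left power_add mult_1_right)
      have "p * q \<le> r \<Longrightarrow> q > 0 \<Longrightarrow> r > 0 \<Longrightarrow> inverse r * p \<le> 1 / q" for p q r :: real
        by (simp add: field_simps)
      from this[OF le] show "inverse (2 ^ (k * (2 * s))) * 2 ^ (k * CARD('n)) \<le> (1/2 :: real) ^ k"
        by (simp add: power_one_over)
    qed
    finally show "inverse (2 ^ (k * s)) * sqrt (2 ^ (k * CARD('n))) \<le> sqrt (1/2) ^ k"
      by (simp only: real_sqrt_power)
  qed (simp add: N_nonneg)
  finally show ?thesis .
qed

lemma mollify_step:
  fixes u :: "real ^ 'n::finite \<Rightarrow> complex"
  assumes u: "u \<in> L2" and g: "\<And>j. g j \<in> L2" and wd: "\<And>j. weak_pure_derivative s j u (g j)"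
    and s: "CARD('n) < 2 * s"
  shows "norm (mollify (Suc k) b u y - mollify k b u y)
     \<le> sqrt ((2 * N) ^ CARD('n)) * (\<Sum>j\<in>UNIV. L2norm (g j)) * sqrt (1/2) ^ k"
proof -
  have "norm ((\<integral>w. u w * mixed_kernel J k y w \<partial>lebesgue) - (\<integral>w. u w * mixed_kernel {} k y w \<partial>lebesgue))
     \<le> (\<Sum>j\<in>J. sqrt ((2 * N) ^ CARD('n)) * L2norm (g j) * sqrt (1/2) ^ k)" for J :: "'n set"
    using finite[of J]
  proof (induction J rule: finite_induct)
    case (insert j J)
    have "norm ((z::complex) - x) \<le> norm (z - y) + norm (y - x)" for x y z
      using norm_triangle_ineq[of "z - y" "y - x"] by simp
    from order_trans[OF this add_mono[OF mixed_kernel_step[OF u g wd insert.hyps(2) s] insert.IH]]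
    show ?case unfolding sum.insert[OF insert.hyps] .
  qed simp
  from this[of UNIV] show ?thesis
    by (simp add: mollify_def bump_kernel_def mixed_kernel_def sum_distrib_left sum_distrib_right)
qed

lemma mollify_bound_norm:
  fixes u :: "real ^ 'n::finite \<Rightarrow> complex"
  assumes u: "u \<in> L2" and g: "\<And>j. g j \<in> L2" and wd: "\<And>j. weak_pure_derivative s j u (g j)"
    and s: "CARD('n) < 2 * s"
  shows "norm (mollify k b u y) \<le> sqrt ((2 * N) ^ CARD('n)) / (1 - sqrt (1/2)) * (L2norm u + (\<Sum>j\<in>UNIV. L2norm (g j)))"
proof -
  define D where "D = sqrt ((2 * N) ^ CARD('n))"
  define S where "S = (\<Sum>j\<in>UNIV. L2norm (g j))"
  define r where "r = sqrt (1/2)"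
  have r: "0 \<le> r" "r < 1" by (simp_all add: r_def)
  have D0: "D \<ge> 0" by (simp add: D_def N_nonneg)
  have S0: "S \<ge> 0" by (simp add: S_def sum_nonneg)
  have base: "norm (mollify 0 b u y) \<le> D * L2norm u"
  proof -
    have k: "bump_kernel 0 b y \<in> L2" unfolding bump_kernel_def by (intro tensor_L2 bump_dilate b)
    have "L2norm (bump_kernel 0 b y) \<le> D * sqrt (2 ^ (0 * CARD('n)))"
      unfolding bump_kernel_def D_def by (rule mixed_kernel_norm_bound[where y = "\<lambda>i. y $ i"]) auto
    then have "L2norm u * L2norm (bump_kernel 0 b y) \<le> L2norm u * D" by (intro mult_left_mono) auto
    then show ?thesis using L2_Cauchy_Schwarz[OF u k] by (simp add: mollify_def mult.commute)
  qed
  \<comment> \<open>Telescoping from scale zero; the increments are dominated by a geometric series.\<close>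
  have "norm (mollify k b u y) \<le> D * L2norm u + (\<Sum>i<k. D * S * r ^ i)"
  proof (induction k)
    case (Suc k)
    have "norm (mollify (Suc k) b u y) \<le> norm (mollify k b u y) + norm (mollify (Suc k) b u y - mollify k b u y)"
      by (metis add.commute diff_add_cancel norm_triangle_ineq)
    also have "norm (mollify (Suc k) b u y - mollify k b u y) \<le> D * S * r ^ k"
      unfolding D_def S_def r_def by (rule mollify_step[OF u g wd s])
    finally show ?case using Suc by simp
  qed (use base in simp)
  also have "(\<Sum>i<k. D * S * r ^ i) = D * S * (\<Sum>i<k. r ^ i)" by (simp add: sum_distrib_left)
  also have "\<dots> \<le> D * S * (1 / (1 - r))"
  proof (rule mult_left_mono)
    show "(\<Sum>i<k. r ^ i) \<le> 1 / (1 - r)"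
      using r by (subst sum_gp_strict) (auto intro!: divide_right_mono)
  qed (use D0 S0 in simp)
  also have "D * L2norm u + D * S * (1 / (1 - r)) \<le> D * L2norm u * (1 / (1 - r)) + D * S * (1 / (1 - r))"
    using r D0 mult_left_mono[of 1 "1 / (1 - r)" "D * L2norm u"] by simp
  also have "\<dots> = D / (1 - r) * (L2norm u + S)" by (simp add: field_simps add_divide_distrib)
  finally show ?thesis by (simp add: D_def S_def r_def)
qed

end

text \<open>
  The constant depends on \<open>b\<close>, \<open>\<kappa>\<close> and the dimension only: neither on the function nor on the scale
  nor on the point.
\<close>

lemma mollify_bound:
  assumes "bump b" "bump \<kappa>" "\<And>t. 2 * b (2 * t) - b t = (deriv ^^ s) \<kappa> t" and s: "CARD('n::finite) < 2 * s"
  obtains C where "C \<ge> 0" "\<And>(u :: real ^ 'n \<Rightarrow> complex) g k y.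
      u \<in> L2 \<Longrightarrow> (\<And>j. g j \<in> L2) \<Longrightarrow> (\<And>j. weak_pure_derivative s j u (g j)) \<Longrightarrow>
      (norm (mollify k b u y))\<^sup>2 \<le> C * ((\<integral>x. (norm (u x))\<^sup>2 \<partial>lebesgue) + (\<Sum>j\<in>UNIV. \<integral>x. (norm (g j x))\<^sup>2 \<partial>lebesgue))"
proof -
  define N where "N = max (\<integral>t. (b t)\<^sup>2 \<partial>lborel) (\<integral>t. (\<kappa> t)\<^sup>2 \<partial>lborel)"
  define E where "E = sqrt ((2 * N) ^ CARD('n)) / (1 - sqrt (1/2))"
  define C where "C = E\<^sup>2 * (2 * real CARD('n) + 2)"
  have C: "C \<ge> 0" by (simp add: C_def)
  have main: "(norm (mollify k b u y))\<^sup>2 \<le> C * ((\<integral>x. (norm (u x))\<^sup>2 \<partial>lebesgue) + (\<Sum>j\<in>UNIV. \<integral>x. (norm (g j x))\<^sup>2 \<partial>lebesgue))"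
    if "u \<in> L2" "\<And>j. g j \<in> L2" "\<And>j. weak_pure_derivative s j u (g j)" for u :: "real ^ 'n \<Rightarrow> complex" and g k y
  proof -
    define S where "S = (\<Sum>j\<in>UNIV. L2norm (g j))"
    have "norm (mollify k b u y) \<le> E * (L2norm u + S)"
      unfolding E_def S_def
      by (rule mollify_bound_norm[OF assms(1-3)]) (use that s in \<open>auto simp: N_def\<close>)
    then have "(norm (mollify k b u y))\<^sup>2 \<le> (E * (L2norm u + S))\<^sup>2"
      by (intro power_mono) auto
    also have "\<dots> = E\<^sup>2 * (L2norm u + S)\<^sup>2" by (rule power_mult_distrib)
    also have "(L2norm u + S)\<^sup>2 \<le> 2 * (L2norm u)\<^sup>2 + 2 * S\<^sup>2"
      using zero_le_power2[of "L2norm u - S"] by (simp add: power2_eq_square algebra_simps)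
    also have "S\<^sup>2 \<le> real CARD('n) * (\<Sum>j\<in>UNIV. (L2norm (g j))\<^sup>2)"
      unfolding S_def using sum_squared_le_sum_of_squares[of "\<lambda>j. L2norm (g j)" "UNIV :: 'n set"]
      by (simp add: mult.commute)
    also have "2 * (L2norm u)\<^sup>2 + 2 * (real CARD('n) * (\<Sum>j\<in>UNIV. (L2norm (g j))\<^sup>2))
        \<le> (2 * real CARD('n) + 2) * ((L2norm u)\<^sup>2 + (\<Sum>j\<in>UNIV. (L2norm (g j))\<^sup>2))"
    proof -
      have "2 * a + 2 * (c * T) \<le> (2 * c + 2) * (a + T)" if "a \<ge> 0" "T \<ge> 0" "c \<ge> 0" for a T c :: real
        using that mult_nonneg_nonneg[of c a] by (simp add: algebra_simps)
      then show ?thesis by (simp add: sum_nonneg)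
    qed
    finally show ?thesis
      by (simp add: C_def L2norm_def mult_left_mono mult.assoc)
  qed
  show ?thesis by (rule that[OF C main])
qed

section \<open>Weak convergence of mollifications\<close>

text \<open>
  Fubini's theorem will be applied on the product of two Borel--Lebesgue measures, which requires a
  Borel measurable integrand.
\<close>

lemma borel_representative:
  fixes F :: "real ^ 'n::finite \<Rightarrow> complex"
  assumes "F \<in> borel_measurable lebesgue"
  obtains F' where "F' \<in> borel_measurable borel" "AE x in lebesgue. F x = F' x"
proof -
  have "(\<lambda>x. Re (F x)) \<in> borel_measurable lebesgue" "(\<lambda>x. Im (F x)) \<in> borel_measurable lebesgue"
    using assms by measurable
  then obtain p q where p: "p \<in> borel_measurable lborel" "AE x in lborel. Re (F x) = p x"
    and q: "q \<in> borel_measurable lborel" "AE x in lborel. Im (F x) = q x"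
    using completion_ex_borel_measurable_real[of "\<lambda>x. Re (F x)" lborel]
      completion_ex_borel_measurable_real[of "\<lambda>x. Im (F x)" lborel] by blast
  have "(\<lambda>x. of_real (p x) + \<i> * of_real (q x)) \<in> borel_measurable borel"
    using p(1) q(1) by measurable
  moreover have "AE x in lborel. F x = of_real (p x) + \<i> * of_real (q x)"
    using p(2) q(2) by eventually_elim (metis complex_eq)
  ultimately show ?thesis using that AE_completion by blast
qed

text \<open>
  As a function of its centre \<open>y\<close> the kernel is again a tensor product of bump functions.
\<close>

lemma kernel_swap:
  "bump_kernel k b y w = tensor (\<lambda>j t. 2 ^ k * b ((-(2 ^ k)) * t + 2 ^ k * (w $ j))) y"
  unfolding bump_kernel_def tensor_def dilate_def by (simp add: algebra_simps)

lemma integral_real_reflect_affine: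
  fixes f :: "real \<Rightarrow> real"
  shows "(\<integral>t. 2 ^ k * f ((-(2 ^ k)) * t + c) \<partial>lborel) = (\<integral>t. f t \<partial>lborel)"
proof -
  have "(\<integral>t. f t \<partial>lborel) = \<bar>-(2 ^ k)\<bar> *\<^sub>R (\<integral>t. f (c + (-(2 ^ k)) * t) \<partial>lborel)"
    by (rule lborel_integral_real_affine) simp
  then show ?thesis by (simp add: add.commute)
qed

lemma kernel_integral:
  fixes w :: "real ^ 'n::finite"
  assumes b: "bump b" "(\<integral>t. b t \<partial>lborel) = 1"
  shows "Cc (\<lambda>y. bump_kernel k b y w)"
    and "integrable lborel (\<lambda>y. bump_kernel k b y w)"
    and "(\<integral>y. bump_kernel k b y w \<partial>lborel) = 1"
    and "(\<integral>y. norm (bump_kernel k b y w) \<partial>lborel) = (\<integral>t. \<bar>b t\<bar> \<partial>lborel) ^ CARD('n)"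
proof -
  define f where "f = (\<lambda>j t. 2 ^ k * b ((-(2 ^ k)) * t + 2 ^ k * (w $ j)))"
  have f: "bump (f j)" for j unfolding f_def by (rule bump_affine[OF b(1)]) simp
  have eq: "(\<lambda>y. bump_kernel k b y w) = tensor f" by (rule ext) (simp only: kernel_swap f_def)
  show "Cc (\<lambda>y. bump_kernel k b y w)" unfolding eq by (rule Cc_tensor[of f, OF f])
  show "integrable lborel (\<lambda>y. bump_kernel k b y w)" unfolding eq by (rule tensor_integral(1)[of f, OF f])
  have "(\<integral>t. f j t \<partial>lborel) = 1" for j unfolding f_def integral_real_reflect_affine by (rule b(2))
  then show "(\<integral>y. bump_kernel k b y w \<partial>lborel) = 1"
    unfolding eq tensor_integral(2)[of f, OF f] by simp
  have "integrable lborel (\<lambda>t. \<bar>f j t\<bar>)" for j by (rule integrable_abs[OF bump_integrable[OF f]])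
  then have "(\<integral>y. norm (tensor f y) \<partial>lborel) = (\<Prod>j\<in>UNIV. \<integral>t. \<bar>f j t\<bar> \<partial>lborel)"
    using lborel_vec_prod(2)[of "\<lambda>j t. \<bar>f j t\<bar>"] by (simp only: tensor_def norm_of_real abs_prod)
  moreover have "(\<integral>t. \<bar>f j t\<bar> \<partial>lborel) = (\<integral>t. \<bar>b t\<bar> \<partial>lborel)" for j
  proof -
    have "\<bar>f j t\<bar> = 2 ^ k * \<bar>b ((-(2 ^ k)) * t + 2 ^ k * (w $ j))\<bar>" for t
      by (simp add: f_def abs_mult)
    then show ?thesis using integral_real_reflect_affine[of k "\<lambda>t. \<bar>b t\<bar>"] by simp
  qed
  moreover have "norm (bump_kernel k b y w) = norm (tensor f y)" for y using fun_cong[OF eq, of y] by simp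
  ultimately show "(\<integral>y. norm (bump_kernel k b y w) \<partial>lborel) = (\<integral>t. \<bar>b t\<bar> \<partial>lborel) ^ CARD('n)"
    by simp
qed

lemma kernel_support:
  fixes w y :: "real ^ 'n::finite"
  assumes \<rho>: "\<And>t. \<bar>t\<bar> > \<rho> \<Longrightarrow> b t = 0" and nz: "bump_kernel k b y w \<noteq> 0"
  shows "norm (w - y) \<le> real CARD('n) * \<rho> / 2 ^ k"
proof -
  have "b (2 ^ k * (w $ j - y $ j)) \<noteq> 0" for j
    using nz by (auto simp: bump_kernel_def tensor_def dilate_def)
  then have "\<bar>2 ^ k * (w $ j - y $ j)\<bar> \<le> \<rho>" for j using \<rho> by (meson not_le)
  then have "2 ^ k * \<bar>w $ j - y $ j\<bar> \<le> \<rho>" for j by (simp only: abs_mult) simp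
  then have "\<bar>(w - y) $ j\<bar> \<le> \<rho> / 2 ^ k" for j by (simp add: pos_le_divide_eq mult.commute)
  then have "(\<Sum>j\<in>UNIV. \<bar>(w - y) $ j\<bar>) \<le> (\<Sum>j\<in>(UNIV::'n set). \<rho> / 2 ^ k)" by (intro sum_mono)
  then show ?thesis using norm_le_l1_cart[of "w - y"] by simp
qed

lemma kernel_measurable:
  assumes "bump b"
  shows "(\<lambda>(w, y). bump_kernel k b y w) \<in> borel_measurable (borel \<Otimes>\<^sub>M borel)"
proof -
  have [measurable]: "b \<in> borel_measurable borel" by (rule bump_borel[OF assms])
  have nth: "(\<lambda>x. x $ j) \<in> borel_measurable borel" for j :: 'a
    by (intro borel_measurable_continuous_onI continuous_intros)
  have [measurable]: "(\<lambda>x :: (real^'a) \<times> (real^'a). fst x $ j) \<in> borel_measurable (borel \<Otimes>\<^sub>M borel)"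
      "(\<lambda>x :: (real^'a) \<times> (real^'a). snd x $ j) \<in> borel_measurable (borel \<Otimes>\<^sub>M borel)" for j
    by (rule measurable_compose[OF measurable_fst nth], rule measurable_compose[OF measurable_snd nth])
  show ?thesis unfolding bump_kernel_def tensor_def dilate_def split_def by measurable
qed

text \<open>
  Mollification is moved to the continuous function \<open>G\<close>, whose mollifications converge to \<open>G\<close>
  pointwise, with a common bound and a common compact support; dominated convergence then applies with
  a multiple of \<open>F\<close> on that compact set as the dominating function.
\<close>

lemma mollify_weak_convergence:
  fixes F G :: "real ^ 'n::finite \<Rightarrow> complex"
  assumes b: "bump b" "(\<integral>t. b t \<partial>lborel) = 1" and F: "locally_integrable F" and G: "Cc G"
  shows "\<And>k. integrable lebesgue (\<lambda>y. mollify k b F y * G y)"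
    and "(\<lambda>k. \<integral>y. mollify k b F y * G y \<partial>lebesgue) \<longlonglongrightarrow> (\<integral>w. F w * G w \<partial>lebesgue)"
proof -
  obtain F' where F'm[measurable]: "F' \<in> borel_measurable borel" and F'eq: "AE x in lebesgue. F x = F' x"
    using borel_representative[OF locally_integrable_measurable[OF F]] by blast
  have Gm[measurable]: "G \<in> borel_measurable borel" by (rule Cc_measurable[OF G])
  obtain M R where MR: "M > 0" "R > 0" "\<And>x. norm (G x) \<le> M" "\<And>x. norm x > R \<Longrightarrow> G x = 0"
    using Cc_bound[OF G] by metis
  obtain \<rho> where \<rho>: "\<rho> > 0" "\<And>t. \<bar>t\<bar> > \<rho> \<Longrightarrow> b t = 0" using bump_bound[OF b(1)] by blast
  define L where "L = real CARD('n) * \<rho>"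
  have L0: "L > 0" using \<rho>(1) by (simp add: L_def)
  define B where "B = (\<integral>t. \<bar>b t\<bar> \<partial>lborel) ^ CARD('n)"
  have B0: "B \<ge> 0" by (simp add: B_def)
  have ker: "Cc (\<lambda>y. bump_kernel k b y w)" "integrable lborel (\<lambda>y. bump_kernel k b y w)"
      "(\<integral>y. bump_kernel k b y w \<partial>lborel) = 1" "(\<integral>y. norm (bump_kernel k b y w) \<partial>lborel) = B" for k and w :: "real ^ 'n"
    unfolding B_def by (rule kernel_integral[OF b])+
  have supp: "norm (w - y) \<le> L / 2 ^ k" if "bump_kernel k b y w \<noteq> 0" for k and w y :: "real ^ 'n"
    unfolding L_def by (rule kernel_support[OF \<rho>(2) that])
  have km[measurable]: "(\<lambda>p. bump_kernel k b (snd p) (fst p)) \<in> borel_measurable (borel \<Otimes>\<^sub>M borel)" for k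
    using kernel_measurable[OF b(1)] by (simp add: split_def)
  have kG: "integrable lborel (\<lambda>y. bump_kernel k b y w * G y)" for k w
  proof (rule Bochner_Integration.integrable_bound)
    show "integrable lborel (\<lambda>y. M * norm (bump_kernel k b y w))"
      by (intro integrable_mult_right integrable_norm ker)
    show "AE y in lborel. norm (bump_kernel k b y w * G y) \<le> norm (M * norm (bump_kernel k b y w))"
    proof (rule AE_I2)
      fix y show "norm (bump_kernel k b y w * G y) \<le> norm (M * norm (bump_kernel k b y w))"
        using mult_left_mono[OF MR(3)[of y], of "norm (bump_kernel k b y w)"] MR(1)
        by (simp add: norm_mult mult.commute)
    qed
  qed (use Cc_measurable[OF ker(1)] in measurable)
  define Gk where "Gk = (\<lambda>k w. \<integral>y. bump_kernel k b y w * G y \<partial>lborel)"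
  have nGk: "(\<integral>y. norm (bump_kernel k b y w * G y) \<partial>lborel) \<le> M * B" for k w
  proof -
    have "(\<integral>y. norm (bump_kernel k b y w * G y) \<partial>lborel) \<le> (\<integral>y. M * norm (bump_kernel k b y w) \<partial>lborel)"
    proof (rule integral_mono)
      show "norm (bump_kernel k b y w * G y) \<le> M * norm (bump_kernel k b y w)" for y
        using mult_left_mono[OF MR(3)[of y], of "norm (bump_kernel k b y w)"]
        by (simp add: norm_mult mult.commute)
    qed (intro integrable_norm kG, intro integrable_mult_right integrable_norm ker)
    also have "\<dots> = M * B" by (subst Bochner_Integration.integral_mult_right_zero) (simp only: ker)
    finally show ?thesis .
  qed
  have far: "bump_kernel k b y w * G y = 0" if "norm w > R + L" for k y w
  proof (rule ccontr)
    assume "bump_kernel k b y w * G y \<noteq> 0"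
    then have "norm (w - y) \<le> L / 2 ^ k" "norm y \<le> R" using supp[of k y w] MR(4)[of y] by fastforce+
    moreover have "L / 2 ^ k \<le> L" using L0 by (simp add: field_simps)
    ultimately show False using that norm_triangle_ineq[of "w - y" y] by simp
  qed
  have Gk_bound: "norm (Gk k w) \<le> M * B" for k w
    unfolding Gk_def using integral_norm_bound[of lborel "\<lambda>y. bump_kernel k b y w * G y"] nGk[of k w] by linarith
  have Gk_far: "Gk k w = 0" if "norm w > R + L" for k w
    by (simp only: Gk_def far[OF that] Bochner_Integration.integral_zero)
  have Gk_m[measurable]: "Gk k \<in> borel_measurable borel" for k
    unfolding Gk_def by measurable
  have Gk_lim: "(\<lambda>k. Gk k w) \<longlonglongrightarrow> G w" for w
  proof (rule LIMSEQ_I)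
    fix e :: real assume e: "e > 0"
    define e' where "e' = e / (B + 1)"
    have e': "e' > 0" using e B0 by (simp add: e'_def)
    have "isCont G w" using G by (auto simp: Cc_def continuous_on_eq_continuous_at)
    then obtain d where d: "d > 0" "\<And>y. norm (y - w) < d \<Longrightarrow> norm (G y - G w) < e'"
      using e' by (auto simp: continuous_at_eps_delta dist_norm)
    have "(\<lambda>k. L * (1/2) ^ k) \<longlonglongrightarrow> L * 0" by (intro tendsto_intros LIMSEQ_power_zero) simp
    then have "eventually (\<lambda>k. L * (1/2) ^ k < d) sequentially" using d(1) by (intro order_tendstoD) auto
    then obtain K where K: "\<And>k. k \<ge> K \<Longrightarrow> L / 2 ^ k < d" by (auto simp: eventually_sequentially power_one_over)
    show "\<exists>no. \<forall>k\<ge>no. norm (Gk k w - G w) < e"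
    proof (intro exI[of _ K] allI impI)
      fix k assume k: "k \<ge> K"
      have ik: "integrable lborel (\<lambda>y. bump_kernel k b y w * G w)" by (intro integrable_mult_left ker)
      have "G w = (\<integral>y. bump_kernel k b y w * G w \<partial>lborel)" by (simp add: ker)
      then have "Gk k w - G w = (\<integral>y. bump_kernel k b y w * G y - bump_kernel k b y w * G w \<partial>lborel)"
        unfolding Gk_def using Bochner_Integration.integral_diff[OF kG ik] by simp
      also have "norm \<dots> \<le> (\<integral>y. norm (bump_kernel k b y w * G y - bump_kernel k b y w * G w) \<partial>lborel)"
        by (rule integral_norm_bound)
      also have "\<dots> \<le> (\<integral>y. e' * norm (bump_kernel k b y w) \<partial>lborel)"
      proof (rule integral_mono)
        fix y
        show "norm (bump_kernel k b y w * G y - bump_kernel k b y w * G w) \<le> e' * norm (bump_kernel k b y w)"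
        proof (cases "bump_kernel k b y w = 0")
          case False
          have "norm (y - w) < d" using supp[OF False] K[OF k] by (simp add: norm_minus_commute)
          then have "norm (G y - G w) \<le> e'" using d(2) by (meson less_imp_le)
          then show ?thesis
            unfolding right_diff_distrib[symmetric] norm_mult mult.commute[of e']
            by (rule mult_left_mono) simp
        qed simp
      qed (intro integrable_norm Bochner_Integration.integrable_diff kG ik, intro integrable_mult_right integrable_norm ker)
      also have "\<dots> = e' * B" by (subst Bochner_Integration.integral_mult_right_zero) (simp only: ker)
      also have "\<dots> < e" using e B0 by (simp add: e'_def field_simps)
      finally show "norm (Gk k w - G w) < e" .
    qed
  qed
  \<comment> \<open>Fubini moves the mollification from \<open>F\<close> to \<open>G\<close>, where it converges pointwise and boundedly.\<close>
  define P where "P = (\<lambda>k w y. F' w * (bump_kernel k b y w * G y))"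
  have "set_integrable lebesgue (cball 0 (R + L)) F" using F by (auto simp: locally_integrable_def)
  then have loc: "integrable lebesgue (\<lambda>x. indicator (cball 0 (R + L)) x *\<^sub>R F x)" by (simp add: set_integrable_def)
  have locm: "(\<lambda>x. indicator (cball 0 (R + L)) x *\<^sub>R F' x) \<in> borel_measurable borel"
    by (intro borel_measurable_scaleR borel_measurable_indicator F'm) simp
  have "integrable lebesgue (\<lambda>x. indicator (cball 0 (R + L)) x *\<^sub>R F' x)"
  proof (rule integrable_cong_AE_imp[OF loc])
    show "AE x in lebesgue. indicator (cball 0 (R + L)) x *\<^sub>R F x = indicator (cball 0 (R + L)) x *\<^sub>R F' x"
      using F'eq by eventually_elim simp
  qed (rule borel_lebesgue[OF locm])
  then have loc': "integrable lborel (\<lambda>x. indicator (cball 0 (R + L)) x *\<^sub>R F' x)"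
    using locm by (subst (asm) integrable_completion) simp_all
  have dom: "integrable lborel (\<lambda>x. M * B * norm (indicator (cball 0 (R + L)) x *\<^sub>R F' x))"
    by (intro integrable_mult_right integrable_norm loc')
  have Pint: "integrable (lborel \<Otimes>\<^sub>M lborel) (case_prod (P k))" for k
  proof (rule lborel_pair.Fubini_integrable)
    show "case_prod (P k) \<in> borel_measurable (lborel \<Otimes>\<^sub>M lborel)"
      unfolding P_def split_def by measurable
    show "integrable lborel (\<lambda>w. \<integral>y. norm (case (w, y) of (w, y) \<Rightarrow> P k w y) \<partial>lborel)"
    proof (rule Bochner_Integration.integrable_bound[OF dom])
      show "(\<lambda>w. \<integral>y. norm (case (w, y) of (w, y) \<Rightarrow> P k w y) \<partial>lborel) \<in> borel_measurable lborel"
        unfolding P_def prod.case by measurable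
      show "AE w in lborel. norm (\<integral>y. norm (case (w, y) of (w, y) \<Rightarrow> P k w y) \<partial>lborel)
         \<le> norm (M * B * norm (indicator (cball 0 (R + L)) w *\<^sub>R F' w))"
      proof (rule AE_I2)
        fix w
        show "norm (\<integral>y. norm (case (w, y) of (w, y) \<Rightarrow> P k w y) \<partial>lborel)
         \<le> norm (M * B * norm (indicator (cball 0 (R + L)) w *\<^sub>R F' w))"
        proof (cases "norm w > R + L")
          case True
          then show ?thesis
            by (simp only: P_def prod.case far mult_zero_right norm_zero Bochner_Integration.integral_zero) simp
        next
          case False
          have "(\<integral>y. norm (P k w y) \<partial>lborel) = norm (F' w) * (\<integral>y. norm (bump_kernel k b y w * G y) \<partial>lborel)"
            unfolding P_def norm_mult[of "F' w"] by (rule Bochner_Integration.integral_mult_right_zero)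
          also have "\<dots> \<le> norm (F' w) * (M * B)" by (intro mult_left_mono nGk) simp
          finally show ?thesis using False MR(1) B0 by (simp add: indicator_def mult.commute)
        qed
      qed
    qed
    show "AE w in lborel. integrable lborel (\<lambda>y. case (w, y) of (w, y) \<Rightarrow> P k w y)"
      unfolding P_def prod.case by (intro AE_I2 integrable_mult_right kG)
  qed
  have moll: "mollify k b F y = (\<integral>w. F' w * bump_kernel k b y w \<partial>lborel)" for k y
  proof -
    have kb: "(\<lambda>w. bump_kernel k b y w) \<in> borel_measurable borel"
      unfolding bump_kernel_def by (rule Cc_measurable[OF Cc_tensor]) (rule bump_dilate[OF b(1)])
    have "mollify k b F y = (\<integral>w. F' w * bump_kernel k b y w \<partial>lebesgue)"
      unfolding mollify_def
    proof (rule integral_cong_AE)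
      show "(\<lambda>w. F w * bump_kernel k b y w) \<in> borel_measurable lebesgue"
        by (intro borel_measurable_times locally_integrable_measurable[OF F] borel_lebesgue kb)
      show "(\<lambda>w. F' w * bump_kernel k b y w) \<in> borel_measurable lebesgue"
        using kb by (intro borel_measurable_times borel_lebesgue F'm)
      show "AE w in lebesgue. F w * bump_kernel k b y w = F' w * bump_kernel k b y w"
        using F'eq by eventually_elim simp
    qed
    also have "\<dots> = (\<integral>w. F' w * bump_kernel k b y w \<partial>lborel)"
      using kb by (intro integral_completion) measurable
    finally show ?thesis .
  qed
  have mG: "mollify k b F y * G y = (\<integral>w. P k w y \<partial>lborel)" for k y
    unfolding moll P_def mult.assoc[symmetric] by (rule Bochner_Integration.integral_mult_left_zero[symmetric])
  have PG: "(\<integral>y. P k w y \<partial>lborel) = F' w * Gk k w" for k w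
    unfolding P_def Gk_def by (rule Bochner_Integration.integral_mult_right_zero)
  have i1: "integrable lborel (\<lambda>y. mollify k b F y * G y)" for k
    unfolding mG by (rule lborel_pair.integrable_snd[OF Pint])
  then show "integrable lebesgue (\<lambda>y. mollify k b F y * G y)" for k
    using borel_measurable_integrable[OF i1] by (simp add: integrable_completion)
  have e1: "(\<integral>y. mollify k b F y * G y \<partial>lebesgue) = (\<integral>w. F' w * Gk k w \<partial>lborel)" for k
  proof -
    have "(\<integral>y. mollify k b F y * G y \<partial>lebesgue) = (\<integral>y. mollify k b F y * G y \<partial>lborel)"
      using borel_measurable_integrable[OF i1] by (intro integral_completion)
    also have "\<dots> = (\<integral>w. \<integral>y. P k w y \<partial>lborel \<partial>lborel)"
      unfolding mG by (rule lborel_pair.Fubini_integral[OF Pint])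
    finally show ?thesis by (simp only: PG)
  qed
  have e2: "(\<integral>w. F w * G w \<partial>lebesgue) = (\<integral>w. F' w * G w \<partial>lborel)"
  proof -
    have "(\<integral>w. F w * G w \<partial>lebesgue) = (\<integral>w. F' w * G w \<partial>lebesgue)"
    proof (rule integral_cong_AE)
      show "AE w in lebesgue. F w * G w = F' w * G w" using F'eq by eventually_elim simp
    qed (intro borel_measurable_times locally_integrable_measurable[OF F] borel_lebesgue Gm F'm)+
    also have "\<dots> = (\<integral>w. F' w * G w \<partial>lborel)" by (intro integral_completion) measurable
    finally show ?thesis .
  qed
  show "(\<lambda>k. \<integral>y. mollify k b F y * G y \<partial>lebesgue) \<longlonglongrightarrow> (\<integral>w. F w * G w \<partial>lebesgue)"
    unfolding e1 e2
  proof (rule integral_dominated_convergence[OF _ _ dom])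
    show "AE w in lborel. (\<lambda>k. F' w * Gk k w) \<longlonglongrightarrow> F' w * G w"
      by (intro AE_I2 tendsto_intros Gk_lim)
    show "AE w in lborel. norm (F' w * Gk k w) \<le> M * B * norm (indicator (cball 0 (R + L)) w *\<^sub>R F' w)" for k
    proof (rule AE_I2)
      fix w show "norm (F' w * Gk k w) \<le> M * B * norm (indicator (cball 0 (R + L)) w *\<^sub>R F' w)"
        using mult_right_mono[OF Gk_bound[of k w], of "norm (F' w)"] Gk_far[of w k]
        by (auto simp: indicator_def norm_mult mult.commute)
    qed
  qed measurable
qed

lemma locally_integrable_diff:
  "locally_integrable u \<Longrightarrow> locally_integrable v \<Longrightarrow> locally_integrable (\<lambda>x. u x - v x)"
  unfolding locally_integrable_def by (simp add: set_integral_diff)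

text \<open>
  Functions with the same integrals against all test functions have the same mollifications, hence
  the same integrals against all continuous functions of compact support; duality with the constant
  zero shows that their difference vanishes.
\<close>

lemma fundamental_lemma:
  fixes u v :: "real ^ 'n::finite \<Rightarrow> complex"
  assumes u: "locally_integrable u" and v: "locally_integrable v"
    and eq: "\<And>\<phi>. test_function \<phi> \<Longrightarrow> (\<integral>x. u x * \<phi> x \<partial>lebesgue) = (\<integral>x. v x * \<phi> x \<partial>lebesgue)"
  shows "AE x in lebesgue. u x = v x"
proof -
  obtain b where b: "bump b" "(\<integral>t. b t \<partial>lborel) = 1" using ex_unit_bump by blast
  have moll: "mollify k b u = mollify k b v" for k
    unfolding mollify_def bump_kernel_def
    by (intro ext eq test_function_tensor bump_dilate b)
  define F where "F = (\<lambda>x. u x - v x)"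
  have F: "locally_integrable F" unfolding F_def by (rule locally_integrable_diff[OF u v])
  have zero: "(\<integral>x. F x * G x \<partial>lebesgue) = 0" if G: "Cc G" for G
  proof -
    have "(\<integral>x. u x * G x \<partial>lebesgue) = (\<integral>x. v x * G x \<partial>lebesgue)"
      using mollify_weak_convergence(2)[OF b u G] mollify_weak_convergence(2)[OF b v G]
      unfolding moll by (rule LIMSEQ_unique)
    then show ?thesis
      unfolding F_def left_diff_distrib
      using Bochner_Integration.integral_diff[OF Cc_mult_integrable[OF u G] Cc_mult_integrable[OF v G]] by simp
  qed
  have L2: "F \<in> L2" "(\<integral>x. (norm (F x))\<^sup>2 \<partial>lebesgue) \<le> 0"
    by (rule L2_by_duality[OF F, of 0]; simp add: zero)+
  then have "(\<integral>x. (norm (F x))\<^sup>2 \<partial>lebesgue) = 0"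
    by (intro antisym) simp_all
  then have "AE x in lebesgue. (norm (F x))\<^sup>2 = 0"
    using L2(1) by (subst (asm) integral_nonneg_eq_0_iff_AE) (auto simp: L2_def)
  then show ?thesis by eventually_elim (simp add: F_def)
qed

section \<open>Completeness of the space of square-integrable functions\<close>

lemma L2_measurable: "f \<in> L2 \<Longrightarrow> f \<in> borel_measurable lebesgue"
  and L2_square_integrable: "f \<in> L2 \<Longrightarrow> integrable lebesgue (\<lambda>x. (norm (f x))\<^sup>2)"
  by (simp_all add: L2_def)

lemma norm_add_sq_le: "(norm (a + b :: complex))\<^sup>2 \<le> 2 * (norm a)\<^sup>2 + 2 * (norm b)\<^sup>2"
proof -
  have "(norm (a + b))\<^sup>2 \<le> (norm a + norm b)\<^sup>2" by (intro power_mono norm_triangle_ineq) simp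
  also have "\<dots> \<le> 2 * (norm a)\<^sup>2 + 2 * (norm b)\<^sup>2"
    using zero_le_power2[of "norm a - norm b"] by (simp add: power2_eq_square algebra_simps)
  finally show ?thesis .
qed

lemma L2_add:
  assumes "f \<in> L2" "g \<in> L2"
  shows "(\<lambda>x. f x + g x) \<in> L2"
    and "(\<integral>x. (norm (f x + g x))\<^sup>2 \<partial>lebesgue) \<le> 2 * (\<integral>x. (norm (f x))\<^sup>2 \<partial>lebesgue) + 2 * (\<integral>x. (norm (g x))\<^sup>2 \<partial>lebesgue)"
proof -
  note [measurable] = assms[THEN L2_measurable]
  have dom: "integrable lebesgue (\<lambda>x. 2 * (norm (f x))\<^sup>2 + 2 * (norm (g x))\<^sup>2)"
    using assms[THEN L2_square_integrable] by simp
  have int: "integrable lebesgue (\<lambda>x. (norm (f x + g x))\<^sup>2)"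
    by (rule Bochner_Integration.integrable_bound[OF dom])
      (measurable, use norm_add_sq_le in \<open>auto intro!: AE_I2\<close>)
  then show "(\<lambda>x. f x + g x) \<in> L2" by (simp add: L2_def)
  have "(\<integral>x. (norm (f x + g x))\<^sup>2 \<partial>lebesgue) \<le> (\<integral>x. 2 * (norm (f x))\<^sup>2 + 2 * (norm (g x))\<^sup>2 \<partial>lebesgue)"
    by (rule integral_mono[OF int dom]) (rule norm_add_sq_le)
  also have "\<dots> = 2 * (\<integral>x. (norm (f x))\<^sup>2 \<partial>lebesgue) + 2 * (\<integral>x. (norm (g x))\<^sup>2 \<partial>lebesgue)"
    using assms[THEN L2_square_integrable] by simp
  finally show "(\<integral>x. (norm (f x + g x))\<^sup>2 \<partial>lebesgue) \<le> 2 * (\<integral>x. (norm (f x))\<^sup>2 \<partial>lebesgue) + 2 * (\<integral>x. (norm (g x))\<^sup>2 \<partial>lebesgue)" .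
qed

lemma L2_cmult: "f \<in> L2 \<Longrightarrow> (\<lambda>x. c * f x) \<in> L2"
  by (auto simp: L2_def norm_mult power_mult_distrib)

lemma L2_diff: "f \<in> L2 \<Longrightarrow> g \<in> L2 \<Longrightarrow> (\<lambda>x. f x - g x) \<in> L2"
  using L2_add(1)[of f "\<lambda>x. (-1) * g x"] L2_cmult[of g "-1"] by simp

lemma L2_zero: "(\<lambda>x. 0) \<in> L2"
  by (simp add: L2_def)

lemma L2_sum: "(\<And>i. i \<in> A \<Longrightarrow> f i \<in> L2) \<Longrightarrow> (\<lambda>x. \<Sum>i\<in>A. f i x) \<in> L2"
proof (induction A rule: infinite_finite_induct)
  case (insert i A)
  then have "(\<lambda>x. f i x + (\<Sum>i\<in>A. f i x)) \<in> L2" by (intro L2_add(1)) auto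
  then show ?case using insert.hyps by simp
qed (simp_all add: L2_zero)

lemma L2_cnj: "f \<in> L2 \<Longrightarrow> (\<lambda>x. cnj (f x)) \<in> L2"
proof -
  assume f: "f \<in> L2"
  have "cnj \<in> borel_measurable borel" by (intro borel_measurable_continuous_onI continuous_intros)
  from measurable_compose[OF L2_measurable[OF f] this] show ?thesis
    using f by (simp add: L2_def)
qed

definition L2_tendsto :: "(nat \<Rightarrow> real ^ 'n \<Rightarrow> complex) \<Rightarrow> (real ^ 'n::finite \<Rightarrow> complex) \<Rightarrow> bool" where
  "L2_tendsto f F \<longleftrightarrow> (\<forall>k. f k \<in> L2) \<and> F \<in> L2 \<and> (\<lambda>k. \<integral>x. (norm (f k x - F x))\<^sup>2 \<partial>lebesgue) \<longlonglongrightarrow> 0"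

lemma L2_tendsto_unique:
  assumes "L2_tendsto f F" "L2_tendsto f F'"
  shows "AE x in lebesgue. F x = F' x"
proof -
  have L2: "f k \<in> L2" "F \<in> L2" "F' \<in> L2" for k using assms by (auto simp: L2_tendsto_def)
  have "(\<integral>x. (norm (F x - F' x))\<^sup>2 \<partial>lebesgue) \<le> 2 * (\<integral>x. (norm (f k x - F' x))\<^sup>2 \<partial>lebesgue) + 2 * (\<integral>x. (norm (f k x - F x))\<^sup>2 \<partial>lebesgue)" for k
    using L2_add(2)[OF L2_diff[OF L2(1)[of k] L2(3)] L2_diff[OF L2(2) L2(1)[of k]]] by (simp add: norm_minus_commute)
  moreover have "(\<lambda>k. 2 * (\<integral>x. (norm (f k x - F' x))\<^sup>2 \<partial>lebesgue) + 2 * (\<integral>x. (norm (f k x - F x))\<^sup>2 \<partial>lebesgue)) \<longlonglongrightarrow> 2 * 0 + 2 * 0"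
    using assms unfolding L2_tendsto_def by (intro tendsto_intros) auto
  ultimately have "(\<integral>x. (norm (F x - F' x))\<^sup>2 \<partial>lebesgue) \<le> 0"
    by (intro LIMSEQ_le_const[where X = "\<lambda>k. 2 * (\<integral>x. (norm (f k x - F' x))\<^sup>2 \<partial>lebesgue) + 2 * (\<integral>x. (norm (f k x - F x))\<^sup>2 \<partial>lebesgue)"]) auto
  then have "(\<integral>x. (norm (F x - F' x))\<^sup>2 \<partial>lebesgue) = 0" by (intro antisym) simp_all
  then have "AE x in lebesgue. (norm (F x - F' x))\<^sup>2 = 0"
    using L2_square_integrable[OF L2_diff[OF L2(2,3)]] by (subst (asm) integral_nonneg_eq_0_iff_AE) auto
  then show ?thesis by eventually_elim simp
qed

lemma L2_tendsto_add:
  assumes "L2_tendsto f F" "L2_tendsto g G"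
  shows "L2_tendsto (\<lambda>k x. f k x + g k x) (\<lambda>x. F x + G x)"
proof -
  have L2: "f k \<in> L2" "g k \<in> L2" "F \<in> L2" "G \<in> L2" for k using assms by (auto simp: L2_tendsto_def)
  have "(\<integral>x. (norm ((f k x + g k x) - (F x + G x)))\<^sup>2 \<partial>lebesgue)
      \<le> 2 * (\<integral>x. (norm (f k x - F x))\<^sup>2 \<partial>lebesgue) + 2 * (\<integral>x. (norm (g k x - G x))\<^sup>2 \<partial>lebesgue)" for k
    using L2_add(2)[OF L2_diff[OF L2(1,3)] L2_diff[OF L2(2,4)], of k] by (simp add: algebra_simps)
  then have bd: "norm (\<integral>x. (norm ((f k x + g k x) - (F x + G x)))\<^sup>2 \<partial>lebesgue)
      \<le> 2 * (\<integral>x. (norm (f k x - F x))\<^sup>2 \<partial>lebesgue) + 2 * (\<integral>x. (norm (g k x - G x))\<^sup>2 \<partial>lebesgue)" for k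
    by simp
  have "(\<lambda>k. 2 * (\<integral>x. (norm (f k x - F x))\<^sup>2 \<partial>lebesgue) + 2 * (\<integral>x. (norm (g k x - G x))\<^sup>2 \<partial>lebesgue)) \<longlonglongrightarrow> 2 * 0 + 2 * 0"
    using assms unfolding L2_tendsto_def by (intro tendsto_intros) auto
  then have lim: "(\<lambda>k. 2 * (\<integral>x. (norm (f k x - F x))\<^sup>2 \<partial>lebesgue) + 2 * (\<integral>x. (norm (g k x - G x))\<^sup>2 \<partial>lebesgue)) \<longlonglongrightarrow> 0"
    by simp
  have "(\<lambda>k. \<integral>x. (norm ((f k x + g k x) - (F x + G x)))\<^sup>2 \<partial>lebesgue) \<longlonglongrightarrow> 0"
    by (rule Lim_null_comparison[OF always_eventually[OF allI[OF bd]] lim])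
  then show ?thesis unfolding L2_tendsto_def by (simp add: L2_add(1)[OF L2(1,2)] L2_add(1)[OF L2(3,4)])
qed

lemma L2_tendsto_cmult:
  assumes "L2_tendsto f F"
  shows "L2_tendsto (\<lambda>k x. c * f k x) (\<lambda>x. c * F x)"
proof -
  have "(\<integral>x. (norm (c * f k x - c * F x))\<^sup>2 \<partial>lebesgue) = (norm c)\<^sup>2 * (\<integral>x. (norm (f k x - F x))\<^sup>2 \<partial>lebesgue)" for k
    unfolding right_diff_distrib[symmetric] norm_mult power_mult_distrib by (rule Bochner_Integration.integral_mult_right_zero)
  moreover have "(\<lambda>k. (norm c)\<^sup>2 * (\<integral>x. (norm (f k x - F x))\<^sup>2 \<partial>lebesgue)) \<longlonglongrightarrow> (norm c)\<^sup>2 * 0"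
    using assms unfolding L2_tendsto_def by (intro tendsto_intros) auto
  ultimately show ?thesis using assms by (simp add: L2_tendsto_def L2_cmult)
qed

text \<open>
  The factor two comes from \<open>\<bar>a + b\<bar>\<^sup>2 \<le> 2 * \<bar>a\<bar>\<^sup>2 + 2 * \<bar>b\<bar>\<^sup>2\<close>, which stands in for the triangle
  inequality of the norm.
\<close>

lemma L2_tendsto_bound:
  assumes "L2_tendsto f F" and "\<And>k. (\<integral>x. (norm (f k x))\<^sup>2 \<partial>lebesgue) \<le> K"
  shows "(\<integral>x. (norm (F x))\<^sup>2 \<partial>lebesgue) \<le> 2 * K"
proof -
  have L2: "f k \<in> L2" "F \<in> L2" for k using assms by (auto simp: L2_tendsto_def)
  have "(\<integral>x. (norm (F x))\<^sup>2 \<partial>lebesgue) \<le> 2 * (\<integral>x. (norm (f k x - F x))\<^sup>2 \<partial>lebesgue) + 2 * K" for k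
    using L2_add(2)[OF L2_diff[OF L2(2) L2(1)[of k]] L2(1)[of k]] assms(2)[of k] by (simp add: norm_minus_commute)
  moreover have "(\<lambda>k. 2 * (\<integral>x. (norm (f k x - F x))\<^sup>2 \<partial>lebesgue) + 2 * K) \<longlonglongrightarrow> 2 * 0 + 2 * K"
    using assms unfolding L2_tendsto_def by (intro tendsto_intros) auto
  ultimately show ?thesis
    by (intro LIMSEQ_le_const[where X = "\<lambda>k. 2 * (\<integral>x. (norm (f k x - F x))\<^sup>2 \<partial>lebesgue) + 2 * K"]) auto
qed

text \<open>
  By monotone convergence \<open>\<Sum>k. 2 ^ k * (norm (d k x))\<^sup>2\<close> is finite almost everywhere, and
  \<open>a \<le> 1 / p + p * a\<^sup>2\<close> with \<open>p = 2 ^ k\<close> compares \<open>norm (d k x)\<close> with its terms.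
\<close>

lemma AE_summable_of_small_squares:
  fixes d :: "nat \<Rightarrow> 'a \<Rightarrow> complex"
  assumes [measurable]: "\<And>k. d k \<in> borel_measurable M"
    and int: "\<And>k. integrable M (\<lambda>x. (norm (d k x))\<^sup>2)"
    and small: "\<And>k. (\<integral>x. (norm (d k x))\<^sup>2 \<partial>M) \<le> (1/4) ^ k"
  shows "AE x in M. summable (\<lambda>k. d k x)"
proof -
  have "(\<integral>\<^sup>+x. (\<Sum>k. ennreal (2 ^ k * (norm (d k x))\<^sup>2)) \<partial>M) = (\<Sum>k. \<integral>\<^sup>+x. ennreal (2 ^ k * (norm (d k x))\<^sup>2) \<partial>M)"
    by (rule nn_integral_suminf) measurable
  also have "\<dots> \<le> (\<Sum>k. ennreal ((1/2) ^ k))"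
  proof (rule suminf_le)
    fix k
    have "(\<integral>\<^sup>+x. ennreal (2 ^ k * (norm (d k x))\<^sup>2) \<partial>M) = ennreal (2 ^ k * (\<integral>x. (norm (d k x))\<^sup>2 \<partial>M))"
      using int[of k] by (subst nn_integral_eq_integral) auto
    also have "\<dots> \<le> ennreal (2 ^ k * (1/4) ^ k)"
      by (intro ennreal_leI mult_left_mono small) simp
    also have "2 ^ k * (1/4) ^ k = (1/2 :: real) ^ k" by (simp add: power_mult_distrib[symmetric])
    finally show "(\<integral>\<^sup>+x. ennreal (2 ^ k * (norm (d k x))\<^sup>2) \<partial>M) \<le> ennreal ((1/2) ^ k)" .
  qed auto
  also have "\<dots> < \<infinity>"
  proof -
    have "(\<Sum>k. ennreal ((1/2) ^ k)) = ennreal (\<Sum>k. (1/2) ^ k)"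
      by (rule suminf_ennreal2) (auto intro: summable_geometric)
    then show ?thesis using ennreal_less_top by (simp only: infinity_ennreal_def)
  qed
  finally have "(\<integral>\<^sup>+x. (\<Sum>k. ennreal (2 ^ k * (norm (d k x))\<^sup>2)) \<partial>M) \<noteq> \<infinity>" by simp
  then have "AE x in M. (\<Sum>k. ennreal (2 ^ k * (norm (d k x))\<^sup>2)) \<noteq> \<infinity>"
    by (intro nn_integral_PInf_AE) measurable
  then show ?thesis
  proof eventually_elim
    case (elim x)
    then have s: "summable (\<lambda>k. 2 ^ k * (norm (d k x))\<^sup>2)"
      by (intro summable_suminf_not_top) auto
    have "summable (\<lambda>k. norm (d k x))"
    proof (rule summable_comparison_test')
      show "summable (\<lambda>k. (1/2::real) ^ k + 2 ^ k * (norm (d k x))\<^sup>2)"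
        by (rule summable_add[OF summable_geometric s]) simp
      fix k :: nat
      have "a \<le> inverse p + p * a\<^sup>2" if "p > 0" "a \<ge> 0" for a p :: real
      proof (cases "a \<le> inverse p")
        case True then show ?thesis using that by (simp add: add_increasing2)
      next
        case False
        then have "1 \<le> p * a" using that by (simp add: field_simps)
        then have "a * 1 \<le> a * (p * a)" using that by (intro mult_left_mono) auto
        then have "a \<le> p * a\<^sup>2" by (simp add: power2_eq_square mult_ac)
        then show ?thesis using that by (simp add: add_increasing)
      qed
      from this[of "2 ^ k" "norm (d k x)"]
      show "norm (norm (d k x)) \<le> (1/2) ^ k + 2 ^ k * (norm (d k x))\<^sup>2"
        by (simp add: power_one_over inverse_eq_divide)
    qed
    then show ?case by (rule summable_norm_cancel)
  qed
qed

text \<open>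
  The Riesz--Fischer argument: a rapidly converging subsequence converges almost everywhere, and Fatou's
  lemma shows that its limit is the limit of the whole sequence in the mean.
\<close>

lemma L2_complete:
  fixes f :: "nat \<Rightarrow> real ^ 'n::finite \<Rightarrow> complex"
  assumes f: "\<And>k. f k \<in> L2"
    and cauchy: "\<And>e. e > 0 \<Longrightarrow> \<exists>N. \<forall>m\<ge>N. \<forall>n\<ge>N. (\<integral>x. (norm (f m x - f n x))\<^sup>2 \<partial>lebesgue) \<le> e"
  shows "\<exists>F. L2_tendsto f F"
proof -
  note [measurable] = L2_measurable[OF f]
  have dL2: "(\<lambda>x. f m x - f n x) \<in> L2" for m n by (rule L2_diff[OF f f])
  obtain N where N: "\<And>k m n. m \<ge> N k \<Longrightarrow> n \<ge> N k \<Longrightarrow> (\<integral>x. (norm (f m x - f n x))\<^sup>2 \<partial>lebesgue) \<le> (1/4) ^ k"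
  proof -
    have "\<forall>k. \<exists>N. \<forall>m\<ge>N. \<forall>n\<ge>N. (\<integral>x. (norm (f m x - f n x))\<^sup>2 \<partial>lebesgue) \<le> (1/4) ^ k"
      using cauchy by simp
    then show ?thesis using that by metis
  qed
  \<comment> \<open>The sum makes \<open>r k\<close> exceed \<open>N k\<close>, the summand \<open>k\<close> forces divergence.\<close>
  define r where "r = (\<lambda>k. (\<Sum>i\<le>k. N i) + k)"
  have "N k \<le> (\<Sum>i\<le>k. N i)" for k by (rule member_le_sum) auto
  then have rN: "r k \<ge> N k" "r (Suc k) \<ge> N k" for k
    by (auto simp: r_def intro: trans_le_add1 le_SucI)
  have rk: "r k \<ge> k" for k by (simp add: r_def)
  have rs: "filterlim r at_top sequentially"
    by (rule filterlim_at_top_mono[OF filterlim_ident]) (use rk in auto)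
  have "AE x in lebesgue. summable (\<lambda>k. f (r (Suc k)) x - f (r k) x)"
    by (rule AE_summable_of_small_squares[OF _ L2_square_integrable[OF dL2] N[OF rN(2,1)]]) measurable
  then have conv: "AE x in lebesgue. convergent (\<lambda>k. f (r k) x)"
  proof eventually_elim
    case (elim x)
    have "(\<Sum>i<k. f (r (Suc i)) x - f (r i) x) = f (r k) x - f (r 0) x" for k
      by (rule sum_lessThan_telescope)
    then have "convergent (\<lambda>k. f (r k) x - f (r 0) x)"
      using elim by (simp add: summable_iff_convergent)
    then have "convergent (\<lambda>k. (f (r k) x - f (r 0) x) + f (r 0) x)"
      by (intro convergent_add convergent_const)
    then show ?case by simp
  qed
  define F where "F = (\<lambda>x. lim (\<lambda>k. f (r k) x))"
  have Fm[measurable]: "F \<in> borel_measurable lebesgue"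
    unfolding F_def by (rule borel_measurable_lim_metric) measurable
  have Flim: "AE x in lebesgue. (\<lambda>k. f (r k) x) \<longlonglongrightarrow> F x"
    using conv by eventually_elim (simp add: F_def convergent_LIMSEQ_iff)
  have fatou: "(\<integral>\<^sup>+x. ennreal ((norm (f m x - F x))\<^sup>2) \<partial>lebesgue) \<le> ennreal e"
    if e: "e > 0" and bd: "\<And>n. n \<ge> M \<Longrightarrow> (\<integral>x. (norm (f m x - f n x))\<^sup>2 \<partial>lebesgue) \<le> e" for m M e
  proof -
    have "(\<integral>\<^sup>+x. ennreal ((norm (f m x - F x))\<^sup>2) \<partial>lebesgue)
       = (\<integral>\<^sup>+x. liminf (\<lambda>k. ennreal ((norm (f m x - f (r k) x))\<^sup>2)) \<partial>lebesgue)"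
    proof (rule nn_integral_cong_AE)
      show "AE x in lebesgue. ennreal ((norm (f m x - F x))\<^sup>2) = liminf (\<lambda>k. ennreal ((norm (f m x - f (r k) x))\<^sup>2))"
        using Flim
      proof eventually_elim
        case (elim x)
        then have "(\<lambda>k. ennreal ((norm (f m x - f (r k) x))\<^sup>2)) \<longlonglongrightarrow> ennreal ((norm (f m x - F x))\<^sup>2)"
          by (intro tendsto_ennrealI tendsto_intros)
        then show ?case by (rule lim_imp_Liminf[OF sequentially_bot, symmetric])
      qed
    qed
    also have "\<dots> \<le> liminf (\<lambda>k. \<integral>\<^sup>+x. ennreal ((norm (f m x - f (r k) x))\<^sup>2) \<partial>lebesgue)"
      by (rule nn_integral_liminf) measurable
    also have "\<dots> \<le> liminf (\<lambda>k. ennreal e)"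
    proof (rule Liminf_mono)
      have "eventually (\<lambda>k. r k \<ge> M) sequentially" using rs by (simp add: filterlim_at_top)
      then show "eventually (\<lambda>k. (\<integral>\<^sup>+x. ennreal ((norm (f m x - f (r k) x))\<^sup>2) \<partial>lebesgue) \<le> ennreal e) sequentially"
      proof eventually_elim
        case (elim k)
        have "(\<integral>\<^sup>+x. ennreal ((norm (f m x - f (r k) x))\<^sup>2) \<partial>lebesgue) = ennreal (\<integral>x. (norm (f m x - f (r k) x))\<^sup>2 \<partial>lebesgue)"
          by (rule nn_integral_eq_integral[OF L2_square_integrable[OF dL2]]) simp
        also have "\<dots> \<le> ennreal e" by (intro ennreal_leI bd elim)
        finally show ?case .
      qed
    qed
    also have "\<dots> = ennreal e" by (rule Liminf_const) simp
    finally show ?thesis .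
  qed
  have close: "(\<lambda>x. f m x - F x) \<in> L2 \<and> (\<integral>x. (norm (f m x - F x))\<^sup>2 \<partial>lebesgue) \<le> e"
    if e: "e > 0" and bd: "\<And>n. n \<ge> M \<Longrightarrow> (\<integral>x. (norm (f m x - f n x))\<^sup>2 \<partial>lebesgue) \<le> e" for m M e
  proof -
    have nn: "(\<integral>\<^sup>+x. ennreal ((norm (f m x - F x))\<^sup>2) \<partial>lebesgue) \<le> ennreal e" by (rule fatou[OF that])
    have int: "integrable lebesgue (\<lambda>x. (norm (f m x - F x))\<^sup>2)"
      by (rule integrableI_bounded) (use nn in \<open>auto simp: le_less_trans\<close>)
    then have "ennreal (\<integral>x. (norm (f m x - F x))\<^sup>2 \<partial>lebesgue) \<le> ennreal e"
      using nn nn_integral_eq_integral[OF int] by simp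
    then show ?thesis using int e by (simp add: L2_def)
  qed
  have cl: "\<exists>N. \<forall>m\<ge>N. (\<lambda>x. f m x - F x) \<in> L2 \<and> (\<integral>x. (norm (f m x - F x))\<^sup>2 \<partial>lebesgue) \<le> e" if "e > 0" for e
    using cauchy[OF that] close[OF that] by meson
  obtain m where "(\<lambda>x. f m x - F x) \<in> L2" using cl[of 1] by auto
  from L2_diff[OF f[of m] this] have FL2: "F \<in> L2" by simp
  have "(\<lambda>k. \<integral>x. (norm (f k x - F x))\<^sup>2 \<partial>lebesgue) \<longlonglongrightarrow> 0"
  proof (rule LIMSEQ_I)
    fix e :: real assume "e > 0"
    then obtain N where "\<forall>m\<ge>N. (\<integral>x. (norm (f m x - F x))\<^sup>2 \<partial>lebesgue) \<le> e / 2" using cl[of "e / 2"] by auto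
    then show "\<exists>no. \<forall>n\<ge>no. norm ((\<integral>x. (norm (f n x - F x))\<^sup>2 \<partial>lebesgue) - 0) < e"
      using \<open>e > 0\<close> by (intro exI[of _ N]) fastforce
  qed
  then show ?thesis using f FL2 by (auto simp: L2_tendsto_def)
qed

section \<open>The bound on finite Hermite expansions\<close>

lemma L2_locally_integrable:
  assumes "f \<in> L2" shows "locally_integrable f"
  unfolding locally_integrable_def set_integrable_def
proof (intro allI impI)
  fix K :: "(real ^ 'a) set" assume K: "compact K"
  have Km: "K \<in> sets lebesgue" using K by (simp add: borel_compact)
  have K1: "integrable lebesgue (indicat_real K)"
    using Km emeasure_bounded_finite[OF compact_imp_bounded[OF K]] K
    by (intro integrable_real_indicator) (auto simp: borel_compact)
  show "integrable lebesgue (\<lambda>x. indicator K x *\<^sub>R f x)"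
  proof (rule Bochner_Integration.integrable_bound)
    show "integrable lebesgue (\<lambda>x. indicat_real K x + (norm (f x))\<^sup>2)"
      by (intro Bochner_Integration.integrable_add K1 L2_square_integrable assms)
    show "(\<lambda>x. indicator K x *\<^sub>R f x) \<in> borel_measurable lebesgue"
      by (intro borel_measurable_scaleR borel_measurable_indicator Km L2_measurable assms)
    have "t \<le> 1 + t\<^sup>2" for t :: real
      using zero_le_power2[of "t - 1/2"] by (simp add: power2_eq_square algebra_simps)
    then show "AE x in lebesgue. norm (indicator K x *\<^sub>R f x) \<le> norm (indicat_real K x + (norm (f x))\<^sup>2)"
      by (intro AE_I2) (auto simp: indicator_def)
  qed
qed

lemma locally_integrable_mult_continuous:
  fixes u :: "real ^ 'n::finite \<Rightarrow> complex"
  assumes u: "locally_integrable u" and h: "continuous_on UNIV h"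
  shows "locally_integrable (\<lambda>x. h x * u x)"
  unfolding locally_integrable_def set_integrable_def
proof (intro allI impI)
  fix K :: "(real ^ 'n) set" assume K: "compact K"
  have Km: "K \<in> sets borel" using K by (rule borel_compact)
  have hm: "h \<in> borel_measurable borel" using h by (rule borel_measurable_continuous_onI)
  have "bounded (h ` K)"
    by (rule compact_imp_bounded[OF compact_continuous_image[OF continuous_on_subset[OF h] K]]) simp
  then obtain M where "\<forall>x\<in>K. norm (h x) \<le> M" by (auto simp: bounded_iff)
  then have M: "norm (indicator K x *\<^sub>R h x) \<le> max M 0" for x by (auto simp: indicator_def)
  obtain R where "\<forall>x\<in>K. norm x \<le> R" using compact_imp_bounded[OF K] by (auto simp: bounded_iff)
  then have R: "indicator K x *\<^sub>R h x = 0" if "norm x > R" for x using that by (auto simp: indicator_def)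
  have "integrable lebesgue (\<lambda>x. u x * (indicator K x *\<^sub>R h x))"
    by (rule locally_integrable_mult_bounded[OF u _ M R])
      (intro borel_lebesgue borel_measurable_scaleR borel_measurable_indicator hm Km)
  then show "integrable lebesgue (\<lambda>x. indicator K x *\<^sub>R (h x * u x))"
    by (simp add: mult.commute mult_scaleR_left)
qed

lemma locally_integrable_sum:
  assumes "\<And>i. i \<in> A \<Longrightarrow> locally_integrable (f i)"
  shows "locally_integrable (\<lambda>x. \<Sum>i\<in>A. f i x)"
  using assms unfolding locally_integrable_def set_integrable_def
  by (simp add: scaleR_sum_right)

lemma Cc_mult_continuous:
  "Cc G \<Longrightarrow> continuous_on UNIV h \<Longrightarrow> Cc (\<lambda>x. h x * G x)"
  unfolding Cc_def by (auto intro!: continuous_intros)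

lemma hermite_complex_continuous: "continuous_on UNIV (\<lambda>x. complex_of_real (hermite \<xi> x))"
  by (intro continuous_intros hermite_continuous)

lemma hermite_L2: "(\<lambda>x::real^'n::finite. complex_of_real (hermite \<xi> x)) \<in> L2"
proof -
  have m: "hermite \<xi> \<in> borel_measurable (borel :: (real^'n) measure)"
    by (rule borel_measurable_continuous_onI[OF hermite_continuous])
  then have "(\<lambda>x::real^'n. (hermite \<xi> x)\<^sup>2) \<in> borel_measurable borel" by measurable
  moreover have "integrable lborel (\<lambda>x::real^'n. (hermite \<xi> x)\<^sup>2)"
    using hermite_orthonormal(1)[of \<xi> \<xi>] by (simp add: power2_eq_square)
  ultimately show ?thesis
    using borel_lebesgue[OF borel_measurable_continuous_onI[OF hermite_complex_continuous]]
    by (simp add: L2_def integrable_completion)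
qed

lemma hermite_orthonormal_lebesgue:
  fixes \<xi> \<eta> :: "'n::finite multi_index"
  shows "integrable lebesgue (\<lambda>x::real^'n. complex_of_real (hermite \<xi> x) * complex_of_real (hermite \<eta> x))"
    and "integral\<^sup>L lebesgue (\<lambda>x::real^'n. complex_of_real (hermite \<xi> x) * complex_of_real (hermite \<eta> x)) = (if \<xi> = \<eta> then 1 else 0)"
proof -
  show "integrable lebesgue (\<lambda>x::real^'n. complex_of_real (hermite \<xi> x) * complex_of_real (hermite \<eta> x))"
    by (rule L2_mult_integrable[OF hermite_L2 hermite_L2])
  have m: "(\<lambda>x::real^'n. hermite \<xi> x * hermite \<eta> x) \<in> borel_measurable borel"
    by (intro borel_measurable_continuous_onI continuous_intros hermite_continuous)
  have "integral\<^sup>L lebesgue (\<lambda>x::real^'n. complex_of_real (hermite \<xi> x) * complex_of_real (hermite \<eta> x))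
      = of_real (integral\<^sup>L lebesgue (\<lambda>x::real^'n. hermite \<xi> x * hermite \<eta> x))"
    by (simp only: of_real_mult[symmetric] integral_complex_of_real)
  also have "integral\<^sup>L lebesgue (\<lambda>x::real^'n. hermite \<xi> x * hermite \<eta> x) = (if \<xi> = \<eta> then 1 else 0)"
    using hermite_orthonormal(2)[of \<xi> \<eta>] m by (simp add: integral_completion)
  finally show "integral\<^sup>L lebesgue (\<lambda>x::real^'n. complex_of_real (hermite \<xi> x) * complex_of_real (hermite \<eta> x)) = (if \<xi> = \<eta> then 1 else 0)"
    by simp
qed

lemma norm_sq_sum_expand:
  fixes z :: "'i \<Rightarrow> complex"
  shows "complex_of_real ((norm (\<Sum>i\<in>A. z i))\<^sup>2) = (\<Sum>i\<in>A. \<Sum>j\<in>A. z i * cnj (z j))"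
  unfolding complex_norm_square cnj_sum by (rule sum_product)

lemma L2_sum_norm_sq:
  fixes v :: "'i \<Rightarrow> real ^ 'n::finite \<Rightarrow> complex"
  assumes v: "\<And>i. i \<in> A \<Longrightarrow> v i \<in> L2"
  shows "complex_of_real (\<integral>x. (norm (\<Sum>i\<in>A. a i * v i x))\<^sup>2 \<partial>lebesgue)
     = (\<Sum>i\<in>A. \<Sum>j\<in>A. a i * cnj (a j) * (\<integral>x. v i x * cnj (v j x) \<partial>lebesgue))"
proof -
  have int: "integrable lebesgue (\<lambda>x. v i x * cnj (v j x))" if "i \<in> A" "j \<in> A" for i j
    by (rule L2_mult_integrable[OF v[OF that(1)] L2_cnj[OF v[OF that(2)]]])
  have "complex_of_real (\<integral>x. (norm (\<Sum>i\<in>A. a i * v i x))\<^sup>2 \<partial>lebesgue)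
      = (\<integral>x. complex_of_real ((norm (\<Sum>i\<in>A. a i * v i x))\<^sup>2) \<partial>lebesgue)"
    by (rule integral_complex_of_real[symmetric])
  also have "\<dots> = (\<integral>x. (\<Sum>i\<in>A. \<Sum>j\<in>A. a i * cnj (a j) * (v i x * cnj (v j x))) \<partial>lebesgue)"
    unfolding norm_sq_sum_expand by (simp add: mult_ac)
  also have "\<dots> = (\<Sum>i\<in>A. \<Sum>j\<in>A. \<integral>x. a i * cnj (a j) * (v i x * cnj (v j x)) \<partial>lebesgue)"
    using int by (subst Bochner_Integration.integral_sum, simp) (auto intro!: sum.cong Bochner_Integration.integral_sum)
  also have "\<dots> = (\<Sum>i\<in>A. \<Sum>j\<in>A. a i * cnj (a j) * (\<integral>x. v i x * cnj (v j x) \<partial>lebesgue))"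
    by (simp only: Bochner_Integration.integral_mult_right_zero)
  finally show ?thesis .
qed

text \<open>
  The squared norm is a Hermitian form in the numbers \<open>c \<xi> * hermite \<xi> y\<close>, and integrating
  \<open>hermite \<xi> y * hermite \<eta> y\<close> over \<open>y\<close> removes the off-diagonal terms.
\<close>

lemma hermite_average:
  fixes c :: "'n::finite multi_index \<Rightarrow> complex" and v :: "'n::finite multi_index \<Rightarrow> real ^ 'n \<Rightarrow> complex"
  assumes A: "finite A" and v: "\<And>\<xi>. \<xi> \<in> A \<Longrightarrow> v \<xi> \<in> L2"
  defines "q \<equiv> \<lambda>y. \<integral>x. (norm (\<Sum>\<xi>\<in>A. (c \<xi> * of_real (hermite \<xi> y)) * v \<xi> x))\<^sup>2 \<partial>lebesgue"
  shows "integrable lebesgue q"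
    and "(\<integral>y. q y \<partial>lebesgue) = (\<Sum>\<xi>\<in>A. (norm (c \<xi>))\<^sup>2 * (\<integral>x. (norm (v \<xi> x))\<^sup>2 \<partial>lebesgue))"
proof -
  define I where "I = (\<lambda>\<xi> \<eta>. \<integral>x. v \<xi> x * cnj (v \<eta> x) \<partial>lebesgue)"
  let ?h = "\<lambda>\<xi> y. complex_of_real (hermite \<xi> y)"
  have q: "complex_of_real (q y) = (\<Sum>\<xi>\<in>A. \<Sum>\<eta>\<in>A. c \<xi> * cnj (c \<eta>) * I \<xi> \<eta> * (?h \<xi> y * ?h \<eta> y))" for y
    unfolding q_def by (subst L2_sum_norm_sq[OF v]) (auto simp: I_def mult_ac intro!: sum.cong)
  have int: "integrable lebesgue (\<lambda>y. c \<xi> * cnj (c \<eta>) * I \<xi> \<eta> * (?h \<xi> y * ?h \<eta> y))" for \<xi> \<eta>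
    by (intro integrable_mult_right hermite_orthonormal_lebesgue)
  have "integrable lebesgue (\<lambda>y. complex_of_real (q y))"
    unfolding q by (intro Bochner_Integration.integrable_sum int)
  then show "integrable lebesgue q" using integrable_Re by fastforce
  have "complex_of_real (\<integral>y. q y \<partial>lebesgue) = (\<integral>y. complex_of_real (q y) \<partial>lebesgue)"
    by (rule integral_complex_of_real[symmetric])
  also have "\<dots> = (\<Sum>\<xi>\<in>A. \<Sum>\<eta>\<in>A. \<integral>y. c \<xi> * cnj (c \<eta>) * I \<xi> \<eta> * (?h \<xi> y * ?h \<eta> y) \<partial>lebesgue)"
    unfolding q using int by (subst Bochner_Integration.integral_sum, simp) (auto intro!: sum.cong Bochner_Integration.integral_sum)
  also have "\<dots> = (\<Sum>\<xi>\<in>A. \<Sum>\<eta>\<in>A. c \<xi> * cnj (c \<eta>) * I \<xi> \<eta> * (if \<xi> = \<eta> then 1 else 0))"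
    by (simp only: Bochner_Integration.integral_mult_right_zero hermite_orthonormal_lebesgue)
  also have "\<dots> = (\<Sum>\<xi>\<in>A. c \<xi> * cnj (c \<xi>) * I \<xi> \<xi>)"
    using A by (intro sum.cong refl) (simp add: if_distrib[of "\<lambda>x. _ * x"] cong: if_cong)
  also have "\<dots> = (\<Sum>\<xi>\<in>A. complex_of_real ((norm (c \<xi>))\<^sup>2 * (\<integral>x. (norm (v \<xi> x))\<^sup>2 \<partial>lebesgue)))"
    by (intro sum.cong refl) (simp only: I_def of_real_mult complex_norm_square[symmetric] integral_complex_of_real)
  finally show "(\<integral>y. q y \<partial>lebesgue) = (\<Sum>\<xi>\<in>A. (norm (c \<xi>))\<^sup>2 * (\<integral>x. (norm (v \<xi> x))\<^sup>2 \<partial>lebesgue))"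
    by (simp only: of_real_sum[symmetric] of_real_eq_iff)
qed

lemma weak_pure_derivative_sum:
  fixes u g :: "'i \<Rightarrow> real ^ 'n::finite \<Rightarrow> complex"
  assumes u: "\<And>i. u i \<in> L2" and g: "\<And>i. g i \<in> L2" and wd: "\<And>i. weak_pure_derivative s j (u i) (g i)"
  shows "weak_pure_derivative s j (\<lambda>x. \<Sum>i\<in>A. a i * u i x) (\<lambda>x. \<Sum>i\<in>A. a i * g i x)"
  unfolding weak_pure_derivative_def
proof (intro allI impI)
  fix f :: "'n \<Rightarrow> real \<Rightarrow> real" assume f: "\<forall>i. bump (f i)"
  have sum: "(\<integral>x. (\<Sum>i\<in>A. a i * w i x) * \<phi> x \<partial>lebesgue) = (\<Sum>i\<in>A. a i * (\<integral>x. w i x * \<phi> x \<partial>lebesgue))"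
    if "\<And>i. w i \<in> L2" "\<phi> \<in> L2" for w :: "'i \<Rightarrow> real ^ 'n \<Rightarrow> complex" and \<phi>
  proof -
    have "(\<integral>x. (\<Sum>i\<in>A. a i * w i x) * \<phi> x \<partial>lebesgue) = (\<integral>x. (\<Sum>i\<in>A. a i * (w i x * \<phi> x)) \<partial>lebesgue)"
      by (simp add: sum_distrib_right mult.assoc)
    also have "\<dots> = (\<Sum>i\<in>A. \<integral>x. a i * (w i x * \<phi> x) \<partial>lebesgue)"
      by (intro Bochner_Integration.integral_sum integrable_mult_right L2_mult_integrable that)
    finally show ?thesis by (simp only: Bochner_Integration.integral_mult_right_zero)
  qed
  have t: "tensor f \<in> L2" by (rule tensor_L2(1)[of f]) (use f in blast)
  have t': "tensor (f(j := (deriv ^^ s) (f j))) \<in> L2"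
    by (rule tensor_L2(1)[of "f(j := (deriv ^^ s) (f j))"]) (use f bump_deriv in simp)
  show "(\<integral>x. (\<Sum>i\<in>A. a i * u i x) * tensor (f(j := (deriv ^^ s) (f j))) x \<partial>lebesgue)
      = (-1) ^ s * (\<integral>x. (\<Sum>i\<in>A. a i * g i x) * tensor f x \<partial>lebesgue)"
    unfolding sum[OF u t'] sum[OF g t]
    using wd f unfolding weak_pure_derivative_def by (simp add: sum_distrib_left mult_ac)
qed

lemma mollify_sum:
  fixes u :: "'i \<Rightarrow> real ^ 'n::finite \<Rightarrow> complex"
  assumes u: "\<And>i. u i \<in> L2" and b: "bump b"
  shows "mollify k b (\<lambda>x. \<Sum>i\<in>A. a i * u i x) y = (\<Sum>i\<in>A. a i * mollify k b (u i) y)"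
proof -
  have k: "bump_kernel k b y \<in> L2" unfolding bump_kernel_def by (rule tensor_L2(1)) (rule bump_dilate[OF b])
  have "mollify k b (\<lambda>x. \<Sum>i\<in>A. a i * u i x) y = (\<integral>w. (\<Sum>i\<in>A. a i * (u i w * bump_kernel k b y w)) \<partial>lebesgue)"
    unfolding mollify_def by (simp add: sum_distrib_right mult.assoc)
  also have "\<dots> = (\<Sum>i\<in>A. \<integral>w. a i * (u i w * bump_kernel k b y w) \<partial>lebesgue)"
    by (intro Bochner_Integration.integral_sum integrable_mult_right L2_mult_integrable u k)
  finally show ?thesis by (simp only: Bochner_Integration.integral_mult_right_zero mollify_def)
qed

text \<open>
  The Sobolev bound is applied at the point \<open>y\<close> to the function whose coefficients already contain the
  Hermite functions at the same \<open>y\<close>; averaging over \<open>y\<close> then gives the estimate for the mollified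
  sums, uniformly in the scale, and duality passes to the limit. Mollifications are defined
  at every point, which avoids exceptional null sets that would depend on \<open>y\<close>.
\<close>

lemma pseudo_multiplier_bound:
  fixes u :: "'n::finite multi_index \<Rightarrow> real ^ 'n \<Rightarrow> complex"
    and g :: "'n multi_index \<Rightarrow> 'n \<Rightarrow> real ^ 'n \<Rightarrow> complex"
  assumes u: "\<And>\<xi>. u \<xi> \<in> L2" and g: "\<And>\<xi> j. g \<xi> j \<in> L2"
    and wd: "\<And>\<xi> j. weak_pure_derivative s j (u \<xi>) (g \<xi> j)" and s: "CARD('n) < 2 * s"
    and uB: "\<And>\<xi>. (\<integral>x. (norm (u \<xi> x))\<^sup>2 \<partial>lebesgue) \<le> B"
    and gB: "\<And>\<xi> j. (\<integral>x. (norm (g \<xi> j x))\<^sup>2 \<partial>lebesgue) \<le> B"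
  obtains K where "K \<ge> 0" "\<And>A c. finite A \<Longrightarrow> (\<lambda>x. \<Sum>\<xi>\<in>A. c \<xi> * (of_real (hermite \<xi> x) * u \<xi> x)) \<in> L2"
    "\<And>A c. finite A \<Longrightarrow> (\<integral>x. (norm (\<Sum>\<xi>\<in>A. c \<xi> * (of_real (hermite \<xi> x) * u \<xi> x)))\<^sup>2 \<partial>lebesgue) \<le> K * (\<Sum>\<xi>\<in>A. (norm (c \<xi>))\<^sup>2)"
proof -
  have s1: "s \<ge> 1" using s by (cases s) auto
  obtain b \<kappa> where b: "bump b" "(\<integral>t. b t \<partial>lborel) = 1" and \<kappa>: "bump \<kappa>"
    and dil: "\<And>t. 2 * b (2 * t) - b t = (deriv ^^ s) \<kappa> t"
    using ex_bump_vanishing_moments[OF s1] by metis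
  obtain C where C: "C \<ge> 0" and Cb: "\<And>(u :: real ^ 'n \<Rightarrow> complex) g k y.
      u \<in> L2 \<Longrightarrow> (\<And>j. g j \<in> L2) \<Longrightarrow> (\<And>j. weak_pure_derivative s j u (g j)) \<Longrightarrow>
      (norm (mollify k b u y))\<^sup>2 \<le> C * ((\<integral>x. (norm (u x))\<^sup>2 \<partial>lebesgue) + (\<Sum>j\<in>UNIV. \<integral>x. (norm (g j x))\<^sup>2 \<partial>lebesgue))"
    using mollify_bound[OF b(1) \<kappa> dil s] by metis
  \<comment> \<open>The factor \<open>1 + n\<close> counts the function itself and its \<open>n\<close> pure derivatives.\<close>
  define K where "K = C * ((1 + real CARD('n)) * B)"
  have B0: "B \<ge> 0" by (rule order_trans[OF _ uB]) simp
  have K0: "K \<ge> 0" using C B0 by (simp add: K_def)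
  have main: "(\<lambda>x. \<Sum>\<xi>\<in>A. c \<xi> * (of_real (hermite \<xi> x) * u \<xi> x)) \<in> L2 \<and>
      (\<integral>x. (norm (\<Sum>\<xi>\<in>A. c \<xi> * (of_real (hermite \<xi> x) * u \<xi> x)))\<^sup>2 \<partial>lebesgue) \<le> K * (\<Sum>\<xi>\<in>A. (norm (c \<xi>))\<^sup>2)"
    if A: "finite A" for A c
  proof -
    let ?h = "\<lambda>\<xi> y. complex_of_real (hermite \<xi> y)"
    define F where "F = (\<lambda>x. \<Sum>\<xi>\<in>A. c \<xi> * (?h \<xi> x * u \<xi> x))"
    define Fk where "Fk = (\<lambda>k y. \<Sum>\<xi>\<in>A. (c \<xi> * ?h \<xi> y) * mollify k b (u \<xi>) y)"
    define q where "q = (\<lambda>(v :: 'n multi_index \<Rightarrow> real ^ 'n \<Rightarrow> complex) y. \<integral>x. (norm (\<Sum>\<xi>\<in>A. (c \<xi> * ?h \<xi> y) * v \<xi> x))\<^sup>2 \<partial>lebesgue)"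
    define Q where "Q = (\<lambda>y. q u y + (\<Sum>j\<in>UNIV. q (\<lambda>\<xi>. g \<xi> j) y))"
    define S where "S = (\<Sum>\<xi>\<in>A. (norm (c \<xi>))\<^sup>2)"
    have q_int: "integrable lebesgue (q v)"
      and q_le: "(\<integral>y. q v y \<partial>lebesgue) \<le> B * S"
      if "\<And>\<xi>. v \<xi> \<in> L2" "\<And>\<xi>. (\<integral>x. (norm (v \<xi> x))\<^sup>2 \<partial>lebesgue) \<le> B" for v
    proof -
      show "integrable lebesgue (q v)" unfolding q_def by (rule hermite_average(1)[OF A that(1)])
      have "(\<integral>y. q v y \<partial>lebesgue) = (\<Sum>\<xi>\<in>A. (norm (c \<xi>))\<^sup>2 * (\<integral>x. (norm (v \<xi> x))\<^sup>2 \<partial>lebesgue))"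
        unfolding q_def by (rule hermite_average(2)[OF A that(1)])
      also have "\<dots> \<le> (\<Sum>\<xi>\<in>A. (norm (c \<xi>))\<^sup>2 * B)" by (intro sum_mono mult_left_mono that) simp
      finally show "(\<integral>y. q v y \<partial>lebesgue) \<le> B * S" by (simp add: S_def sum_distrib_left mult.commute)
    qed
    have q0: "q v y \<ge> 0" for v y unfolding q_def by simp
    have Q0: "Q y \<ge> 0" for y unfolding Q_def by (intro add_nonneg_nonneg sum_nonneg q0)
    have Qint: "integrable lebesgue Q" unfolding Q_def
      by (intro Bochner_Integration.integrable_add Bochner_Integration.integrable_sum q_int u g uB gB)
    have Qle: "(\<integral>y. C * Q y \<partial>lebesgue) \<le> K * S"
    proof -
      have "(\<integral>y. Q y \<partial>lebesgue) = (\<integral>y. q u y \<partial>lebesgue) + (\<Sum>j\<in>UNIV. \<integral>y. q (\<lambda>\<xi>. g \<xi> j) y \<partial>lebesgue)"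
        unfolding Q_def
        by (subst Bochner_Integration.integral_add)
          (auto intro!: Bochner_Integration.integrable_sum Bochner_Integration.integral_sum q_int u g uB gB)
      also have "\<dots> \<le> B * S + (\<Sum>j\<in>(UNIV::'n set). B * S)"
        by (intro add_mono sum_mono q_le u g uB gB)
      also have "\<dots> = (1 + real CARD('n)) * B * S" by (simp add: algebra_simps)
      finally have "C * (\<integral>y. Q y \<partial>lebesgue) \<le> C * ((1 + real CARD('n)) * B * S)" using C by (rule mult_left_mono)
      then show ?thesis by (simp add: K_def mult.assoc)
    qed
    have Fk_bound: "(norm (Fk k y))\<^sup>2 \<le> C * Q y" for k y
    proof -
      define U where "U = (\<lambda>x. \<Sum>\<xi>\<in>A. (c \<xi> * ?h \<xi> y) * u \<xi> x)"
      define V where "V = (\<lambda>j x. \<Sum>\<xi>\<in>A. (c \<xi> * ?h \<xi> y) * g \<xi> j x)"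
      have "U \<in> L2" "V j \<in> L2" for j
        unfolding U_def V_def by (intro L2_sum L2_cmult u g)+
      moreover have "weak_pure_derivative s j U (V j)" for j
        unfolding U_def V_def by (rule weak_pure_derivative_sum[OF u g wd])
      moreover have "Fk k y = mollify k b U y"
        unfolding Fk_def U_def by (rule mollify_sum[OF u b(1), symmetric])
      ultimately show ?thesis using Cb[of U V k y] by (simp add: Q_def q_def U_def V_def)
    qed
    have F_loc: "locally_integrable F"
      unfolding F_def mult.assoc[symmetric]
      by (intro locally_integrable_sum locally_integrable_mult_continuous L2_locally_integrable u
          continuous_intros hermite_continuous)
    have dual: "(norm (\<integral>x. F x * G x \<partial>lebesgue))\<^sup>2 \<le> (K * S) * (\<integral>x. (norm (G x))\<^sup>2 \<partial>lebesgue)" if G: "Cc G" for G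
    proof -
      have hG: "Cc (\<lambda>x. ?h \<xi> x * G x)" for \<xi> by (rule Cc_mult_continuous[OF G hermite_complex_continuous])
      note wc = mollify_weak_convergence[OF b L2_locally_integrable[OF u] hG]
      have FkG: "Fk k y * G y = (\<Sum>\<xi>\<in>A. c \<xi> * (mollify k b (u \<xi>) y * (?h \<xi> y * G y)))" for k y
        unfolding Fk_def sum_distrib_right by (simp add: mult_ac)
      have FkG_int: "integrable lebesgue (\<lambda>y. Fk k y * G y)" for k
        unfolding FkG by (intro Bochner_Integration.integrable_sum integrable_mult_right wc(1))
      have FG: "F y * G y = (\<Sum>\<xi>\<in>A. c \<xi> * (u \<xi> y * (?h \<xi> y * G y)))" for y
        unfolding F_def sum_distrib_right by (simp add: mult_ac)
      have "(\<integral>y. Fk k y * G y \<partial>lebesgue) = (\<Sum>\<xi>\<in>A. c \<xi> * (\<integral>y. mollify k b (u \<xi>) y * (?h \<xi> y * G y) \<partial>lebesgue))" for k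
        unfolding FkG
        by (subst Bochner_Integration.integral_sum) (intro integrable_mult_right wc(1), simp only: Bochner_Integration.integral_mult_right_zero)
      moreover have "(\<integral>y. F y * G y \<partial>lebesgue) = (\<Sum>\<xi>\<in>A. c \<xi> * (\<integral>y. u \<xi> y * (?h \<xi> y * G y) \<partial>lebesgue))"
        unfolding FG
        by (subst Bochner_Integration.integral_sum)
          (intro integrable_mult_right Cc_mult_integrable L2_locally_integrable u hG, simp only: Bochner_Integration.integral_mult_right_zero)
      moreover have "(\<lambda>k. \<Sum>\<xi>\<in>A. c \<xi> * (\<integral>y. mollify k b (u \<xi>) y * (?h \<xi> y * G y) \<partial>lebesgue))
          \<longlonglongrightarrow> (\<Sum>\<xi>\<in>A. c \<xi> * (\<integral>y. u \<xi> y * (?h \<xi> y * G y) \<partial>lebesgue))"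
        by (intro tendsto_intros wc(2))
      ultimately have lim: "(\<lambda>k. \<integral>y. Fk k y * G y \<partial>lebesgue) \<longlonglongrightarrow> (\<integral>y. F y * G y \<partial>lebesgue)" by simp
      have bd: "(norm (\<integral>y. Fk k y * G y \<partial>lebesgue))\<^sup>2 \<le> (K * S) * (\<integral>x. (norm (G x))\<^sup>2 \<partial>lebesgue)" for k
      proof -
        \<comment> \<open>The pointwise bound on \<open>Fk\<close> is used in place of \<open>Fk\<close> itself, since the integral of its square is under control.\<close>
        define r where "r = (\<lambda>y. complex_of_real (sqrt (C * Q y)))"
        define G' where "G' = (\<lambda>y. complex_of_real (norm (G y)))"
        have Qm: "Q \<in> borel_measurable lebesgue" using Qint by (rule borel_measurable_integrable)
        have r2: "(norm (r y))\<^sup>2 = C * Q y" for y using C Q0 by (simp add: r_def)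
        have rm: "r \<in> borel_measurable lebesgue" unfolding r_def using Qm by measurable
        have r2int: "integrable lebesgue (\<lambda>y. (norm (r y))\<^sup>2)" unfolding r2 by (intro integrable_mult_right Qint)
        have rL2: "r \<in> L2" using rm r2int by (simp add: L2_def)
        have Gm: "G \<in> borel_measurable lebesgue" by (rule borel_lebesgue[OF Cc_measurable[OF G]])
        have "integrable lebesgue (\<lambda>x. (norm (G x))\<^sup>2)"
          using Cc_square_integrable[OF G] by (subst integrable_completion) (use Cc_measurable[OF G] in measurable)
        then have GL2: "G' \<in> L2" using Gm by (simp add: L2_def G'_def)
        have rG: "r y * G' y = complex_of_real (sqrt (C * Q y) * norm (G y))" for y by (simp add: r_def G'_def)
        have int: "integrable lebesgue (\<lambda>y. sqrt (C * Q y) * norm (G y))"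
        proof -
          have "norm (r y * G' y) = sqrt (C * Q y) * norm (G y)" for y
            using C Q0[of y] by (simp add: r_def G'_def norm_mult)
          then show ?thesis using integrable_norm[OF L2_mult_integrable[OF rL2 GL2]] by simp
        qed
        have "norm (\<integral>y. Fk k y * G y \<partial>lebesgue) \<le> (\<integral>y. norm (Fk k y * G y) \<partial>lebesgue)" by (rule integral_norm_bound)
        also have "\<dots> \<le> (\<integral>y. sqrt (C * Q y) * norm (G y) \<partial>lebesgue)"
        proof (rule integral_mono[OF integrable_norm[OF FkG_int] int])
          fix y
          have "norm (Fk k y) \<le> sqrt (C * Q y)" using Fk_bound by (rule real_le_rsqrt)
          then show "norm (Fk k y * G y) \<le> sqrt (C * Q y) * norm (G y)" unfolding norm_mult by (rule mult_right_mono) simp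
        qed
        also have "\<dots> = norm (\<integral>y. r y * G' y \<partial>lebesgue)"
          unfolding rG integral_complex_of_real using C Q0 by (simp add: integral_nonneg_AE)
        finally have "(norm (\<integral>y. Fk k y * G y \<partial>lebesgue))\<^sup>2 \<le> (norm (\<integral>y. r y * G' y \<partial>lebesgue))\<^sup>2"
          by (rule power_mono) simp
        also have "\<dots> \<le> (\<integral>y. (norm (r y))\<^sup>2 \<partial>lebesgue) * (\<integral>y. (norm (G' y))\<^sup>2 \<partial>lebesgue)"
          using rL2 GL2 by (intro Cauchy_Schwarz_integral) (auto simp: L2_def)
        also have "\<dots> = (\<integral>y. C * Q y \<partial>lebesgue) * (\<integral>y. (norm (G y))\<^sup>2 \<partial>lebesgue)"
          unfolding r2 by (simp add: G'_def)
        also have "\<dots> \<le> (K * S) * (\<integral>y. (norm (G y))\<^sup>2 \<partial>lebesgue)"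
          by (rule mult_right_mono[OF Qle]) simp
        finally show ?thesis .
      qed
      show ?thesis
        by (rule LIMSEQ_le_const2[OF tendsto_power[OF tendsto_norm[OF lim]]]) (use bd in blast)
    qed
    have KS: "K * S \<ge> 0" using K0 by (simp add: S_def sum_nonneg)
    show ?thesis using L2_by_duality[OF F_loc KS dual] by (simp add: F_def S_def)
  qed
  show ?thesis by (rule that[OF K0]) (use main in blast)+
qed

section \<open>Extension to all square-integrable functions\<close>

text \<open>
  Cauchy--Schwarz for \<open>f\<close> and its partial Hermite expansion \<open>p\<close>: both the pairing and the squared norm
  of \<open>p\<close> equal the sum \<open>s\<close> on the left, so \<open>s\<^sup>2 \<le> \<parallel>f\<parallel>\<^sup>2 * s\<close>.
\<close>

lemma Bessel:
  fixes f :: "real ^ 'n::finite \<Rightarrow> complex"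
  assumes f: "f \<in> L2" and A: "finite A"
  shows "(\<Sum>\<xi>\<in>A. (norm (hermite_coeff f \<xi>))\<^sup>2) \<le> (\<integral>x. (norm (f x))\<^sup>2 \<partial>lebesgue)"
proof -
  let ?h = "\<lambda>\<xi> x. complex_of_real (hermite \<xi> x)"
  define c where "c = hermite_coeff f"
  define p where "p = (\<lambda>x. \<Sum>\<xi>\<in>A. cnj (c \<xi>) * ?h \<xi> x)"
  have fh: "integrable lebesgue (\<lambda>x. f x * ?h \<xi> x)" for \<xi> by (rule L2_mult_integrable[OF f hermite_L2])
  have cc: "cnj (c \<xi>) * c \<xi> = complex_of_real ((norm (c \<xi>))\<^sup>2)" for \<xi>
    using complex_norm_square[of "c \<xi>"] by (simp only: mult.commute)
  have pL2: "p \<in> L2" unfolding p_def by (intro L2_sum L2_cmult hermite_L2)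
  have "(\<integral>x. f x * p x \<partial>lebesgue) = (\<integral>x. (\<Sum>\<xi>\<in>A. cnj (c \<xi>) * (f x * ?h \<xi> x)) \<partial>lebesgue)"
    by (simp add: p_def sum_distrib_left mult_ac)
  also have "\<dots> = (\<Sum>\<xi>\<in>A. \<integral>x. cnj (c \<xi>) * (f x * ?h \<xi> x) \<partial>lebesgue)"
    by (intro Bochner_Integration.integral_sum integrable_mult_right fh)
  also have "\<dots> = (\<Sum>\<xi>\<in>A. complex_of_real ((norm (c \<xi>))\<^sup>2))"
    unfolding Bochner_Integration.integral_mult_right_zero hermite_coeff_def[symmetric] c_def[symmetric] cc ..
  finally have fp: "(\<integral>x. f x * p x \<partial>lebesgue) = complex_of_real (\<Sum>\<xi>\<in>A. (norm (c \<xi>))\<^sup>2)"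
    by (simp only: of_real_sum)
  have "complex_of_real (\<integral>x. (norm (p x))\<^sup>2 \<partial>lebesgue)
      = (\<Sum>\<xi>\<in>A. \<Sum>\<eta>\<in>A. cnj (c \<xi>) * cnj (cnj (c \<eta>)) * (\<integral>x. ?h \<xi> x * cnj (?h \<eta> x) \<partial>lebesgue))"
    unfolding p_def by (rule L2_sum_norm_sq[OF hermite_L2])
  also have "\<dots> = (\<Sum>\<xi>\<in>A. \<Sum>\<eta>\<in>A. if \<xi> = \<eta> then cnj (c \<xi>) * c \<eta> else 0)"
    unfolding complex_cnj_complex_of_real hermite_orthonormal_lebesgue by (intro sum.cong refl) simp
  also have "\<dots> = (\<Sum>\<xi>\<in>A. cnj (c \<xi>) * c \<xi>)" using A by simp
  also have "\<dots> = complex_of_real (\<Sum>\<xi>\<in>A. (norm (c \<xi>))\<^sup>2)" by (simp only: cc of_real_sum)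
  finally have pp: "(\<integral>x. (norm (p x))\<^sup>2 \<partial>lebesgue) = (\<Sum>\<xi>\<in>A. (norm (c \<xi>))\<^sup>2)"
    by (simp only: of_real_eq_iff)
  define s where "s = (\<Sum>\<xi>\<in>A. (norm (c \<xi>))\<^sup>2)"
  have s0: "s \<ge> 0" by (simp add: s_def sum_nonneg)
  have "(norm (complex_of_real s))\<^sup>2 \<le> (\<integral>x. (norm (f x))\<^sup>2 \<partial>lebesgue) * s"
    using Cauchy_Schwarz_integral[of f lebesgue p] f pL2 unfolding fp pp s_def by (simp add: L2_def)
  then have "s * s \<le> (\<integral>x. (norm (f x))\<^sup>2 \<partial>lebesgue) * s" by (simp add: power2_eq_square)
  then have "s \<le> (\<integral>x. (norm (f x))\<^sup>2 \<partial>lebesgue)"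
    using s0 by (cases "s = 0") (auto dest: mult_right_le_imp_le)
  then show ?thesis by (simp add: s_def c_def)
qed

lemma hermite_coeff_add:
  assumes "f \<in> L2" "g \<in> L2"
  shows "hermite_coeff (\<lambda>x. f x + g x) \<xi> = hermite_coeff f \<xi> + hermite_coeff g \<xi>"
  unfolding hermite_coeff_def distrib_right
  by (rule Bochner_Integration.integral_add; rule L2_mult_integrable[OF _ hermite_L2]; fact)

lemma hermite_coeff_cmult: "hermite_coeff (\<lambda>x. c * f x) \<xi> = c * hermite_coeff f \<xi>"
  unfolding hermite_coeff_def mult.assoc by (rule Bochner_Integration.integral_mult_right_zero)

lemma hermite_coeff_sum:
  assumes "finite S"
  shows "hermite_coeff (\<lambda>x. \<Sum>\<xi>\<in>S. c \<xi> * of_real (hermite \<xi> x)) \<eta> = (if \<eta> \<in> S then c \<eta> else 0)"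
proof -
  have "hermite_coeff (\<lambda>x. \<Sum>\<xi>\<in>S. c \<xi> * of_real (hermite \<xi> x)) \<eta>
     = (\<integral>x. (\<Sum>\<xi>\<in>S. c \<xi> * (of_real (hermite \<xi> x) * of_real (hermite \<eta> x))) \<partial>lebesgue)"
    unfolding hermite_coeff_def sum_distrib_right mult.assoc ..
  also have "\<dots> = (\<Sum>\<xi>\<in>S. \<integral>x. c \<xi> * (of_real (hermite \<xi> x) * of_real (hermite \<eta> x)) \<partial>lebesgue)"
    by (intro Bochner_Integration.integral_sum integrable_mult_right hermite_orthonormal_lebesgue)
  also have "\<dots> = (\<Sum>\<xi>\<in>S. if \<xi> = \<eta> then c \<xi> else 0)"
    unfolding Bochner_Integration.integral_mult_right_zero hermite_orthonormal_lebesgue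
    by (intro sum.cong refl) simp
  also have "\<dots> = (if \<eta> \<in> S then c \<eta> else 0)" using assms by simp
  finally show ?thesis .
qed

text \<open>
  The image of \<open>f\<close> is the limit of the images of its partial Hermite expansions. Since limits are
  determined almost everywhere only, an arbitrary one is chosen; uniqueness of limits makes the choice
  additive and homogeneous almost everywhere.
\<close>

lemma extension_by_hermite_expansion:
  fixes \<tau> :: "'n::finite multi_index \<Rightarrow> real ^ 'n \<Rightarrow> complex"
  assumes K: "K \<ge> 0" and \<tau>L2: "\<And>A c. finite A \<Longrightarrow> (\<lambda>x. \<Sum>\<xi>\<in>A. c \<xi> * \<tau> \<xi> x) \<in> L2"
    and \<tau>K: "\<And>A c. finite A \<Longrightarrow> (\<integral>x. (norm (\<Sum>\<xi>\<in>A. c \<xi> * \<tau> \<xi> x))\<^sup>2 \<partial>lebesgue) \<le> K * (\<Sum>\<xi>\<in>A. (norm (c \<xi>))\<^sup>2)"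
  obtains T where "bounded_operator_L2 T"
    "\<And>S c. finite S \<Longrightarrow> AE x in lebesgue. T (\<lambda>x. \<Sum>\<xi>\<in>S. c \<xi> * of_real (hermite \<xi> x)) x = (\<Sum>\<xi>\<in>S. c \<xi> * \<tau> \<xi> x)"
proof -
  \<comment> \<open>An exhaustion of the countable set of multi-indices by finite sets.\<close>
  define I where "I = (\<lambda>N::nat. {\<xi> :: 'n multi_index. to_nat \<xi> < N})"
  have I_fin: "finite (I N)" for N
  proof -
    have "finite (to_nat -` {..<N} :: 'n multi_index set)" by (rule finite_vimageI) simp_all
    moreover have "(to_nat -` {..<N} :: 'n multi_index set) = I N" by (auto simp: I_def)
    ultimately show ?thesis by simp
  qed
  have I_mono: "I M \<subseteq> I N" if "M \<le> N" for M N using that by (auto simp: I_def)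
  have I_exhaust: "\<exists>N. S \<subseteq> I N" if "finite S" for S
  proof -
    have "finite (to_nat ` S)" using that by simp
    then obtain N where "\<forall>k\<in>to_nat ` S. k < N" using finite_nat_set_iff_bounded by blast
    then show ?thesis by (auto simp: I_def)
  qed
  define P where "P = (\<lambda>c N x. \<Sum>\<xi>\<in>I N. c \<xi> * \<tau> \<xi> x)"
  have P_L2: "P c N \<in> L2" for c N unfolding P_def by (rule \<tau>L2[OF I_fin])
  define T where "T = (\<lambda>f. SOME F. L2_tendsto (P (hermite_coeff f)) F)"
  have T_lim: "L2_tendsto (P (hermite_coeff f)) (T f)" if "L2_tendsto (P (hermite_coeff f)) F" for f F
    unfolding T_def using that by (rule someI[of "L2_tendsto (P (hermite_coeff f))"])
  have conv: "L2_tendsto (P (hermite_coeff f)) (T f)" if f: "f \<in> L2" for f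
  proof -
    define c where "c = hermite_coeff f"
    define D where "D = (\<integral>x. (norm (f x))\<^sup>2 \<partial>lebesgue)"
    define r where "r = (\<lambda>N. \<Sum>\<xi>\<in>I N. (norm (c \<xi>))\<^sup>2)"
    have r_mono: "r M \<le> r N" if "M \<le> N" for M N
      unfolding r_def by (rule sum_mono2[OF I_fin I_mono[OF that]]) simp
    have r_bd: "r N \<le> D" for N unfolding r_def c_def D_def by (rule Bessel[OF f I_fin])
    have diff: "(\<integral>x. (norm (P c N x - P c M x))\<^sup>2 \<partial>lebesgue) \<le> K * (r N - r M)" if "M \<le> N" for M N
    proof -
      have "P c N x - P c M x = (\<Sum>\<xi>\<in>I N - I M. c \<xi> * \<tau> \<xi> x)" for x
        unfolding P_def using sum_diff[OF I_fin I_mono[OF that], of "\<lambda>\<xi>. c \<xi> * \<tau> \<xi> x"] by simp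
      then have "(\<integral>x. (norm (P c N x - P c M x))\<^sup>2 \<partial>lebesgue) \<le> K * (\<Sum>\<xi>\<in>I N - I M. (norm (c \<xi>))\<^sup>2)"
        using \<tau>K[of "I N - I M" c] I_fin by simp
      also have "(\<Sum>\<xi>\<in>I N - I M. (norm (c \<xi>))\<^sup>2) = r N - r M"
        unfolding r_def by (rule sum_diff[OF I_fin I_mono[OF that]])
      finally show ?thesis .
    qed
    \<comment> \<open>The sums of the squared coefficients converge, and they control the increments of \<open>P c\<close>.\<close>
    have "\<exists>F. L2_tendsto (P c) F"
    proof (rule L2_complete[OF P_L2])
      fix e :: real assume e: "e > 0"
      have "incseq r" using r_mono by (auto simp: incseq_def)
      then obtain l where "r \<longlonglongrightarrow> l" using incseq_convergent[of r D] r_bd by metis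
      then have "Cauchy r" by (rule LIMSEQ_imp_Cauchy)
      moreover have "e / (K + 1) > 0" using e K by simp
      ultimately obtain N where N: "\<And>m n. m \<ge> N \<Longrightarrow> n \<ge> N \<Longrightarrow> norm (r m - r n) < e / (K + 1)"
        using CauchyD[of r "e / (K + 1)"] by blast
      have small: "K * (r m - r n) \<le> e" if "m \<ge> N" "n \<ge> N" for m n
      proof -
        have "r m - r n \<le> e / (K + 1)" using N[OF that] by (simp add: abs_less_iff)
        then have "K * (r m - r n) \<le> K * (e / (K + 1))" using K by (rule mult_left_mono)
        also have "\<dots> \<le> e" using K e by (simp add: field_simps)
        finally show ?thesis .
      qed
      show "\<exists>N. \<forall>m\<ge>N. \<forall>n\<ge>N. (\<integral>x. (norm (P c m x - P c n x))\<^sup>2 \<partial>lebesgue) \<le> e"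
      proof (intro exI[of _ N] allI impI)
        fix m n assume mn: "m \<ge> N" "n \<ge> N"
        show "(\<integral>x. (norm (P c m x - P c n x))\<^sup>2 \<partial>lebesgue) \<le> e"
        proof (cases "n \<le> m")
          case True
          then show ?thesis using diff[OF True] small[OF mn] by linarith
        next
          case False
          then have "m \<le> n" by simp
          from diff[OF this] small[OF mn(2,1)] show ?thesis by (simp add: norm_minus_commute)
        qed
      qed
    qed
    then show ?thesis using T_lim unfolding c_def by blast
  qed
  have bound: "L2norm (T f) \<le> sqrt (2 * K) * L2norm f" if f: "f \<in> L2" for f
  proof -
    have "(\<integral>x. (norm (P (hermite_coeff f) N x))\<^sup>2 \<partial>lebesgue) \<le> K * (\<integral>x. (norm (f x))\<^sup>2 \<partial>lebesgue)" for N
      unfolding P_def using \<tau>K[OF I_fin, of "hermite_coeff f" N] mult_left_mono[OF Bessel[OF f I_fin] K] by (rule order_trans)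
    then have "(\<integral>x. (norm (T f x))\<^sup>2 \<partial>lebesgue) \<le> 2 * (K * (\<integral>x. (norm (f x))\<^sup>2 \<partial>lebesgue))"
      by (rule L2_tendsto_bound[OF conv[OF f]])
    then have "sqrt (\<integral>x. (norm (T f x))\<^sup>2 \<partial>lebesgue) \<le> sqrt (2 * K * (\<integral>x. (norm (f x))\<^sup>2 \<partial>lebesgue))"
      by (intro real_sqrt_le_mono) (simp add: mult.assoc)
    then show ?thesis by (simp add: L2norm_def real_sqrt_mult)
  qed
  have add: "AE x in lebesgue. T (\<lambda>y. f y + g y) x = T f x + T g x" if "f \<in> L2" "g \<in> L2" for f g
  proof -
    have "L2_tendsto (\<lambda>N x. P (hermite_coeff f) N x + P (hermite_coeff g) N x) (\<lambda>x. T f x + T g x)"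
      by (rule L2_tendsto_add[OF conv conv]) fact+
    moreover have "P (hermite_coeff (\<lambda>y. f y + g y)) = (\<lambda>N x. P (hermite_coeff f) N x + P (hermite_coeff g) N x)"
      unfolding P_def hermite_coeff_add[OF that] by (simp add: distrib_right sum.distrib fun_eq_iff)
    ultimately show ?thesis
      using L2_tendsto_unique[OF conv[OF L2_add(1)[OF that]]] by simp
  qed
  have cmult: "AE x in lebesgue. T (\<lambda>y. a * f y) x = a * T f x" if "f \<in> L2" for a f
  proof -
    have "L2_tendsto (\<lambda>N x. a * P (hermite_coeff f) N x) (\<lambda>x. a * T f x)"
      by (rule L2_tendsto_cmult[OF conv]) fact
    moreover have "P (hermite_coeff (\<lambda>y. a * f y)) = (\<lambda>N x. a * P (hermite_coeff f) N x)"
      unfolding P_def hermite_coeff_cmult by (simp add: sum_distrib_left mult.assoc fun_eq_iff)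
    ultimately show ?thesis
      using L2_tendsto_unique[OF conv[OF L2_cmult[OF that]]] by simp
  qed
  have "bounded_operator_L2 T"
    unfolding bounded_operator_L2_def
  proof (intro conjI ballI allI)
    show "T f \<in> L2" if "f \<in> L2" for f using conv[OF that] by (simp add: L2_tendsto_def)
    show "\<exists>B. \<forall>f\<in>L2. L2norm (T f) \<le> B * L2norm f" using bound by blast
  qed (fact add cmult)+
  moreover have "AE x in lebesgue. T (\<lambda>x. \<Sum>\<xi>\<in>S. c \<xi> * of_real (hermite \<xi> x)) x = (\<Sum>\<xi>\<in>S. c \<xi> * \<tau> \<xi> x)"
    if S: "finite S" for S c
  proof -
    let ?f = "\<lambda>x. \<Sum>\<xi>\<in>S. c \<xi> * of_real (hermite \<xi> x)"
    define W where "W = (\<lambda>x. \<Sum>\<xi>\<in>S. c \<xi> * \<tau> \<xi> x)"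
    obtain N where N: "S \<subseteq> I N" using I_exhaust[OF S] by blast
    have PW: "P (hermite_coeff ?f) k = W" if "k \<ge> N" for k
    proof
      fix x
      have "P (hermite_coeff ?f) k x = (\<Sum>\<xi>\<in>I k. if \<xi> \<in> S then c \<xi> * \<tau> \<xi> x else 0)"
        unfolding P_def hermite_coeff_sum[OF S] by (intro sum.cong refl) simp
      also have "\<dots> = (\<Sum>\<xi>\<in>I k \<inter> S. c \<xi> * \<tau> \<xi> x)" by (rule sum.inter_restrict[OF I_fin, symmetric])
      also have "I k \<inter> S = S" using N I_mono[OF that] by blast
      finally show "P (hermite_coeff ?f) k x = W x" by (simp add: W_def)
    qed
    have "(\<lambda>k. \<integral>x. (norm (P (hermite_coeff ?f) k x - W x))\<^sup>2 \<partial>lebesgue) \<longlonglongrightarrow> 0"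
      by (rule tendsto_eventually) (auto simp: eventually_sequentially PW intro!: exI[of _ N])
    then have "L2_tendsto (P (hermite_coeff ?f)) W"
      using P_L2 \<tau>L2[OF S, of c] by (simp add: L2_tendsto_def W_def)
    from L2_tendsto_unique[OF T_lim[OF this] this] show ?thesis by (simp add: W_def)
  qed
  ultimately show ?thesis by (rule that)
qed

text \<open>
  The weak derivative of order zero serves as a square-integrable representative \<open>u\<close> of the symbol, for
  which the estimates are proved; \<open>u\<close> is compared with \<open>\<sigma>\<close> almost everywhere only at the end, for the finitely
  many indices that occur in an element of the span.
\<close>

theorem theorem1p4:
  fixes \<sigma> :: "real ^ 'n::finite \<Rightarrow> 'n multi_index \<Rightarrow> complex"
  assumes "\<And>\<nu> :: 'n multi_index. mi_length \<nu> \<le> CARD('n) div 2 + 1 \<Longrightarrow>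
    \<exists>C. \<forall>\<xi>. \<exists>g. has_weak_derivative \<nu> (\<lambda>x. \<sigma> x \<xi>) g \<and> g \<in> L2 \<and> L2norm g \<le> C"
  shows "\<exists>T. bounded_operator_L2 T \<and>
    (\<forall>f\<in>hermite_span. AE x in lebesgue. T f x = pseudo_multiplier \<sigma> f x)"
proof -
  define s where "s = CARD('n) div 2 + 1"
  have s: "CARD('n) < 2 * s" by (simp add: s_def)
  let ?\<nu> = "\<lambda>j i. if i = j then s else (0::nat)"
  have "\<exists>C. \<forall>\<xi>. \<exists>g. has_weak_derivative (\<lambda>_. 0) (\<lambda>x. \<sigma> x \<xi>) g \<and> g \<in> L2 \<and> L2norm g \<le> C"
    by (rule assms) (simp add: mi_length_def)
  then obtain C0 where "\<forall>\<xi>. \<exists>g. has_weak_derivative (\<lambda>_. 0) (\<lambda>x. \<sigma> x \<xi>) g \<and> g \<in> L2 \<and> L2norm g \<le> C0" ..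
  then obtain u where u: "\<And>\<xi>. has_weak_derivative (\<lambda>_. 0) (\<lambda>x. \<sigma> x \<xi>) (u \<xi>)" "\<And>\<xi>. u \<xi> \<in> L2" "\<And>\<xi>. L2norm (u \<xi>) \<le> C0"
    by metis
  have "\<forall>j. \<exists>C. \<forall>\<xi>. \<exists>g. has_weak_derivative (?\<nu> j) (\<lambda>x. \<sigma> x \<xi>) g \<and> g \<in> L2 \<and> L2norm g \<le> C"
    using assms by (simp add: mi_length_def s_def)
  then obtain C where "\<forall>j \<xi>. \<exists>g. has_weak_derivative (?\<nu> j) (\<lambda>x. \<sigma> x \<xi>) g \<and> g \<in> L2 \<and> L2norm g \<le> C j" by metis
  then obtain g where g: "\<And>j \<xi>. has_weak_derivative (?\<nu> j) (\<lambda>x. \<sigma> x \<xi>) (g j \<xi>)" "\<And>j \<xi>. g j \<xi> \<in> L2"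
      "\<And>j \<xi>. L2norm (g j \<xi>) \<le> C j"
    by metis
  have mp0: "multi_partial (\<lambda>_. 0) \<phi> = \<phi>" for \<phi> :: "real ^ 'n \<Rightarrow> complex"
  proof -
    have "foldr (\<lambda>j. partial j ^^ 0) js \<phi> = \<phi>" for js :: "'n list" by (induction js) simp_all
    then show ?thesis by (simp add: multi_partial_def)
  qed
  have test_eq: "(\<integral>x. \<sigma> x \<xi> * \<phi> x \<partial>lebesgue) = (\<integral>x. u \<xi> x * \<phi> x \<partial>lebesgue)" if "test_function \<phi>" for \<xi> \<phi>
    using u(1)[of \<xi>] that unfolding has_weak_derivative_def mp0 by (simp add: mi_length_def)
  have ae: "AE x in lebesgue. \<sigma> x \<xi> = u \<xi> x" for \<xi>
    by (rule fundamental_lemma[OF _ _ test_eq]) (use u(1)[of \<xi>] in \<open>auto simp: has_weak_derivative_def\<close>)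
  have wd: "weak_pure_derivative s j (u \<xi>) (g j \<xi>)" for j \<xi>
    unfolding weak_pure_derivative_def
  proof (intro allI impI)
    fix f :: "'n \<Rightarrow> real \<Rightarrow> real" assume f: "\<forall>i. bump (f i)"
    have tf: "test_function (tensor (f(j := (deriv ^^ s) (f j))))"
      by (rule test_function_tensor) (use f bump_deriv in simp)
    have "(\<integral>x. \<sigma> x \<xi> * tensor (f(j := (deriv ^^ s) (f j))) x \<partial>lebesgue) = (-1) ^ s * (\<integral>x. g j \<xi> x * tensor f x \<partial>lebesgue)"
      using weak_pure_derivativeI[OF g(1)[of j \<xi>]] f unfolding weak_pure_derivative_def by blast
    then show "(\<integral>x. u \<xi> x * tensor (f(j := (deriv ^^ s) (f j))) x \<partial>lebesgue) = (-1) ^ s * (\<integral>x. g j \<xi> x * tensor f x \<partial>lebesgue)"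
      by (simp only: test_eq[OF tf])
  qed
  define B where "B = C0\<^sup>2 + (\<Sum>j\<in>UNIV. (C j)\<^sup>2)"
  have sq: "(\<integral>x. (norm (v x))\<^sup>2 \<partial>lebesgue) \<le> c\<^sup>2" if "L2norm v \<le> c" for v :: "real ^ 'n \<Rightarrow> complex" and c
    using power_mono[OF that L2norm_nonneg, of 2] by (simp add: L2norm_def)
  have uB: "(\<integral>x. (norm (u \<xi> x))\<^sup>2 \<partial>lebesgue) \<le> B" for \<xi>
    using sq[OF u(3)[of \<xi>]] sum_nonneg[of UNIV "\<lambda>j. (C j)\<^sup>2"] by (simp add: B_def)
  have gB: "(\<integral>x. (norm (g j \<xi> x))\<^sup>2 \<partial>lebesgue) \<le> B" for j \<xi>
  proof -
    have "(C j)\<^sup>2 \<le> (\<Sum>j\<in>UNIV. (C j)\<^sup>2)" by (rule member_le_sum) auto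
    moreover have "(\<integral>x. (norm (g j \<xi> x))\<^sup>2 \<partial>lebesgue) \<le> (C j)\<^sup>2" by (rule sq[OF g(3)])
    moreover have "0 \<le> C0\<^sup>2" by simp
    ultimately show ?thesis unfolding B_def by linarith
  qed
  define \<tau> where "\<tau> \<xi> x = of_real (hermite \<xi> x) * u \<xi> x" for \<xi> x
  obtain K where K: "K \<ge> 0"
    "\<And>A c. finite A \<Longrightarrow> (\<lambda>x. \<Sum>\<xi>\<in>A. c \<xi> * (of_real (hermite \<xi> x) * u \<xi> x)) \<in> L2"
    "\<And>A c. finite A \<Longrightarrow> (\<integral>x. (norm (\<Sum>\<xi>\<in>A. c \<xi> * (of_real (hermite \<xi> x) * u \<xi> x)))\<^sup>2 \<partial>lebesgue) \<le> K * (\<Sum>\<xi>\<in>A. (norm (c \<xi>))\<^sup>2)"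
    by (rule pseudo_multiplier_bound[of u "\<lambda>\<xi> j. g j \<xi>" s B, OF u(2) g(2) wd s uB gB]) (rule that)
  obtain T where T: "bounded_operator_L2 T"
    "\<And>S c. finite S \<Longrightarrow> AE x in lebesgue. T (\<lambda>x. \<Sum>\<xi>\<in>S. c \<xi> * of_real (hermite \<xi> x)) x = (\<Sum>\<xi>\<in>S. c \<xi> * \<tau> \<xi> x)"
    by (rule extension_by_hermite_expansion[of K \<tau>, OF K(1) K(2,3)[folded \<tau>_def]]) (assumption | rule that)+
  have "AE x in lebesgue. T f x = pseudo_multiplier \<sigma> f x" if fs: "f \<in> hermite_span" for f
  proof -
    obtain S c where S: "finite S" and f: "f = (\<lambda>x. \<Sum>\<xi>\<in>S. c \<xi> * of_real (hermite \<xi> x))"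
      using fs unfolding hermite_span_def by blast
    have "AE x in lebesgue. \<forall>\<xi>\<in>S. \<sigma> x \<xi> = u \<xi> x" using S ae by (simp add: AE_finite_all)
    with T(2)[OF S, of c] show ?thesis
    proof eventually_elim
      case (elim x)
      have "pseudo_multiplier \<sigma> f x = (\<Sum>\<^sub>\<infinity>\<xi>\<in>S. \<sigma> x \<xi> * hermite_coeff f \<xi> * of_real (hermite \<xi> x))"
        unfolding pseudo_multiplier_def f
        by (rule infsum_cong_neutral) (auto simp: hermite_coeff_sum[OF S])
      also have "\<dots> = (\<Sum>\<xi>\<in>S. \<sigma> x \<xi> * hermite_coeff f \<xi> * of_real (hermite \<xi> x))" using S by simp
      also have "\<dots> = (\<Sum>\<xi>\<in>S. c \<xi> * \<tau> \<xi> x)"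
        using elim(2) by (intro sum.cong refl) (simp add: f hermite_coeff_sum[OF S] \<tau>_def mult_ac)
      finally show ?case using elim(1) by (simp add: f)
    qed
  qed
  with T(1) show ?thesis by blast
qed

end
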